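(* Let $a_1,a_2,a_3,b_1,b_2,b_3$ be generic parameters with $a_1a_2a_3b_1b_2b_3=q$, let $t=a_1a_2a_3=q/(b_1b_2b_3)$, and let $M_1,M_2,M_3,N_1,N_2,N_3$ be integers with $M_1+M_2+M_3=N_1+N_2+N_3=0$. Let $W$ and $\mathbf K$ be the space and functional defined in the context for the parameters $(a_j,b_j)$, and let $W'$ and $\mathbf K'$ be the objects obtained from these by replacing $a_j$ by $a_jq^{M_j}$ and $b_j$ by $b_jq^{N_j}$ for $j=1,2,3$. Then, for $f\in W$ and $g\in W'$, $$\sum_{x=-\infty}^\infty\oint\prod_{j=1}^3\frac{(q^{1+x/2}/a_jz,\,q^{1-x/2}z/b_j)_\infty}{(q^{M_j+x/2}a_jz,\,q^{N_j-x/2}b_j/z)_\infty}\left(-\frac{q^{1/2}}{tz^3}\right)^x f(q^{-x/2}z)\,g(q^{x/2}z)\,\frac{dz}{2\pi\mathrm i z}$$ $$=\frac{1}{\prod_{j=1}^3q^{\binom{M_j}2+\binom{N_j}2}a_j^{M_j}b_j^{N_j}}\prod_{i,j=1}^3\frac{(q/a_ib_j)_\infty}{(a_ib_jq^{M_i+N_j})_\infty}\;\mathbf K(f)\,\mathbf K'(g).$$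
   Context: Throughout, $q$ is a fixed complex number with $0<|q|<1$, with a fixed choice of square root $q^{1/2}$ (the base $q$ is suppressed from the notation). For $k\in\mathbb Z_{\ge 0}$, $(a)_k=(1-a)(1-aq)\cdots(1-aq^{k-1})$; for $k\in\mathbb Z_{<0}$, $(a)_k=\left((1-aq^{-1})\cdots(1-aq^{k})\right)^{-1}$; $(a)_\infty=\prod_{j=0}^\infty(1-aq^j)$. Repeated arguments denote products, e.g. $(x,y)_\infty=(x)_\infty(y)_\infty$; $q^{1+x/2}/a_jz$ means $q^{1+x/2}/(a_jz)$ and $q/a_ib_j$ means $q/(a_ib_j)$. $W$ is the space of rational functions in $z$ that are regular everywhere (including at $0$ and at infinity) except for possible single (simple) poles at $z\in a_j^{-1}q^{\mathbb Z_{>0}}$ and $z\in b_jq^{\mathbb Z_{<0}}$, $1\leq j\leq 3$. It is spanned by the functions $$h(z)=z^{-T}\prod_{j=1}^3(a_jz)_{k_j}(b_j/z)_{l_j},$$ where $k_j,l_j,T$ are integers with $T=k_1+k_2+k_3=-l_1-l_2-l_3$. The (Al-Salam--Ismail) functional $\mathbf K$ is the linear functional on $W$ determined by its values on these spanning functions, $$\mathbf K(h)=\frac{(-t)^Tq^{\binom T2}\prod_{i,j=1}^3(a_ib_j)_{k_i+l_j}}{\prod_{j=1}^3q^{\binom{k_j}2+\binom{l_j}2}a_j^{k_j}b_j^{l_j}}.$$ Generic means $a_i/a_j,\ b_i/b_j\notin q^{\mathbb Z}$ for $i\neq j$ and $a_ib_j\notin q^{\mathbb Z}$ for all $i,j$.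 For each $x$, the integration is over a positively oriented contour (depending on $x$, $f$, $g$) separating the geometric sequences of poles of the integrand tending to $0$ (inside the contour) from those tending to $\infty$ (outside); that is, poles of the form $z\in b_jq^{-x/2}q^{\mathbb Z}$ are inside and poles of the form $z\in a_j^{-1}q^{-x/2}q^{\mathbb Z}$ are outside. *)

theory Defs
  imports
    "HOL-Complex_Analysis.Complex_Analysis"
    "HOL-Computational_Algebra.Computational_Algebra"
    "HOL-Computational_Algebra.Field_as_Ring"
begin

text \<open>
  The base \<open>q\<close> and a square root \<open>s\<close> of \<open>q\<close> are explicit arguments, so that
  \<open>q\<^sup>x\<^sup>/\<^sup>2\<close> is \<open>s powi x\<close>. The parameters \<open>a\<close>, \<open>b\<close>, \<open>M\<close>, \<open>N\<close> are sequences of which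
  only the entries with index in \<open>{1..3}\<close> are used.
\<close>

text \<open>Polymorphic, because it is used both in \<open>\<complex>\<close> and in the field of rational functions.\<close>

definition qpoch :: "'a::field \<Rightarrow> 'a \<Rightarrow> int \<Rightarrow> 'a" where
  "qpoch q a k =
     (if k \<ge> 0 then \<Prod>i<nat k. 1 - a * q ^ i
      else inverse (\<Prod>i=1..nat (- k). 1 - a / q ^ i))"

definition qpoch_inf :: "complex \<Rightarrow> complex \<Rightarrow> complex" where
  "qpoch_inf q a = (\<Prod>j. 1 - a * q ^ j)"

text \<open>The binomial coefficient \<open>k (k - 1) / 2\<close> for an arbitrary integer \<open>k\<close>.\<close>

definition choose2 :: "int \<Rightarrow> int" where
  "choose2 k = k * (k - 1) div 2"

text \<open>
  Rational functions of one variable are the elements of the fraction field of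
  \<^typ>\<open>complex poly\<close>. Numerator and denominator below are coprime, so the poles in \<open>\<complex>\<close>
  are the roots of the denominator, with the same orders.
\<close>

type_synonym ratfun = "complex poly fract"

definition rf_num :: "ratfun \<Rightarrow> complex poly" where
  "rf_num F = fst (quot_of_fract F)"

definition rf_den :: "ratfun \<Rightarrow> complex poly" where
  "rf_den F = snd (quot_of_fract F)"

text \<open>Has the junk value 0 at the poles.\<close>

definition rf_eval :: "ratfun \<Rightarrow> complex \<Rightarrow> complex" where
  "rf_eval F z = poly (rf_num F) z / poly (rf_den F) z"

definition rf_const :: "complex \<Rightarrow> ratfun" where
  "rf_const c = to_fract [:c:]"

definition rf_Z :: ratfun where
  "rf_Z = to_fract [:0, 1:]"

text \<open>The degree condition is regularity at infinity.\<close>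

definition W_space :: "complex \<Rightarrow> (nat \<Rightarrow> complex) \<Rightarrow> (nat \<Rightarrow> complex) \<Rightarrow> ratfun set" where
  "W_space q a b =
     {F. degree (rf_num F) \<le> degree (rf_den F) \<and>
         (\<forall>z. poly (rf_den F) z = 0 \<longrightarrow>
            order z (rf_den F) = 1 \<and>
            (\<exists>j\<in>{1..3}. \<exists>k::int. (k > 0 \<and> z = inverse (a j) * q powi k) \<or>
                                (k < 0 \<and> z = b j * q powi k)))}"

definition h_fun ::
  "complex \<Rightarrow> (nat \<Rightarrow> complex) \<Rightarrow> (nat \<Rightarrow> complex) \<Rightarrow> (nat \<Rightarrow> int) \<Rightarrow> (nat \<Rightarrow> int) \<Rightarrow> ratfun" where
  "h_fun q a b k l =
     rf_Z powi (- (\<Sum>j=1..3. k j)) *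
     (\<Prod>j=1..3. qpoch (rf_const q) (rf_const (a j) * rf_Z) (k j) *
               qpoch (rf_const q) (rf_const (b j) / rf_Z) (l j))"

definition K_value ::
  "complex \<Rightarrow> (nat \<Rightarrow> complex) \<Rightarrow> (nat \<Rightarrow> complex) \<Rightarrow> (nat \<Rightarrow> int) \<Rightarrow> (nat \<Rightarrow> int) \<Rightarrow> complex" where
  "K_value q a b k l =
     (let t = (\<Prod>j=1..3. a j); T = (\<Sum>j=1..3. k j) in
      (- t) powi T * q powi choose2 T *
      (\<Prod>i=1..3. \<Prod>j=1..3. qpoch q (a i * b j) (k i + l j)) /
      (\<Prod>j=1..3. q powi (choose2 (k j) + choose2 (l j)) * a j powi k j * b j powi l j))"

text \<open>
  The values outside \<open>W\<close> are fixed to be 0, so that a linear functional on \<open>W\<close> corresponds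
  to exactly one HOL function. No existence or uniqueness is assumed here.
\<close>

definition is_K_functional ::
  "complex \<Rightarrow> (nat \<Rightarrow> complex) \<Rightarrow> (nat \<Rightarrow> complex) \<Rightarrow> (ratfun \<Rightarrow> complex) \<Rightarrow> bool" where
  "is_K_functional q a b L \<longleftrightarrow>
     (\<forall>F\<in>W_space q a b. \<forall>G\<in>W_space q a b. L (F + G) = L F + L G) \<and>
     (\<forall>c. \<forall>F\<in>W_space q a b. L (rf_const c * F) = c * L F) \<and>
     (\<forall>F. F \<notin> W_space q a b \<longrightarrow> L F = 0) \<and>
     (\<forall>k l. (\<Sum>j=1..3. k j) = - (\<Sum>j=1..3. l j) \<longrightarrow>
            L (h_fun q a b k l) = K_value q a b k l)"

definition K_functional ::
  "complex \<Rightarrow> (nat \<Rightarrow> complex) \<Rightarrow> (nat \<Rightarrow> complex) \<Rightarrow> ratfun \<Rightarrow> complex" where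
  "K_functional q a b = (THE L. is_K_functional q a b L)"

definition generic_params :: "complex \<Rightarrow> (nat \<Rightarrow> complex) \<Rightarrow> (nat \<Rightarrow> complex) \<Rightarrow> bool" where
  "generic_params q a b \<longleftrightarrow>
     (\<forall>i\<in>{1..3}. \<forall>j\<in>{1..3}. i \<noteq> j \<longrightarrow>
        a i / a j \<notin> range (\<lambda>k::int. q powi k) \<and> b i / b j \<notin> range (\<lambda>k::int. q powi k)) \<and>
     (\<forall>i\<in>{1..3}. \<forall>j\<in>{1..3}. a i * b j \<notin> range (\<lambda>k::int. q powi k))"

text \<open>The integrand with respect to \<open>dz\<close>, i.e. including the factor \<open>1 / (2 \<pi> \<i> z)\<close>.\<close>

definition integrand ::
  "complex \<Rightarrow> complex \<Rightarrow> complex \<Rightarrow> (nat \<Rightarrow> complex) \<Rightarrow> (nat \<Rightarrow> complex) \<Rightarrow>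
   (nat \<Rightarrow> int) \<Rightarrow> (nat \<Rightarrow> int) \<Rightarrow> ratfun \<Rightarrow> ratfun \<Rightarrow> int \<Rightarrow> complex \<Rightarrow> complex" where
  "integrand q s t a b M N f g x z =
     ((\<Prod>j=1..3.
         (qpoch_inf q (q * s powi x / (a j * z)) * qpoch_inf q (q * s powi (- x) * z / b j)) /
         (qpoch_inf q (q powi M j * s powi x * a j * z) *
          qpoch_inf q (q powi N j * s powi (- x) * b j / z))) *
      (- s / (t * z ^ 3)) powi x *
      rf_eval f (s powi (- x) * z) * rf_eval g (s powi x * z) / (2 * of_real pi * \<i> * z))"

text \<open>
  \<open>\<gamma>\<close> is a positively oriented simple closed contour for the integrand \<open>I\<close> with index \<open>x\<close>.
  The sequences \<open>b\<^sub>j q\<^sup>-\<^sup>x\<^sup>/\<^sup>2 q\<^sup>k\<close> and \<open>a\<^sub>j\<^sup>-\<^sup>1 q\<^sup>-\<^sup>x\<^sup>/\<^sup>2 q\<^sup>k\<close> run over all integers \<open>k\<close>, hence each accumulates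
  both at 0 and at infinity; only those members that really are poles of \<open>I\<close> constrain \<open>\<gamma>\<close>.
  The accumulation point 0 of the poles inside \<open>\<gamma>\<close> has to be inside as well.
\<close>

definition separating_contour ::
  "complex \<Rightarrow> complex \<Rightarrow> (nat \<Rightarrow> complex) \<Rightarrow> (nat \<Rightarrow> complex) \<Rightarrow> int \<Rightarrow>
   (complex \<Rightarrow> complex) \<Rightarrow> (real \<Rightarrow> complex) \<Rightarrow> bool" where
  "separating_contour q s a b x I \<gamma> \<longleftrightarrow>
     valid_path \<gamma> \<and> simple_path \<gamma> \<and> pathfinish \<gamma> = pathstart \<gamma> \<and>
     0 \<in> inside (path_image \<gamma>) \<and> winding_number \<gamma> 0 = 1 \<and>
     (\<forall>j\<in>{1..3}. \<forall>k::int.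
        (is_pole I (b j * s powi (- x) * q powi k) \<longrightarrow>
           b j * s powi (- x) * q powi k \<in> inside (path_image \<gamma>)) \<and>
        (is_pole I (inverse (a j) * s powi (- x) * q powi k) \<longrightarrow>
           inverse (a j) * s powi (- x) * q powi k \<in> outside (path_image \<gamma>)))"

end

theory Submission
  imports Defs
begin



text \<open>
  Write \<open>u = q\<^sup>x\<^sup>/\<^sup>2 z\<close> and \<open>v = q\<^sup>-\<^sup>x\<^sup>/\<^sup>2 z\<close>, let \<open>Lam v\<close> be the product of the quotients
  \<open>(qv/b\<^sub>j)\<^sub>\<infinity> / (a\<^sub>jv)\<^sub>\<infinity>\<close> and \<open>Theta u\<close> the product of the \<open>theta (a\<^sub>ju) / theta (b\<^sub>j/u)\<close>. Quasi-periodicity of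
  the theta function turns the integrand into a constant times
  \<open>q\<^sup>-\<^sup>x Theta(u) (Lam f)(v) (Lam' g)(u) / (2\<pi>\<i>z)\<close>, where \<open>Lam'\<close> belongs to the shifted parameters
  (lemma \<open>integrand_eq\<close>). The poles inside the contour lie where \<open>u = b\<^sub>jq\<^sup>m\<close>, hence \<open>v = b\<^sub>jq\<^sup>m\<^sup>-\<^sup>x\<close>. Because
  \<open>Theta (qu) = q\<^sup>2 Theta u\<close>, the residue is a product of a function of \<open>u\<close> and one of \<open>v\<close>, and summing over
  \<open>x\<close> and \<open>m\<close> decouples the two: the left-hand side is \<open>\<Sum>\<^sub>j w\<^sub>j I\<^sub>j(f) I'\<^sub>j(g)\<close> with the Jackson sums
  \<open>I\<^sub>j(f) = \<Sum>\<^sub>k b\<^sub>jq\<^sup>k (Lam f)(b\<^sub>jq\<^sup>k)\<close> over all integers \<open>k\<close>.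
  
  For \<open>f = 1\<close> the nonterminating q-Saalschuetz formula evaluates the differences of these sums as
  explicit products, \<open>I\<^sub>i - I\<^sub>j = Delta i j k\<close> with \<open>k\<close> the third index (lemma \<open>saalschuetz\<close>). Multiplying
  \<open>Lam\<close> by one of the functions that span \<open>W\<close> only shifts the parameters, so
  \<open>I\<^sub>i(f) - I\<^sub>j(f) = Delta i j k K(f)\<close> for every \<open>f\<close> in \<open>W\<close>; this both shows that \<open>K\<close> exists and computes it
  (lemmas \<open>Delta_shift\<close>, \<open>W_induct\<close>, \<open>K_functional_K_data\<close>).
  
  The weights \<open>w\<^sub>1, w\<^sub>2, w\<^sub>3\<close> turn out to be proportional to \<open>Delta 2 3 1\<close>, \<open>Delta 3 1 2\<close>, \<open>Delta 1 2 3\<close>, and the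
  sum of these three numbers is zero, being a telescoping sum of differences of the \<open>I\<^sub>j(1)\<close>. Therefore
  everything that is not a difference drops out of \<open>\<Sum>\<^sub>j w\<^sub>j I\<^sub>j(f) I'\<^sub>j(g)\<close>, and a product of explicit factors
  with \<open>K(f) K'(g)\<close> remains (lemma \<open>weighted_sum\<close>).
  
  For a single \<open>x\<close> the poles accumulate at 0. The residue theorem is applied between the contour and
  the circles \<open>|z| = \<rho> |q|\<^sup>n\<close>; the integrals over these circles tend to 0, again by
  \<open>Theta (qu) = q\<^sup>2 Theta u\<close> (lemmas \<open>contour_integral_eq_residue_sum\<close>, \<open>circle_integrals_vanish\<close>).
\<close>

section \<open>Infinite products and theta functions in base q\<close>

lemma two_choose2: "2 * choose2 k = k * (k - 1)"
  unfolding choose2_def by (rule dvd_mult_div_cancel) (cases "even k"; simp)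

lemma choose2_add: "choose2 (m + n) = choose2 m + choose2 n + m * n"
proof -
  have "2 * choose2 (m + n) = 2 * (choose2 m + choose2 n + m * n)"
    unfolding distrib_left two_choose2 by (simp add: algebra_simps)
  thus ?thesis by simp
qed

lemma choose2_0 [simp]: "choose2 0 = 0" and choose2_1 [simp]: "choose2 1 = 0"
  by (simp_all add: choose2_def)

lemma choose2_minus: "choose2 (- k) = choose2 k + k"
  using two_choose2[of "-k"] two_choose2[of k] by (simp add: algebra_simps)

lemma prod_1_3: "(\<Prod>j=1..3. f j) = f 1 * f 2 * f (3::nat)"
  by (simp add: numeral_3_eq_3 numeral_2_eq_2)

lemma sum_1_3: "(\<Sum>j=1..3. f j) = f 1 + f 2 + f (3::nat)"
  by (simp add: numeral_3_eq_3 numeral_2_eq_2 add.assoc)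

lemma qpoch_0 [simp]: "qpoch q a 0 = 1"
  by (simp add: qpoch_def)

lemma qpoch_step:
  fixes q a :: "'a::field"
  assumes "q \<noteq> 0" "k < 0 \<Longrightarrow> 1 - a * q powi k \<noteq> 0"
  shows "qpoch q a (k + 1) = qpoch q a k * (1 - a * q powi k)"
proof (cases "k \<ge> 0")
  case True
  then obtain n where "k = int n" by (metis nat_0_le)
  moreover have "nat (int n + 1) = Suc n" by simp
  ultimately show ?thesis by (simp add: qpoch_def)
next
  case False
  then obtain n where n: "k = - int (Suc n)" by (metis not_le zero_less_imp_eq_int minus_equation_iff neg_0_less_iff_less gr0_implies_Suc)
  have p: "q powi k = 1 / q ^ Suc n"
    unfolding n power_int_minus power_int_of_nat by (rule inverse_eq_divide)
  have "nat (- k) = Suc n" using n by simp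
  hence "qpoch q a k = inverse ((\<Prod>i=1..n. 1 - a / q ^ i) * (1 - a / q ^ Suc n))"
    using False by (simp add: qpoch_def)
  moreover have "qpoch q a (k + 1) = inverse (\<Prod>i=1..n. 1 - a / q ^ i)"
  proof -
    have "k + 1 = - int n" using n by simp
    thus ?thesis by (cases "n = 0") (simp_all add: qpoch_def)
  qed
  ultimately show ?thesis using assms(2) False p by (simp add: divide_inverse)
qed

locale q_base =
  fixes q :: complex
  assumes q_pos: "0 < norm q" and q_lt_1: "norm q < 1"
begin

abbreviation P where "P \<equiv> qpoch_inf q"

abbreviation qZ :: "complex set" where "qZ \<equiv> range (\<lambda>k::int. q powi k)"

definition theta where "theta x = P x * P (q / x)"

lemma q_nz [simp]: "q \<noteq> 0"
  using q_pos by auto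

lemma P_convergent: "convergent_prod (\<lambda>j. 1 - x * q ^ j)"
proof -
  have "summable (\<lambda>j. norm x * norm q ^ j)"
    using q_lt_1 by (intro summable_mult summable_geometric) auto
  hence "summable (\<lambda>j. norm ((1 - x * q ^ j) - 1))"
    by (simp add: norm_mult norm_power)
  thus ?thesis
    by (intro abs_convergent_prod_imp_convergent_prod summable_imp_abs_convergent_prod)
qed

lemma P_rec: "P x = (1 - x) * P (q * x)"
proof -
  have "P x = (\<Prod>k<1. 1 - x * q ^ k) * (\<Prod>k. 1 - x * q ^ (k + 1))"
    unfolding qpoch_inf_def
    using has_prod_unique[OF has_prod_ignore_initial_segment'[OF P_convergent, of x 1]] by simp
  thus ?thesis by (simp add: qpoch_inf_def mult_ac)
qed

lemma P_0 [simp]: "P 0 = 1"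
  by (simp add: qpoch_inf_def)

lemma P_eq_0_iff: "P x = 0 \<longleftrightarrow> (\<exists>n. x * q ^ n = 1)"
proof -
  have "P x = 0 \<longleftrightarrow> 0 \<in> range (\<lambda>j. 1 - x * q ^ j)"
    unfolding qpoch_inf_def
    by (rule has_prod_eq_0_iff[OF convergent_prod_has_prod[OF P_convergent]])
  thus ?thesis by (auto simp: image_iff)
qed

lemma P_1 [simp]: "P 1 = 0"
  unfolding P_eq_0_iff by (intro exI[of _ 0]) simp

lemma P_nz: "x \<notin> qZ \<Longrightarrow> P x \<noteq> 0"
proof
  assume x: "x \<notin> qZ" and "P x = 0"
  then obtain n where "x * q ^ n = 1" unfolding P_eq_0_iff by auto
  hence "x = q powi (- int n)" by (simp add: power_int_minus field_simps)
  with x show False by auto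
qed

lemma P_holomorphic: "P holomorphic_on A"
proof -
  have "P holomorphic_on UNIV"
  proof (rule holomorphic_uniform_sequence[where f = "\<lambda>n x. \<Prod>k<n. 1 + (- x * q ^ k)"])
    fix x :: complex
    have "uniformly_convergent_on (cball x 1) (\<lambda>N x. \<Prod>n<N. 1 + (- x * q ^ n))"
    proof (rule uniformly_convergent_on_prod)
      show "uniformly_convergent_on (cball x 1) (\<lambda>N x. \<Sum>n<N. norm (- x * q ^ n))"
      proof (rule Weierstrass_m_test'[where M = "\<lambda>n. (norm x + 1) * norm q ^ n"])
        show "summable (\<lambda>n. (norm x + 1) * norm q ^ n)"
          using q_lt_1 by (intro summable_mult summable_geometric) auto
        fix n y assume "y \<in> cball x 1"
        hence "norm y \<le> norm x + 1"
          using norm_triangle_ineq2[of y x] by (simp add: dist_norm norm_minus_commute)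
        thus "norm (norm (- y * q ^ n)) \<le> (norm x + 1) * norm q ^ n"
          by (simp add: norm_mult norm_power mult_right_mono)
      qed
    qed (auto intro!: continuous_intros)
    moreover have "P y = lim (\<lambda>N. \<Prod>n<N. 1 + (- y * q ^ n))" for y
      unfolding qpoch_inf_def
      using convergent_prod_LIMSEQ[OF P_convergent[of y]]
      by (intro limI[symmetric]) (simp add: LIMSEQ_lessThan_iff_atMost)
    ultimately have "uniform_limit (cball x 1) (\<lambda>N x. \<Prod>n<N. 1 + (- x * q ^ n)) P sequentially"
      by (subst (asm) uniformly_convergent_uniform_limit_iff) presburger
    thus "\<exists>d>0. cball x d \<subseteq> UNIV \<and>
        uniform_limit (cball x d) (\<lambda>n x. \<Prod>k<n. 1 + (- x * q ^ k)) P sequentially"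
      by (intro exI[of _ 1]) auto
  qed (auto intro!: holomorphic_intros)
  thus ?thesis by (rule holomorphic_on_subset) auto
qed

lemma P_analytic: "f analytic_on A \<Longrightarrow> (\<lambda>z. P (f z)) analytic_on A"
proof -
  assume "f analytic_on A"
  moreover have "P analytic_on f ` A" 
    using P_holomorphic[of UNIV] analytic_on_open[of UNIV P] analytic_on_subset by blast
  ultimately have "(P o f) analytic_on A" by (rule analytic_on_compose)
  thus ?thesis by (simp add: o_def)
qed

lemma P_isCont: "isCont P x"
  using P_holomorphic[of UNIV] holomorphic_on_imp_continuous_on
  by (metis UNIV_I continuous_on_eq_continuous_at open_UNIV)

lemma P_tendsto: "(f \<longlongrightarrow> x) F \<Longrightarrow> ((\<lambda>z. P (f z)) \<longlongrightarrow> P x) F"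
  by (rule isCont_tendsto_compose[OF P_isCont])

lemma q_pow_tendsto_0: "(\<lambda>n. q ^ n) \<longlonglongrightarrow> 0"
  using q_lt_1 by (rule LIMSEQ_power_zero)

lemma P_powi_step:
  assumes "x \<notin> qZ"
  shows "P (x * q powi k) * qpoch q x k = P x"
proof -
  have nz: "1 - x * q powi k \<noteq> 0" for k
  proof
    assume "1 - x * q powi k = 0"
    hence "x = q powi (-k)" by (simp add: power_int_minus field_simps)
    with assms show False by auto
  qed
  have step: "P (x * q powi (k + 1)) * qpoch q x (k + 1) = P (x * q powi k) * qpoch q x k" for k
    using P_rec[of "x * q powi k"] qpoch_step[of q k x] nz[of k]
    by (simp add: power_int_add mult_ac)
  show ?thesis
  proof (induction k rule: int_induct[where k = 0])
    case (step2 i)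
    thus ?case using step[of "i - 1"] by simp
  qed (use step in auto)
qed

lemma theta_q_mult:
  assumes "x \<noteq> 0" shows "theta (q * x) = - theta x / x"
proof -
  have "P (1 / x) = (1 - 1 / x) * P (q / x)"
    using P_rec[of "1 / x"] by simp
  moreover have "theta (q * x) = P (q * x) * P (1 / x)"
    by (simp add: theta_def)
  moreover have "theta x = (1 - x) * P (q * x) * P (q / x)"
    using P_rec[of x] by (simp add: theta_def)
  ultimately show ?thesis using assms by (simp add: divide_simps) algebra
qed

lemma theta_q_div: "x \<noteq> 0 \<Longrightarrow> theta (q / x) = theta x"
  by (simp add: theta_def)

lemma theta_inverse: "x \<noteq> 0 \<Longrightarrow> theta (1 / x) = - theta x / x"
  using theta_q_mult[of x] theta_q_div[of "q * x"] by simp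

lemma theta_powi:
  assumes "x \<noteq> 0"
  shows "theta (x * q powi k) = (- 1 / x) powi k * q powi (- choose2 k) * theta x"
proof -
  let ?R = "\<lambda>k. (- 1 / x) powi k * q powi (- choose2 k) * theta x"
  have l: "theta (x * q powi (k + 1)) = - theta (x * q powi k) / (x * q powi k)" for k
    using theta_q_mult[of "x * q powi k"] assms by (simp add: power_int_add mult_ac)
  have r: "?R (k + 1) = - ?R k / (x * q powi k)" for k
  proof -
    have "- choose2 (k + 1) = - choose2 k + - k" by (simp add: choose2_add)
    hence e: "q powi (- choose2 (k + 1)) = q powi (- choose2 k) * inverse (q powi k)"
      by (metis power_int_add power_int_minus q_nz)
    have "(- 1 / x) powi (k + 1) = (- 1 / x) powi k * (- 1 / x)"
      using assms by (simp add: power_int_add)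
    thus ?thesis unfolding e by (simp add: field_simps)
  qed
  show ?thesis
  proof (induction k rule: int_induct[where k = 0])
    case (step1 i)
    thus ?case using l[of i] r[of i] by simp
  next
    case (step2 i)
    have "- theta (x * q powi (i-1)) / (x * q powi (i-1)) = - ?R (i-1) / (x * q powi (i-1))"
      using l[of "i-1"] r[of "i-1"] step2 by simp
    thus ?case using assms by simp
  qed auto
qed

lemma theta_eq_0_iff:
  assumes "x \<noteq> 0" shows "theta x = 0 \<longleftrightarrow> x \<in> qZ"
proof
  assume "theta x = 0"
  then consider n where "x * q ^ n = 1" | n where "q / x * q ^ n = 1"
    unfolding theta_def by (auto simp: P_eq_0_iff)
  thus "x \<in> qZ"
  proof cases
    case (1 n)
    hence "x = q powi (- int n)" by (simp add: power_int_minus field_simps)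
    thus ?thesis by auto
  next
    case (2 n)
    hence "x = q ^ Suc n" using assms by (simp add: field_simps)
    hence "x = q powi int (Suc n)" by (simp only: power_int_of_nat)
    thus ?thesis by blast
  qed
next
  assume "x \<in> qZ"
  then obtain k where "x = 1 * q powi k" by auto
  thus "theta x = 0" using theta_powi[of 1 k] by (simp add: theta_def)
qed

lemma theta_analytic:
  "f analytic_on A \<Longrightarrow> (\<And>z. z \<in> A \<Longrightarrow> f z \<noteq> 0) \<Longrightarrow> (\<lambda>z. theta (f z)) analytic_on A"
  unfolding theta_def by (intro analytic_intros P_analytic) auto

end


section \<open>The nonterminating q-Saalschuetz sum\<close>

context q_base begin

text \<open>
  Compared with \<open>qpoch\<close>, the index is a natural number; the recursions in both directions are then
  free of side conditions, also where factors vanish.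
\<close>

definition poch where "poch x n = (\<Prod>k<n. 1 - x * q ^ k)"

lemma poch_0 [simp]: "poch x 0 = 1" by (simp add: poch_def)

lemma poch_Suc: "poch x (Suc n) = poch x n * (1 - x * q ^ n)" by (simp add: poch_def)

lemma poch_Suc': "poch x (Suc n) = (1 - x) * poch (q * x) n"
  unfolding poch_def by (subst prod.lessThan_Suc_shift) (simp add: mult_ac)

lemma poch_LIMSEQ: "poch x \<longlonglongrightarrow> P x"
  unfolding poch_def qpoch_inf_def
  using convergent_prod_LIMSEQ[OF P_convergent[of x]] by (simp add: LIMSEQ_lessThan_iff_atMost)

lemma P_bounded: "\<exists>B\<ge>0. \<forall>x. norm x \<le> r \<longrightarrow> norm (P x) \<le> B"
proof -
  have "compact (P ` cball 0 r)"
    using P_holomorphic by (intro compact_continuous_image holomorphic_on_imp_continuous_on) auto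
  then obtain B where B: "\<And>x. x \<in> cball 0 r \<Longrightarrow> norm (P x) \<le> B"
    using compact_imp_bounded bounded_iff by (metis imageI)
  have "\<forall>x. norm x \<le> r \<longrightarrow> norm (P x) \<le> max B 0"
    using B by (simp add: dist_norm max.coboundedI1)
  thus ?thesis by (intro exI[of _ "max B 0"]) auto
qed

lemma poch_bounded: "norm x \<le> r \<Longrightarrow> norm (poch x n) \<le> exp (r / (1 - norm q))"
proof -
  assume x: "norm x \<le> r"
  hence r: "r \<ge> 0" using norm_ge_zero order_trans by blast
  have "norm (poch x n) \<le> (\<Prod>k<n. 1 + r * norm q ^ k)"
    unfolding poch_def prod_norm[symmetric]
  proof (intro prod_mono conjI norm_ge_zero)
    fix k
    have "norm (1 - x * q ^ k) \<le> 1 + norm x * norm q ^ k"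
      using norm_triangle_ineq4[of 1 "x * q ^ k"] by (simp add: norm_mult norm_power)
    also have "\<dots> \<le> 1 + r * norm q ^ k" using x by (simp add: mult_right_mono)
    finally show "norm (1 - x * q ^ k) \<le> 1 + r * norm q ^ k" .
  qed
  also have "\<dots> \<le> (\<Prod>k<n. exp (r * norm q ^ k))"
    using r by (intro prod_mono) (auto intro: add_nonneg_nonneg exp_ge_add_one_self)
  also have "\<dots> = exp (r * (\<Sum>k<n. norm q ^ k))"
    by (simp add: exp_sum sum_distrib_left)
  also have "(\<Sum>k<n. norm q ^ k) \<le> (\<Sum>k. norm q ^ k)"
    using q_lt_1 by (intro sum_le_suminf summable_geometric) auto
  hence "exp (r * (\<Sum>k<n. norm q ^ k)) \<le> exp (r / (1 - norm q))"
    using q_lt_1 r suminf_geometric[of "norm q"]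
    by (simp add: mult_left_mono divide_inverse)
  finally show ?thesis .
qed

lemma P_q_pow_nz: "P x \<noteq> 0 \<Longrightarrow> P (x * q ^ n) \<noteq> 0"
  unfolding P_eq_0_iff by (metis mult.assoc power_add)

lemma q_pow_bound: "norm (x * q ^ n) \<le> norm x"
  using q_lt_1 by (simp add: norm_mult norm_power mult_left_le power_le_one)

lemma P_q_pow_LIMSEQ: "(\<lambda>n. P (x * q ^ n)) \<longlonglongrightarrow> 1"
proof -
  have "(\<lambda>n. P (x * q ^ n)) \<longlonglongrightarrow> P (x * 0)"
    by (intro P_tendsto tendsto_intros q_pow_tendsto_0)
  thus ?thesis by simp
qed

lemma P_inverse_bounded: "P x \<noteq> 0 \<Longrightarrow> \<exists>B\<ge>0. \<forall>n. norm (inverse (P (x * q ^ n))) \<le> B"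
proof -
  have "(\<lambda>n. inverse (P (x * q ^ n))) \<longlonglongrightarrow> inverse 1"
    by (intro tendsto_inverse P_q_pow_LIMSEQ) auto
  hence "Bseq (\<lambda>n. inverse (P (x * q ^ n)))"
    by (intro convergent_imp_Bseq convergentI)
  thus ?thesis unfolding Bseq_def by (metis less_imp_le)
qed

text \<open>
  The summand of the balanced series \<open>\<^sub>3\<phi>\<^sub>2(ab, a\<^sub>2b, a\<^sub>3b; qb/c, qb/d; q, q)\<close> with
  \<open>a a\<^sub>2 a\<^sub>3 b c d = q\<close>, cleared of the denominators that depend on \<open>a\<close>. It is entire in \<open>a\<close>, so that \<open>a\<close> may
  be moved to 0 and to \<open>1/b\<close>; the parameter \<open>d\<close> moves along with \<open>a\<close> and is eliminated.
\<close>

definition saal_term where "saal_term a a2 a3 b c y =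
  q ^ y * P (q * q ^ y) * P (q * b / c * q ^ y) * P (a * a2 * a3 * b * c * b * q ^ y) * poch (a * b) y
   * P (a * c) / (P (a2 * b * q ^ y) * P (a3 * b * q ^ y))"

text \<open>
  A bound that is uniform for bounded \<open>a\<close>, as dominated convergence for \<open>a \<rightarrow> 0\<close> requires.
\<close>

lemma saal_term_bound:
  assumes "P (a2 * b) \<noteq> 0" "P (a3 * b) \<noteq> 0"
  shows "\<exists>B. \<forall>a y. norm a \<le> r \<longrightarrow> norm (saal_term a a2 a3 b c y) \<le> B * norm q ^ y"
proof -
  define R where "R = max r 0 * norm (a2 * a3 * b * c * b)"
  obtain B1 where B1: "B1 \<ge> 0" "\<And>x. norm x \<le> norm q \<Longrightarrow> norm (P x) \<le> B1"
    using P_bounded by blast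
  obtain B2 where B2: "B2 \<ge> 0" "\<And>x. norm x \<le> norm (q * b / c) \<Longrightarrow> norm (P x) \<le> B2"
    using P_bounded by blast
  obtain B3 where B3: "B3 \<ge> 0" "\<And>x. norm x \<le> R \<Longrightarrow> norm (P x) \<le> B3"
    using P_bounded by blast
  define B4 where "B4 = exp (max r 0 * norm b / (1 - norm q))"
  obtain B5 where B5: "B5 \<ge> 0" "\<And>x. norm x \<le> max r 0 * norm c \<Longrightarrow> norm (P x) \<le> B5"
    using P_bounded by blast
  obtain B6 where B6: "B6 \<ge> 0" "\<And>n. norm (inverse (P (a2 * b * q ^ n))) \<le> B6"
    using P_inverse_bounded[OF assms(1)] by blast
  obtain B7 where B7: "B7 \<ge> 0" "\<And>n. norm (inverse (P (a3 * b * q ^ n))) \<le> B7"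
    using P_inverse_bounded[OF assms(2)] by blast
  have "norm (saal_term a a2 a3 b c y) \<le> (B1 * B2 * B3 * B4 * B5 * (B6 * B7)) * norm q ^ y"
    if a: "norm a \<le> r" for a y
  proof -
    have n1: "norm (P (q * q ^ y)) \<le> B1" by (intro B1 q_pow_bound)
    have n2: "norm (P (q * b / c * q ^ y)) \<le> B2" by (intro B2 q_pow_bound)
    have n3: "norm (P (a * a2 * a3 * b * c * b * q ^ y)) \<le> B3"
    proof (intro B3 order_trans[OF q_pow_bound])
      have "norm a * norm (a2 * a3 * b * c * b) \<le> R"
        unfolding R_def using a by (intro mult_right_mono) auto
      thus "norm (a * a2 * a3 * b * c * b) \<le> R" by (simp add: norm_mult mult_ac)
    qed
    have n4: "norm (poch (a * b) y) \<le> B4"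
      unfolding B4_def using a by (intro poch_bounded) (auto simp: norm_mult intro: mult_right_mono)
    have n5: "norm (P (a * c)) \<le> B5"
      using a by (intro B5) (auto simp: norm_mult intro: mult_right_mono)
    have "norm (saal_term a a2 a3 b c y) = norm q ^ y * norm (P (q * q ^ y)) * norm (P (q * b / c * q ^ y)) * norm (P (a * a2 * a3 * b * c * b * q ^ y)) * norm (poch (a * b) y)
       * norm (P (a * c)) * (norm (inverse (P (a2 * b * q ^ y))) * norm (inverse (P (a3 * b * q ^ y))))"
      by (simp only: saal_term_def divide_inverse norm_mult norm_inverse norm_power inverse_mult_distrib)
    also have "\<dots> \<le> norm q ^ y * B1 * B2 * B3 * B4 * B5 * (B6 * B7)"
      using B1(1) B2(1) B3(1) B5(1) B6(1) B7(1)
      by (intro mult_mono n1 n2 n3 n4 n5 B6 B7 mult_nonneg_nonneg norm_ge_zero order_refl)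
        (auto simp: B4_def)
    finally show ?thesis by (simp add: mult_ac)
  qed
  thus ?thesis by blast
qed

lemma saal_term_summable:
  assumes "P (a2 * b) \<noteq> 0" "P (a3 * b) \<noteq> 0"
  shows "summable (\<lambda>y. norm (saal_term a a2 a3 b c y))"
proof -
  obtain B where B: "\<And>y. norm (saal_term a a2 a3 b c y) \<le> B * norm q ^ y"
    using saal_term_bound[OF assms, of "norm a" c] by auto
  show ?thesis
  proof (rule summable_comparison_test)
    show "summable (\<lambda>y. B * norm q ^ y)"
      using q_lt_1 by (intro summable_mult summable_geometric) auto
  qed (use B in auto)
qed

text \<open>
  The antidifference that relates the parameter \<open>a\<close> to \<open>qa\<close>. Up to factors independent of \<open>y\<close> it is
  \<open>(1 - v/b)(1 - v/c)\<close> times the weight of the series at \<open>v = bq\<^sup>y\<close>; its value at \<open>y = 0\<close> is 0 since \<open>1 - v/b\<close>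
  vanishes there.
\<close>

definition saal_tele where "saal_tele a a2 a3 b c y = (case y of 0 \<Rightarrow> 0 | Suc n \<Rightarrow>
  - a * c * P (q * a * c) * poch (q * a * b) n * P (q * q ^ n) * P (q * b / c * q ^ n)
    * P (a * a2 * a3 * b * c * b * q * q ^ n)
    / (P (a2 * b * q * q ^ n) * P (a3 * b * q * q ^ n)))"

lemma saal_term_telescope:
  assumes "P (a2 * b) \<noteq> 0" "P (a3 * b) \<noteq> 0" "c \<noteq> 0"
  shows "saal_term a a2 a3 b c y - (1 - a * a3 * b * c) * (1 - a * a2 * b * c) * saal_term (q * a) a2 a3 b c y
     = saal_tele a a2 a3 b c (Suc y) - saal_tele a a2 a3 b c y"
proof -
  define v where "v = q ^ y"
  define X where "X = P (q * v)"
  define Y where "Y = P (q * b / c * v)"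
  define Z where "Z = P (a * a2 * a3 * b * c * b * q * v)"
  define A where "A = P (q * a * c)"
  define D2 where "D2 = P (a2 * b * q * v)"
  define D3 where "D3 = P (a3 * b * q * v)"
  define e where "e = a * a2 * a3 * b * c"
  have r1: "P (e * b * v) = (1 - e * b * v) * Z"
    using P_rec[of "e * b * v"] by (simp add: e_def Z_def mult_ac)
  have r2: "P (a * c) = (1 - a * c) * A" using P_rec[of "a * c"] by (simp add: A_def mult_ac)
  have r3: "P (a2 * b * v) = (1 - a2 * b * v) * D2"
    using P_rec[of "a2 * b * v"] by (simp add: D2_def mult_ac)
  have r4: "P (a3 * b * v) = (1 - a3 * b * v) * D3"
    using P_rec[of "a3 * b * v"] by (simp add: D3_def mult_ac)
  have "P (a2 * b * v) \<noteq> 0" "P (a3 * b * v) \<noteq> 0"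
    unfolding v_def by (intro P_q_pow_nz assms)+
  hence nz: "(1 - a2 * b * v) * D2 \<noteq> 0" "(1 - a3 * b * v) * D3 \<noteq> 0"
    unfolding r3 r4 .
  have u1: "saal_term a a2 a3 b c y = v * X * Y * ((1 - e * b * v) * Z) * poch (a * b) y * ((1 - a * c) * A)
     / (((1 - a2 * b * v) * D2) * ((1 - a3 * b * v) * D3))"
    unfolding saal_term_def v_def[symmetric] X_def[symmetric] Y_def[symmetric]
      r2 r3 r4 r1[unfolded e_def, symmetric] e_def ..
  have z: "q * a * a2 * a3 * b * c * b * v = a * a2 * a3 * b * c * b * q * v" by (simp add: mult_ac)
  have u2: "saal_term (q * a) a2 a3 b c y = v * X * Y * Z * poch (q * a * b) y * A
     / (((1 - a2 * b * v) * D2) * ((1 - a3 * b * v) * D3))"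
    unfolding saal_term_def v_def[symmetric] X_def[symmetric] Y_def[symmetric]
      r2 r3 r4 z Z_def[symmetric] A_def[symmetric] ..
  have h1: "saal_tele a a2 a3 b c (Suc y) = - a * c * A * poch (q * a * b) y * X * Y * Z / (D2 * D3)"
    by (simp add: saal_tele_def v_def X_def Y_def Z_def A_def D2_def D3_def)
  show ?thesis
  proof (cases y)
    case 0
    hence v: "v = 1" by (simp add: v_def)
    have "(1 - e * b) * (1 - a * c) - (1 - a * a3 * b * c) * (1 - a * a2 * b * c)
       = - a * c * (1 - a2 * b) * (1 - a3 * b)"
      unfolding e_def by algebra
    hence "X * Y * Z * A * ((1 - e * b) * (1 - a * c)) 
       - (1 - a * a3 * b * c) * (1 - a * a2 * b * c) * (X * Y * Z * A)
       = (- a * c * A * X * Y * Z) * (1 - a2 * b) * (1 - a3 * b)"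
      by algebra
    thus ?thesis using nz unfolding u1 u2 h1 v
      by (simp add: 0 saal_tele_def divide_simps) (simp add: algebra_simps)?
  next
    case (Suc n)
    define p where "p = poch (q * a * b) n"
    have v': "v = q * q ^ n" by (simp add: v_def Suc)
    have p1: "poch (a * b) y = (1 - a * b) * p"
      unfolding Suc poch_Suc' p_def by (simp add: mult_ac)
    have p2: "poch (q * a * b) y = p * (1 - a * b * v)"
      unfolding Suc poch_Suc p_def v' by (simp add: mult_ac)
    have r5: "P v = (1 - v) * X" using P_rec[of v] by (simp add: X_def)
    have r6: "P (b / c * v) = (1 - b / c * v) * Y" using P_rec[of "b / c * v"] by (simp add: Y_def mult_ac)
    have h2: "saal_tele a a2 a3 b c y = - a * c * A * p * ((1 - v) * X) * ((1 - b / c * v) * Y) * ((1 - e * b * v) * Z)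
       / (((1 - a2 * b * v) * D2) * ((1 - a3 * b * v) * D3))"
      unfolding r1[symmetric] r3[symmetric] r4[symmetric] r5[symmetric] r6[symmetric]
      by (simp add: Suc saal_tele_def p_def A_def v' e_def mult_ac)
    have key: "v * (1 - e * b * v) * (1 - a * b) * (1 - a * c)
       - (1 - a * a3 * b * c) * (1 - a * a2 * b * c) * v * (1 - a * b * v)
      = - a * c * (1 - a * b * v) * (1 - a2 * b * v) * (1 - a3 * b * v)
        + a * (c - b * v) * (1 - e * b * v) * (1 - v)"
      unfolding e_def by algebra
    have cc: "c * (1 - b / c * v) = c - b * v" using assms(3) by (simp add: field_simps)
    have "?thesis \<longleftrightarrow> v * X * Y * ((1 - e * b * v) * Z) * ((1 - a * b) * p) * ((1 - a * c) * A)
        - (1 - a * a3 * b * c) * (1 - a * a2 * b * c) * (v * X * Y * Z * (p * (1 - a * b * v)) * A)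
        = - a * c * A * (p * (1 - a * b * v)) * X * Y * Z * ((1 - a2 * b * v) * (1 - a3 * b * v))
        + a * (c * (1 - b / c * v)) * A * p * ((1 - v) * X) * Y * ((1 - e * b * v) * Z)"
      using nz unfolding u1 u2 h1 h2 p1 p2 by (simp add: divide_simps) (simp add: algebra_simps)?
    moreover have "\<dots>" unfolding cc using key by algebra
    ultimately show ?thesis by blast
  qed
qed

lemma saal_tele_LIMSEQ:
  "saal_tele a a2 a3 b c \<longlonglongrightarrow> - a * c * P (q * a * c) * P (q * a * b)"
proof (rule LIMSEQ_imp_Suc)
  have "(\<lambda>n. - a * c * P (q * a * c) * poch (q * a * b) n * P (q * q ^ n) * P (q * b / c * q ^ n)
    * P (a * a2 * a3 * b * c * b * q * q ^ n)
    / (P (a2 * b * q * q ^ n) * P (a3 * b * q * q ^ n)))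
    \<longlonglongrightarrow> - a * c * P (q * a * c) * P (q * a * b) * 1 * 1 * 1 / (1 * 1)"
    by (intro tendsto_intros poch_LIMSEQ P_q_pow_LIMSEQ) auto
  thus "(\<lambda>n. saal_tele a a2 a3 b c (Suc n)) \<longlonglongrightarrow> - a * c * P (q * a * c) * P (q * a * b)"
    by (simp add: saal_tele_def)
qed

text \<open>
  The boundary term comes from \<open>y \<rightarrow> \<infinity>\<close>. Multiplied by \<open>b\<close> it is symmetric in \<open>b\<close> and \<open>c\<close>, hence it cancels
  from the difference of the two series obtained by exchanging \<open>b\<close> and \<open>c\<close>.
\<close>

lemma saal_term_suminf_rec:
  assumes "P (a2 * b) \<noteq> 0" "P (a3 * b) \<noteq> 0" "c \<noteq> 0"
  shows "suminf (saal_term a a2 a3 b c)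
     = (1 - a * a3 * b * c) * (1 - a * a2 * b * c) * suminf (saal_term (q * a) a2 a3 b c)
       - a * c * P (q * a * c) * P (q * a * b)"
proof -
  have s: "summable (saal_term a a2 a3 b c)" for a
    using saal_term_summable[OF assms(1,2)] by (rule summable_norm_cancel)
  have "(\<lambda>y. saal_tele a a2 a3 b c (Suc y) - saal_tele a a2 a3 b c y)
     sums (- a * c * P (q * a * c) * P (q * a * b) - saal_tele a a2 a3 b c 0)"
    by (intro telescope_sums saal_tele_LIMSEQ)
  moreover have "(\<lambda>y. saal_tele a a2 a3 b c (Suc y) - saal_tele a a2 a3 b c y)
    sums (suminf (saal_term a a2 a3 b c)
     - (1 - a * a3 * b * c) * (1 - a * a2 * b * c) * suminf (saal_term (q * a) a2 a3 b c))"
    unfolding saal_term_telescope[OF assms, symmetric]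
    by (intro sums_diff sums_mult summable_sums s)
  ultimately have "suminf (saal_term a a2 a3 b c)
     - (1 - a * a3 * b * c) * (1 - a * a2 * b * c) * suminf (saal_term (q * a) a2 a3 b c)
     = - a * c * P (q * a * c) * P (q * a * b) - saal_tele a a2 a3 b c 0"
    using sums_unique2 by blast
  thus ?thesis by (simp add: saal_tele_def algebra_simps)
qed

lemma saal_term_suminf_LIMSEQ:
  assumes "P (a2 * b) \<noteq> 0" "P (a3 * b) \<noteq> 0"
  shows "(\<lambda>n. suminf (saal_term (q ^ n * a) a2 a3 b c)) \<longlonglongrightarrow> suminf (saal_term 0 a2 a3 b c)"
proof -
  obtain B where B: "\<And>x y. norm x \<le> norm a \<Longrightarrow> norm (saal_term x a2 a3 b c y) \<le> B * norm q ^ y"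
    using saal_term_bound[OF assms, of "norm a" c] by auto
  have x: "(\<lambda>n. q ^ n * a) \<longlonglongrightarrow> 0"
    using tendsto_mult[OF q_pow_tendsto_0 tendsto_const[of a]] by simp
  show ?thesis
  proof (rule conjunct2[OF conjunct2[OF tannerys_theorem[where M = "\<lambda>y. B * norm q ^ y"]]])
    fix y
    show "(\<lambda>n. saal_term (q ^ n * a) a2 a3 b c y) \<longlonglongrightarrow> saal_term 0 a2 a3 b c y"
    proof (cases "P (a2 * b * q ^ y) * P (a3 * b * q ^ y) = 0")
      case False
      thus ?thesis unfolding saal_term_def poch_def by (intro tendsto_intros P_tendsto x) auto
    qed (auto simp: saal_term_def)
  next
    show "\<forall>\<^sub>F (y, n) in at_top \<times>\<^sub>F at_top. norm (saal_term (q ^ n * a) a2 a3 b c y) \<le> B * norm q ^ y"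
      using B q_pow_bound[of a] by (intro always_eventually) (auto simp: mult.commute)
    show "summable (\<lambda>y. B * norm q ^ y)"
      using q_lt_1 by (intro summable_mult summable_geometric) auto
  qed auto
qed

text \<open>
  As a function of \<open>a\<close>, the left-hand side \<open>F\<close> satisfies
  \<open>F a = (1 - a a\<^sub>3bc)(1 - a a\<^sub>2bc) F (qa)\<close> and is continuous at 0, so \<open>F a\<close> is an infinite product times
  \<open>F 0\<close>. The constant is found at \<open>a = 1/b\<close>, where one series reduces to its first term and the other
  vanishes.
\<close>

lemma saalschuetz_scalar:
  fixes b c :: complex
  assumes nz: "P (a2 * b) \<noteq> 0" "P (a3 * b) \<noteq> 0" "P (a2 * c) \<noteq> 0" "P (a3 * c) \<noteq> 0" "b \<noteq> 0" "c \<noteq> 0"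
  shows "b * suminf (saal_term a a2 a3 b c) - c * suminf (saal_term a a2 a3 c b)
    = P (a * a3 * b * c) * P (a * a2 * b * c) * b * P q * theta (c / b) * P (a2 * a3 * b * c)
      / (P (a2 * b) * P (a3 * b) * P (a2 * c) * P (a3 * c))"
proof -
  define F where "F = (\<lambda>a. b * suminf (saal_term a a2 a3 b c) - c * suminf (saal_term a a2 a3 c b))"
  have rec: "F a = (1 - a * a3 * b * c) * (1 - a * a2 * b * c) * F (q * a)" for a
    unfolding F_def using nz
    by (subst (1 2) saal_term_suminf_rec) (auto simp: algebra_simps)
  have it: "F a = poch (a * a3 * b * c) n * poch (a * a2 * b * c) n * F (q ^ n * a)" for a n
  proof (induction n)
    case (Suc n)
    show ?case unfolding Suc.IH using rec[of "q ^ n * a"] by (simp add: poch_Suc mult_ac)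
  qed simp
  have F: "F a = P (a * a3 * b * c) * P (a * a2 * b * c) * F 0" for a
  proof (rule LIMSEQ_unique)
    show "(\<lambda>n. F a) \<longlonglongrightarrow> F a" by simp
    have "(\<lambda>n. poch (a * a3 * b * c) n * poch (a * a2 * b * c) n * F (q ^ n * a))
       \<longlonglongrightarrow> P (a * a3 * b * c) * P (a * a2 * b * c) * F 0"
      unfolding F_def using nz by (intro tendsto_intros poch_LIMSEQ saal_term_suminf_LIMSEQ)
    thus "(\<lambda>n. F a) \<longlonglongrightarrow> P (a * a3 * b * c) * P (a * a2 * b * c) * F 0"
      using it[of a] by simp
  qed
  have pp1: "poch 1 y = 0" if "y \<noteq> 0" for y
    using that by (cases y) (simp_all add: poch_Suc')
  \<comment> \<open>\<open>poch 1 y\<close> vanishes for \<open>y > 0\<close>, and the second series contains the factor \<open>P 1 = 0\<close>.\<close>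
  have "suminf (saal_term (1 / b) a2 a3 b c) = (\<Sum>y\<in>{0}. saal_term (1 / b) a2 a3 b c y)"
    using nz pp1 by (intro suminf_finite) (auto simp: saal_term_def)
  hence "suminf (saal_term (1 / b) a2 a3 b c)
      = P q * theta (c / b) * P (a2 * a3 * b * c) / (P (a2 * b) * P (a3 * b))"
    using nz by (simp add: saal_term_def theta_def mult_ac)
  moreover have z: "saal_term (1 / b) a2 a3 c b = (\<lambda>_. 0)"
    using nz by (intro ext) (simp add: saal_term_def)
  ultimately have "F (1 / b) = b * (P q * theta (c / b) * P (a2 * a3 * b * c) / (P (a2 * b) * P (a3 * b)))"
    using nz by (simp add: F_def z)
  moreover have "F (1 / b) = P (a3 * c) * P (a2 * c) * F 0"
    using F[of "1 / b"] nz by (simp add: mult_ac)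
  ultimately have "F 0 = b * P q * theta (c / b) * P (a2 * a3 * b * c)
      / (P (a2 * b) * P (a3 * b) * P (a2 * c) * P (a3 * c))"
    using nz by (simp add: field_simps)
  thus ?thesis using F[of a] unfolding F_def by simp
qed

end


section \<open>Jackson sums and their differences\<close>

lemma of_int_choose2: "of_int (choose2 n) = (of_int n * (of_int n - 1) / 2 :: complex)"
  using arg_cong[OF two_choose2[of n], of "of_int :: int \<Rightarrow> complex"] by (simp add: field_simps)

lemma neg_powi: "(- x) powi n = (- 1) powi n * (x :: complex) powi n"
  using power_int_mult_distrib[of "- 1" x n] by simp

lemma minus_one_powi_cong: "even (m - n) \<Longrightarrow> (- 1) powi m = ((- 1) powi n :: complex)"
  by (simp add: power_int_minus_left)

lemma finite_perm3: 
  assumes "{i, j, k} = {1..3::nat}" "i \<noteq> j" "j \<noteq> k" "i \<noteq> k"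
  shows "(\<Prod>m=1..3. f m) = f i * f j * f k" "(\<Sum>m=1..3. g m) = g i + g j + g k"
  unfolding assms(1)[symmetric] using assms(2-) by (simp_all add: mult.assoc add.assoc)

lemma has_sum_int_if_neg_zero:
  fixes f :: "int \<Rightarrow> complex"
  assumes "\<And>k. k < 0 \<Longrightarrow> f k = 0" "summable (\<lambda>n. norm (f (int n)))"
  shows "(f has_sum (\<Sum>n. f (int n))) UNIV" "(\<lambda>k. norm (f k)) summable_on UNIV"
proof -
  have "((\<lambda>n. f (int n)) has_sum (\<Sum>n. f (int n))) UNIV"
    using assms(2) by (intro norm_summable_imp_has_sum summable_sums) (auto intro: summable_norm_cancel)
  hence "(f has_sum (\<Sum>n. f (int n))) (range int)"
    by (subst has_sum_reindex) (auto simp: o_def)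
  thus "(f has_sum (\<Sum>n. f (int n))) UNIV"
  proof (rule has_sum_cong_neutral[THEN iffD1, rotated -1])
    fix k assume "k \<in> UNIV - range int"
    hence "k < 0" by (metis DiffD2 nat_0_le not_less rangeI)
    thus "f k = 0" by (rule assms)
  qed auto
  have "(\<lambda>n. norm (f (int n))) summable_on UNIV"
    using assms(2) by (intro norm_summable_imp_summable_on) auto
  hence "(\<lambda>k. norm (f k)) summable_on (range int)"
    by (subst summable_on_reindex) (auto simp: o_def)
  thus "(\<lambda>k. norm (f k)) summable_on UNIV"
  proof (rule summable_on_cong_neutral[THEN iffD1, rotated -1])
    fix k assume "k \<in> UNIV - range int"
    hence "k < 0" by (metis DiffD2 nat_0_le not_less rangeI)
    thus "norm (f k) = 0" using assms by simp
  qed auto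
qed

lemma (in q_base) powi_not_range:
  assumes "x \<notin> qZ" shows "x * q powi n \<notin> qZ"
proof
  assume "x * q powi n \<in> qZ"
  then obtain k where "x * q powi n = q powi k" by auto
  hence "x = q powi (k - n)" by (simp add: power_int_diff field_simps)
  with assms show False by auto
qed

locale q_params = q_base +
  fixes a b :: "nat \<Rightarrow> complex"
  assumes generic: "generic_params q a b"
    and balanced: "(\<Prod>j=1..3. a j) * (\<Prod>j=1..3. b j) = q"
begin

lemma a_nz: "j \<in> {1..3} \<Longrightarrow> a j \<noteq> 0" and b_nz: "j \<in> {1..3} \<Longrightarrow> b j \<noteq> 0"
  using balanced q_nz by (metis (no_types, lifting) finite_atLeastAtMost mult_eq_0_iff prod_zero)+

lemma ab_generic: "i \<in> {1..3} \<Longrightarrow> j \<in> {1..3} \<Longrightarrow> a i * b j \<notin> qZ"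
  using generic by (auto simp: generic_params_def)

lemma bb_generic: "i \<in> {1..3} \<Longrightarrow> j \<in> {1..3} \<Longrightarrow> i \<noteq> j \<Longrightarrow> b i / b j \<notin> qZ"
  using generic by (auto simp: generic_params_def)

lemma aa_generic: "i \<in> {1..3} \<Longrightarrow> j \<in> {1..3} \<Longrightarrow> i \<noteq> j \<Longrightarrow> a i / a j \<notin> qZ"
  using generic by (auto simp: generic_params_def)

lemma P_ab_nz: "i \<in> {1..3} \<Longrightarrow> j \<in> {1..3} \<Longrightarrow> P (a i * b j * q powi n) \<noteq> 0"
  by (intro P_nz powi_not_range ab_generic)

lemma P_ab_nz': "i \<in> {1..3} \<Longrightarrow> j \<in> {1..3} \<Longrightarrow> P (a i * b j) \<noteq> 0"
  using P_ab_nz[of i j 0] by simp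

definition Lam where "Lam v = (\<Prod>j=1..3. P (q * v / b j) / P (a j * v))"

definition Gam where "Gam = P q / (\<Prod>i=1..3. \<Prod>j=1..3. P (a i * b j))"

definition Delta where "Delta i j k = Gam * b i * theta (b j / b i) * (\<Prod>m=1..3. theta (a m * b k))"

text \<open>
  Jackson sums run over the whole geometric sequence \<open>b\<^sub>jq\<^sup>k\<close>, with \<open>k\<close> any integer, because this set is
  unchanged when \<open>b\<^sub>j\<close> is replaced by \<open>b\<^sub>jq\<^sup>l\<close>. For \<open>\<phi> = Lam\<close> the terms with \<open>k < 0\<close> vanish.
\<close>

abbreviation jterm where "jterm \<phi> j k \<equiv> b j * q powi k * \<phi> (b j * q powi k)"

definition qsum where "qsum \<phi> j = (\<Sum>\<^sub>\<infinity>k::int. jterm \<phi> j k)"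

lemma Lam_neg: 
  assumes "j \<in> {1..3}" "k < 0" shows "Lam (b j * q powi k) = 0"
proof -
  obtain n where n: "k = - int (Suc n)" using assms(2) by (metis not_le zero_less_imp_eq_int minus_equation_iff neg_0_less_iff_less gr0_implies_Suc)
  have "q * (b j * q powi k) / b j * q ^ n = q powi (1 + k + int n)"
    using b_nz[OF assms(1)] by (simp add: power_int_add)
  also have "\<dots> = 1" by (simp add: n)
  finally have "P (q * (b j * q powi k) / b j) = 0" unfolding P_eq_0_iff by blast
  hence "P (q * (b j * q powi k) / b j) / P (a j * (b j * q powi k)) = 0"
    by (simp only: div_0)
  thus ?thesis unfolding Lam_def using assms(1) by (intro prod_zero) blast+
qed

text \<open>
  At \<open>a = a 1\<close> the summand above is, up to a constant, the Jackson summand; \<open>b k\<close> enters only through the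
  balancing condition.
\<close>

lemma saal_term_Lam:
  assumes perm: "{i, j, k} = {1..3::nat}" "i \<noteq> j" "j \<noteq> k" "i \<noteq> k"
  shows "saal_term (a 1) (a 2) (a 3) (b i) (b j) y = P (a 1 * b i) * P (a 1 * b j) * (q ^ y * Lam (b i * q ^ y))"
proof -
  have ijk: "i \<in> {1..3}" "j \<in> {1..3}" "k \<in> {1..3}" using perm(1) by auto
  have "a 1 * a 2 * a 3 * (b i * b j * b k) = q"
    using balanced unfolding finite_perm3(1)[OF perm, of b] prod_1_3[of a] .
  hence e: "a 1 * a 2 * a 3 * b i * b j = q / b k"
    using b_nz[OF ijk(3)] by (simp add: field_simps)
  have L: "Lam v = P (q * v / b i) * P (q * v / b j) * P (q * v / b k) / (P (a 1 * v) * P (a 2 * v) * P (a 3 * v))" for v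
    unfolding Lam_def prod_dividef finite_perm3(1)[OF perm, of "\<lambda>j. P (q * v / b j)"] prod_1_3 ..
  have p: "poch (a 1 * b i) y = P (a 1 * b i) / P (a 1 * b i * q ^ y)"
  proof -
    have "poch x y * P (x * q ^ y) = P x" for x
    proof (induction y)
      case (Suc y)
      thus ?case using P_rec[of "x * q ^ y"] by (simp add: poch_Suc mult_ac)
    qed simp
    thus ?thesis using P_ab_nz[of 1 i "int y"] ijk(1) by (simp add: eq_divide_eq)
  qed
  show ?thesis
    unfolding saal_term_def e p L using b_nz ijk by (simp add: mult_ac)
qed

lemma Lam_summable:
  assumes "i \<in> {1..3}"
  shows "summable (\<lambda>n. norm (jterm Lam i (int n)))"
proof -
  have "\<exists>j k. {i, j, k} = {1..3::nat} \<and> i \<noteq> j \<and> j \<noteq> k \<and> i \<noteq> k"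
  proof -
    have "i = 1 \<or> i = 2 \<or> i = 3" using assms by auto
    moreover have "{1..3::nat} = {1, 2, 3}" by auto
    ultimately show ?thesis
      by (elim disjE) (rule exI[of _ "if i = 1 then 2 else 1"], rule exI[of _ "if i = 3 then 2 else 3"], auto)+
  qed
  then obtain j k where perm: "{i, j, k} = {1..3::nat}" "i \<noteq> j" "j \<noteq> k" "i \<noteq> k" by blast
  have ijk: "i \<in> {1..3}" "j \<in> {1..3}" "k \<in> {1..3}" using perm(1) by auto
  have "summable (\<lambda>y. norm (saal_term (a 1) (a 2) (a 3) (b i) (b j) y))"
    using P_ab_nz'[of _ i] ijk by (intro saal_term_summable) auto
  hence "summable (\<lambda>y. norm (b i / (P (a 1 * b i) * P (a 1 * b j))) * norm (saal_term (a 1) (a 2) (a 3) (b i) (b j) y))"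
    by (rule summable_mult)
  thus ?thesis
    unfolding saal_term_Lam[OF perm] norm_mult[symmetric]
    using P_ab_nz'[of 1 i] P_ab_nz'[of 1 j] ijk by (simp add: mult_ac)
qed

lemma Lam_has_sum:
  assumes "i \<in> {1..3}"
  shows "((jterm Lam i) has_sum qsum Lam i) UNIV"
    "(\<lambda>k. norm (jterm Lam i k)) summable_on UNIV"
    "qsum Lam i = (\<Sum>n. jterm Lam i (int n))"
proof -
  note * = has_sum_int_if_neg_zero[of "\<lambda>k. jterm Lam i k", OF _ Lam_summable[OF assms]]
  show "qsum Lam i = (\<Sum>n. jterm Lam i (int n))"
    unfolding qsum_def using * Lam_neg[OF assms] by (intro infsumI) auto
  thus "((jterm Lam i) has_sum qsum Lam i) UNIV"
    using *(1) Lam_neg[OF assms] by auto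
  show "(\<lambda>k. norm (jterm Lam i k)) summable_on UNIV"
    using *(2) Lam_neg[OF assms] by auto
qed

text \<open>
  By the balancing condition, the products in \<open>saalschuetz_scalar\<close> with four parameters are of the form
  \<open>P (q / (a m * b k))\<close>; completing them to theta functions makes the right-hand side symmetric in the \<open>a m\<close>.
\<close>

lemma saalschuetz:
  assumes perm: "{i, j, k} = {1..3::nat}" "i \<noteq> j" "j \<noteq> k" "i \<noteq> k"
  shows "qsum Lam i - qsum Lam j = Delta i j k"
proof -
  have ijk: "i \<in> {1..3}" "j \<in> {1..3}" "k \<in> {1..3}" using perm(1) by auto
  have perm': "{j, i, k} = {1..3::nat}" "j \<noteq> i" "i \<noteq> k" "j \<noteq> k" using perm by auto
  have A: "P (a m * b n) \<noteq> 0" if "m \<in> {1,2,3}" "n \<in> {i,j,k}" for m n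
    using that perm(1) by (intro P_ab_nz') auto
  note nz = A[of 1 i] A[of 1 j] A[of 1 k] A[of 2 i] A[of 2 j] A[of 2 k] A[of 3 i] A[of 3 j] A[of 3 k]
  have pull: "c * suminf (\<lambda>y. C * (q ^ y * f y)) = C * (\<Sum>n. c * q powi int n * f n)"
    if f: "summable (\<lambda>n. c * q powi int n * f n)" and c: "c \<noteq> 0" for c C :: complex and f
  proof -
    have "summable (\<lambda>n. C / c * (c * q powi int n * f n))"
      using f by (rule summable_mult)
    hence "summable (\<lambda>y. C * (q ^ y * f y))" using c by (simp add: mult_ac)
    from suminf_mult[OF this, of c] suminf_mult[OF f, of C] show ?thesis by (simp add: mult_ac)
  qed
  have s1: "b i * suminf (saal_term (a 1) (a 2) (a 3) (b i) (b j)) = P (a 1 * b i) * P (a 1 * b j) * qsum Lam i"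
    using pull[OF Lam_summable[OF ijk(1), THEN summable_norm_cancel] b_nz[OF ijk(1)]]
    unfolding Lam_has_sum(3)[OF ijk(1)] saal_term_Lam[OF perm] by simp
  have s2: "b j * suminf (saal_term (a 1) (a 2) (a 3) (b j) (b i)) = P (a 1 * b i) * P (a 1 * b j) * qsum Lam j"
    using pull[OF Lam_summable[OF ijk(2), THEN summable_norm_cancel] b_nz[OF ijk(2)]]
    unfolding Lam_has_sum(3)[OF ijk(2)] saal_term_Lam[OF perm']
    by (simp add: mult.commute[of "P (a 1 * b j)" "P (a 1 * b i)"] del: One_nat_def)
  have bal: "a 1 * a 2 * a 3 * (b i * b j * b k) = q"
    using balanced unfolding finite_perm3(1)[OF perm, of b] prod_1_3[of a] .
  have e: "a 1 * a 3 * b i * b j = q / (a 2 * b k)" "a 1 * a 2 * b i * b j = q / (a 3 * b k)"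
    "a 2 * a 3 * b i * b j = q / (a 1 * b k)"
    using bal b_nz[OF ijk(3)] a_nz[of 1] a_nz[of 2] a_nz[of 3] by (simp_all add: field_simps)
  have "P (a 1 * b i) * P (a 1 * b j) * (qsum Lam i - qsum Lam j)
    = P (q / (a 2 * b k)) * P (q / (a 3 * b k)) * b i * P q * theta (b j / b i) * P (q / (a 1 * b k))
      / (P (a 2 * b i) * P (a 3 * b i) * P (a 2 * b j) * P (a 3 * b j))"
    using saalschuetz_scalar[of "a 2" "b i" "a 3" "b j" "a 1"] nz b_nz ijk
    unfolding s1 s2 e by (simp add: right_diff_distrib)
  hence "qsum Lam i - qsum Lam j =
     P (q / (a 2 * b k)) * P (q / (a 3 * b k)) * b i * P q * theta (b j / b i) * P (q / (a 1 * b k))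
      / (P (a 2 * b i) * P (a 3 * b i) * P (a 2 * b j) * P (a 3 * b j)) / (P (a 1 * b i) * P (a 1 * b j))"
    using nz by (simp add: eq_divide_eq mult_ac)
  also have "\<dots> = Delta i j k"
  proof -
    have th: "(\<Prod>m=1..3. theta (a m * b k)) = (P (a 1 * b k) * P (q / (a 1 * b k))) *
        (P (a 2 * b k) * P (q / (a 2 * b k))) * (P (a 3 * b k) * P (q / (a 3 * b k)))"
      unfolding prod_1_3 theta_def ..
    have ga: "Gam = P q / ((P (a 1 * b i) * P (a 1 * b j) * P (a 1 * b k)) *
       (P (a 2 * b i) * P (a 2 * b j) * P (a 2 * b k)) * (P (a 3 * b i) * P (a 3 * b j) * P (a 3 * b k)))"
    proof -
      have inner: "(\<Prod>n=1..3. P (x * b n)) = P (x * b i) * P (x * b j) * P (x * b k)" for x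
        by (rule finite_perm3(1)[OF perm])
      show ?thesis unfolding Gam_def inner prod_1_3 ..
    qed
    show ?thesis unfolding Delta_def th ga using nz by (simp add: divide_simps)
  qed
  finally show ?thesis .
qed

lemma Delta_nz:
  assumes perm: "{i, j, k} = {1..3::nat}" "i \<noteq> j" "j \<noteq> k" "i \<noteq> k"
  shows "Delta i j k \<noteq> 0"
proof -
  have ijk: "i \<in> {1..3}" "j \<in> {1..3}" "k \<in> {1..3}" using perm(1) by auto
  have "P q \<noteq> 0"
    unfolding P_eq_0_iff
  proof
    assume "\<exists>n. q * q ^ n = 1"
    then obtain n where "q ^ Suc n = 1" by auto
    hence "norm q ^ Suc n = 1" by (metis norm_one norm_power)
    moreover have "norm q ^ Suc n < 1" using q_lt_1 by (intro power_Suc_less_one) auto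
    ultimately show False by simp
  qed
  hence "Gam \<noteq> 0" unfolding Gam_def using P_ab_nz' by auto
  moreover have "theta (b j / b i) \<noteq> 0"
    using bb_generic[of j i] ijk perm b_nz by (subst theta_eq_0_iff) auto
  moreover have "theta (a m * b k) \<noteq> 0" if "m \<in> {1..3}" for m
    using ab_generic[OF that ijk(3)] a_nz[OF that] b_nz[OF ijk(3)] by (subst theta_eq_0_iff) auto
  ultimately show ?thesis using b_nz ijk by (simp add: Delta_def)
qed

end


section \<open>Shifting the parameters by powers of q\<close>

text \<open>
  Identities between monomials in nonzero numbers with integer exponents are checked by writing every
  variable as an exponential: they reduce to a polynomial identity between the exponents and to a
  parity condition for the sign.
\<close>

definition signed_exp :: "int \<Rightarrow> complex \<Rightarrow> complex" where
  "signed_exp n x = (- 1) powi n * exp x"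

lemma signed_exp_mult: "signed_exp m x * signed_exp n y = signed_exp (m + n) (x + y)"
  by (simp add: signed_exp_def power_int_add exp_add mult_ac)

lemma signed_exp_divide: "signed_exp m x / signed_exp n y = signed_exp (m - n) (x - y)"
  by (simp add: signed_exp_def power_int_diff exp_diff)

lemma exp_powi_signed_exp: "exp x powi n = signed_exp 0 (of_int n * x)"
  by (simp add: signed_exp_def exp_power_int)

lemma minus_exp_powi_signed_exp: "(- exp x) powi n = signed_exp n (of_int n * x)"
  by (subst neg_powi) (simp add: signed_exp_def exp_power_int)

lemma signed_exp_cong: "even (m - n) \<Longrightarrow> x = y \<Longrightarrow> signed_exp m x = signed_exp n y"
  unfolding signed_exp_def by (simp only: minus_one_powi_cong[of m n])

text \<open>
  All factors produced by quasi-periodicity in \<open>Delta_shift\<close>. The constraint on \<open>q\<close> makes the logarithm of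
  \<open>q\<close> a linear combination of those of the parameters, which is why one polynomial identity suffices.
\<close>

lemma shift_factor_identity:
  fixes a1 a2 a3 b1 b2 b3 q :: complex and k1 k2 k3 l1 l2 l3 :: int
  assumes nz: "a1 \<noteq> 0" "a2 \<noteq> 0" "a3 \<noteq> 0" "b1 \<noteq> 0" "b2 \<noteq> 0" "b3 \<noteq> 0"
    and q: "a1 * a2 * a3 * (b1 * b2 * b3) = q"
    and T: "T = k1 + k2 + k3" "T = - (l1 + l2 + l3)"
  shows "((- b1) powi l1 * q powi choose2 l1) * ((- b2) powi l2 * q powi choose2 l2) * ((- b3) powi l3 * q powi choose2 l3)
     * (q powi l1 * ((- 1 / (b2 / b1)) powi (l2 - l1) * q powi (- choose2 (l2 - l1))))
     * (((- 1 / (a1 * b3)) powi (k1 + l3) * q powi (- choose2 (k1 + l3)))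
      * ((- 1 / (a2 * b3)) powi (k2 + l3) * q powi (- choose2 (k2 + l3)))
      * ((- 1 / (a3 * b3)) powi (k3 + l3) * q powi (- choose2 (k3 + l3))))
   = (- (a1 * a2 * a3)) powi T * q powi choose2 T
     / ((q powi (choose2 k1 + choose2 l1) * a1 powi k1 * b1 powi l1)
      * (q powi (choose2 k2 + choose2 l2) * a2 powi k2 * b2 powi l2)
      * (q powi (choose2 k3 + choose2 l3) * a3 powi k3 * b3 powi l3))"
proof -
  define A1 A2 A3 B1 B2 B3 where "A1 = Ln a1" and "A2 = Ln a2" and "A3 = Ln a3"
    and "B1 = Ln b1" and "B2 = Ln b2" and "B3 = Ln b3"
  hence e: "a1 = exp A1" "a2 = exp A2" "a3 = exp A3" "b1 = exp B1" "b2 = exp B2" "b3 = exp B3"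
    using nz by simp_all
  define L where "L = A1 + A2 + A3 + (B1 + B2 + B3)"
  have qe: "q = exp L" using q unfolding e L_def by (simp add: exp_add)
  have d: "- 1 / (b2 / b1) = - exp (B1 - B2)" "- 1 / (a1 * b3) = - exp (- A1 - B3)"
     "- 1 / (a2 * b3) = - exp (- A2 - B3)" "- 1 / (a3 * b3) = - exp (- A3 - B3)"
     "- (a1 * a2 * a3) = - exp (A1 + A2 + A3)"
    unfolding e by (simp_all add: exp_diff exp_add exp_minus field_simps)
  \<comment> \<open>Treated as an indeterminate with \<open>2h = 1\<close>, so that the identity is one between polynomials.\<close>
  define h :: complex where "h = 1 / 2"
  have h: "2 * h = 1" by (simp add: h_def)
  have ch: "of_int (choose2 n) = of_int n * (of_int n - 1) * h" for n
    by (simp add: of_int_choose2 h_def)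
  have "k3 = - (l1 + l2 + l3) - k1 - k2" "T = - (l1 + l2 + l3)" using T by linarith+
  hence k3: "(of_int k3 :: complex) = - (of_int l1 + of_int l2 + of_int l3) - of_int k1 - of_int k2"
    and T': "(of_int T :: complex) = - (of_int l1 + of_int l2 + of_int l3)"
    by simp_all
  show ?thesis
    unfolding d unfolding qe
    unfolding e minus_exp_powi_signed_exp exp_powi_signed_exp signed_exp_mult signed_exp_divide
  proof (rule signed_exp_cong, goal_cases)
    case 1
    show ?case using T by presburger
  next
    case 2
    show ?case
      unfolding ch of_int_add of_int_minus of_int_diff using k3 T' L_def h by algebra
  qed
qed

context q_params begin

lemma shift_params:
  assumes "(\<Sum>j=1..3. k j) + (\<Sum>j=1..3. l j) = 0"
  shows "q_params q (\<lambda>j. a j * q powi k j) (\<lambda>j. b j * q powi l j)"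
proof unfold_locales
  have r: "x * q powi m / (y * q powi n) = x / y * q powi (m - n)" for x y m n
    by (simp add: power_int_diff field_simps)
  have r': "x * q powi m * (y * q powi n) = x * y * q powi (m + n)" for x y m n
    by (simp add: power_int_add field_simps)
  show "generic_params q (\<lambda>j. a j * q powi k j) (\<lambda>j. b j * q powi l j)"
    unfolding generic_params_def r r'
    by (intro conjI ballI impI powi_not_range aa_generic bb_generic ab_generic)
  have "(\<Prod>j=1..3. q powi k j) * (\<Prod>j=1..3. q powi l j) = q powi ((\<Sum>j=1..3. k j) + (\<Sum>j=1..3. l j))"
    unfolding prod_1_3 sum_1_3 by (simp add: power_int_add mult_ac)
  thus "(\<Prod>j=1..3. a j * q powi k j) * (\<Prod>j=1..3. b j * q powi l j) = q"
    unfolding prod.distrib assms using balanced by (simp add: mult_ac)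
qed

text \<open>
  \<open>Delta\<close> is a quotient of theta functions and of the \<open>P (a i * b j)\<close>; under a shift the former contribute a
  monomial and the latter the finite products in \<open>K_value\<close>. The outcome does not depend on which pair of
  indices is used.
\<close>

lemma Delta_shift:
  assumes sum: "(\<Sum>j=1..3. k j) = - (\<Sum>j=1..3. l j)"
    and perm: "{i, j, m} = {1..3::nat}" "i \<noteq> j" "j \<noteq> m" "i \<noteq> m"
  shows "(\<Prod>j=1..3. (- b j) powi l j * q powi choose2 (l j))
       * q_params.Delta q (\<lambda>j. a j * q powi k j) (\<lambda>j. b j * q powi l j) i j m
     = K_value q a b k l * Delta i j m"
proof -
  let ?a = "\<lambda>j. a j * q powi k j" and ?b = "\<lambda>j. b j * q powi l j"
  interpret s: q_params q ?a ?b using sum by (intro shift_params) auto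
  have ijm: "i \<in> {1..3}" "j \<in> {1..3}" "m \<in> {1..3}" using perm(1) by auto
  define Q where "Q = (\<Prod>i=1..3. \<Prod>j=1..3. qpoch q (a i * b j) (k i + l j))"
  have r': "x * q powi m * (y * q powi n) = x * y * q powi (m + n)" for x y m n
    by (simp add: power_int_add field_simps)
  have r: "x * q powi m / (y * q powi n) = x / y * q powi (m - n)" for x y m n
    by (simp add: power_int_diff field_simps)
  have h: "(\<Prod>i=1..3. \<Prod>j=1..3. P (a i * b j)) = (\<Prod>i=1..3. \<Prod>j=1..3. P (?a i * ?b j)) * Q"
    unfolding Q_def prod.distrib[symmetric] r'
    by (intro prod.cong refl P_powi_step[symmetric] ab_generic)
  have "(\<Prod>i=1..3. \<Prod>j=1..3. P (a i * b j)) \<noteq> 0"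
    using P_ab_nz' by auto
  hence "Q \<noteq> 0" unfolding h by simp
  hence G: "s.Gam = Gam * Q"
    unfolding s.Gam_def Gam_def h by simp
  define th where "th = (\<lambda>n. (- 1 / (a n * b m)) powi (k n + l m) * q powi (- choose2 (k n + l m)))"
  have t1: "theta (?b j / ?b i) = (- 1 / (b j / b i)) powi (l j - l i) * q powi (- choose2 (l j - l i)) * theta (b j / b i)"
    unfolding r using b_nz ijm by (intro theta_powi) auto
  have "(\<Prod>n=1..3. theta (?a n * ?b m)) = (\<Prod>n=1..3. th n * theta (a n * b m))"
    unfolding r' th_def using a_nz b_nz ijm by (intro prod.cong refl theta_powi) auto
  hence t2: "(\<Prod>n=1..3. theta (?a n * ?b m)) = (\<Prod>n=1..3. th n) * (\<Prod>n=1..3. theta (a n * b m))"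
    by (simp add: prod.distrib)
  have bal: "a 1 * a 2 * a 3 * (b i * b j * b m) = q"
    using balanced unfolding finite_perm3(1)[OF perm, of b] prod_1_3[of a] .
  have nz: "a 1 \<noteq> 0" "a 2 \<noteq> 0" "a 3 \<noteq> 0" "b i \<noteq> 0" "b j \<noteq> 0" "b m \<noteq> 0"
    using a_nz b_nz ijm by auto
  have T: "(\<Sum>j=1..3. k j) = k 1 + k 2 + k 3" "(\<Sum>j=1..3. k j) = - (l i + l j + l m)"
    using sum unfolding finite_perm3(2)[OF perm, of l] by (simp_all only: sum_1_3)
  define X where "X = (- (a 1 * a 2 * a 3)) powi (\<Sum>j=1..3. k j) * q powi choose2 (\<Sum>j=1..3. k j)
     / (\<Prod>j=1..3. q powi (choose2 (k j) + choose2 (l j)) * a j powi k j * b j powi l j)"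
  have dd: "(\<Prod>j=1..3. q powi (choose2 (k j) + choose2 (l j)) * a j powi k j * b j powi l j)
     = (q powi (choose2 (k 1) + choose2 (l i)) * a 1 powi k 1 * b i powi l i)
      * (q powi (choose2 (k 2) + choose2 (l j)) * a 2 powi k 2 * b j powi l j)
      * (q powi (choose2 (k 3) + choose2 (l m)) * a 3 powi k 3 * b m powi l m)"
  proof -
    have "(\<Prod>j=1..3. q powi (choose2 (k j) + choose2 (l j)) * a j powi k j * b j powi l j)
      = (\<Prod>j=1..3. q powi choose2 (k j)) * (\<Prod>j=1..3. q powi choose2 (l j)) * (\<Prod>j=1..3. a j powi k j) * (\<Prod>j=1..3. b j powi l j)"
      by (simp add: power_int_add prod.distrib mult_ac)
    also have "\<dots> = (\<Prod>j=1..3. q powi choose2 (k j)) * (q powi choose2 (l i) * q powi choose2 (l j) * q powi choose2 (l m))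
      * (\<Prod>j=1..3. a j powi k j) * (b i powi l i * b j powi l j * b m powi l m)"
      unfolding finite_perm3(1)[OF perm, of "\<lambda>j. q powi choose2 (l j)"] finite_perm3(1)[OF perm, of "\<lambda>j. b j powi l j"] ..
    finally show ?thesis unfolding prod_1_3 by (simp add: power_int_add mult_ac)
  qed
  have "(\<Prod>j=1..3. (- b j) powi l j * q powi choose2 (l j)) * s.Delta i j m
    = ((\<Prod>j=1..3. (- b j) powi l j * q powi choose2 (l j))
        * (q powi l i * ((- 1 / (b j / b i)) powi (l j - l i) * q powi (- choose2 (l j - l i)))) * (\<Prod>n=1..3. th n))
     * (Q * (Gam * b i * theta (b j / b i) * (\<Prod>n=1..3. theta (a n * b m))))"
    unfolding s.Delta_def G t1 t2 by (simp add: mult_ac)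
  also have "(\<Prod>j=1..3. (- b j) powi l j * q powi choose2 (l j))
        * (q powi l i * ((- 1 / (b j / b i)) powi (l j - l i) * q powi (- choose2 (l j - l i)))) * (\<Prod>n=1..3. th n) = X"
    unfolding finite_perm3(1)[OF perm, of "\<lambda>j. (- b j) powi l j * q powi choose2 (l j)"] prod_1_3[of th] X_def dd
    unfolding th_def
    by (rule shift_factor_identity[OF nz bal T])
  also have "X * (Q * (Gam * b i * theta (b j / b i) * (\<Prod>n=1..3. theta (a n * b m)))) = K_value q a b k l * Delta i j m"
    unfolding K_value_def Delta_def X_def Q_def Let_def prod_1_3[of a] by simp
  finally show ?thesis .
qed

text \<open>
  Up to a common factor, the residue of the theta quotient \<open>Theta\<close> at \<open>b j\<close>, divided by \<open>b j ^ 3\<close>.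
\<close>

definition weight where
  "weight j = (\<Prod>m=1..3. theta (a m * b j)) / (b j ^ 2 * (\<Prod>i\<in>{1..3}-{j}. theta (b i / b j)))"

text \<open>
  This is a form of the three-term relation for theta functions; here it holds because the three numbers
  are differences of three Jackson sums.
\<close>

lemma Delta_cyclic_sum: "Delta 1 2 3 + Delta 2 3 1 + Delta 3 1 2 = 0"
proof -
  have "Delta 1 2 3 = qsum Lam 1 - qsum Lam 2" "Delta 2 3 1 = qsum Lam 2 - qsum Lam 3"
    "Delta 3 1 2 = qsum Lam 3 - qsum Lam 1"
    by (rule saalschuetz[symmetric]; auto)+
  thus ?thesis by (simp only:) simp
qed

text \<open>
  Both sides are products of the same theta functions; only \<open>theta (1/x) = - theta x / x\<close> is needed to
  compare them.
\<close>

lemma weight_Delta: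
  defines "om \<equiv> 1 / (Gam * b 1 * b 3 ^ 2 * theta (b 1 / b 3) * theta (b 2 / b 3) * theta (b 2 / b 1))"
  shows "weight 3 = om * Delta 1 2 3" "weight 1 = om * Delta 2 3 1" "weight 2 = om * Delta 3 1 2"
    "om * Delta 1 2 3 * Delta 2 3 1 * Delta 3 1 2 = - (Gam ^ 2 * (\<Prod>i=1..3. \<Prod>j=1..3. theta (a i * b j)))"
proof -
  have nz: "b 1 \<noteq> 0" "b 2 \<noteq> 0" "b 3 \<noteq> 0" using b_nz by auto
  have perm: "{1, 2, 3} = {1..3::nat}" by auto
  have "Gam \<noteq> 0" using Delta_nz[of 1 2 3] perm unfolding Delta_def by auto
  have tnz: "theta (b i / b j) \<noteq> 0" if "i \<in> {1..3}" "j \<in> {1..3}" "i \<noteq> j" for i j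
    using bb_generic[OF that] b_nz that by (subst theta_eq_0_iff) auto
  have inv: "theta (b i / b j) = - b i / b j * theta (b j / b i)" if "i \<in> {1..3}" "j \<in> {1..3}" for i j
    using theta_inverse[of "b j / b i"] b_nz that by simp
  define x y z where "x = theta (b 2 / b 1)" and "y = theta (b 3 / b 2)" and "z = theta (b 1 / b 3)"
  have e: "theta (b 1 / b 2) = - b 1 / b 2 * x" "theta (b 2 / b 3) = - b 2 / b 3 * y" "theta (b 3 / b 1) = - b 3 / b 1 * z"
    unfolding x_def y_def z_def by (rule inv; simp)+
  have xyz: "x \<noteq> 0" "y \<noteq> 0" "z \<noteq> 0" unfolding x_def y_def z_def by (rule tnz; simp)+
  have s: "{1..3} - {1} = {2, 3::nat}" "{1..3} - {2} = {1, 3::nat}" "{1..3} - {3} = {1, 2::nat}" by auto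
  have om: "om = 1 / (Gam * b 1 * b 3 ^ 2 * z * (- b 2 / b 3 * y) * x)"
    unfolding om_def e x_def[symmetric] z_def[symmetric] ..
  define t where "t = (\<lambda>j. \<Prod>m=1..3. theta (a m * b j))"
  have pair: "(\<Prod>i\<in>{2, 3::nat}. f i) = f 2 * f 3" "(\<Prod>i\<in>{1, 3::nat}. f i) = f 1 * f 3"
    "(\<Prod>i\<in>{1, 2::nat}. f i) = f 1 * f 2" for f :: "nat \<Rightarrow> complex" by simp_all
  have D: "Delta 1 2 3 = Gam * b 1 * x * t 3"
     "Delta 2 3 1 = Gam * b 2 * y * t 1"
     "Delta 3 1 2 = Gam * b 3 * z * t 2"
    unfolding Delta_def x_def y_def z_def t_def by (simp_all only:)
  have W: "weight 3 = t 3 / (b 3 ^ 2 * (z * (- b 2 / b 3 * y)))"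
     "weight 1 = t 1 / (b 1 ^ 2 * (x * (- b 3 / b 1 * z)))"
     "weight 2 = t 2 / (b 2 ^ 2 * ((- b 1 / b 2 * x) * y))"
    unfolding t_def
    by (simp_all only: weight_def s pair e x_def[symmetric] y_def[symmetric] z_def[symmetric])
  note nzs = nz xyz \<open>Gam \<noteq> 0\<close>
  show "weight 3 = om * Delta 1 2 3" "weight 1 = om * Delta 2 3 1" "weight 2 = om * Delta 3 1 2"
    unfolding om D W using nzs by (simp_all add: divide_simps power2_eq_square del: One_nat_def)
  have sw: "(\<Prod>i=1..3. \<Prod>j=1..3. theta (a i * b j)) = t 1 * t 2 * t 3"
    unfolding t_def by (subst prod.swap) (rule prod_1_3)
  show "om * Delta 1 2 3 * Delta 2 3 1 * Delta 3 1 2 = - (Gam ^ 2 * (\<Prod>i=1..3. \<Prod>j=1..3. theta (a i * b j)))"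
    unfolding om D sw using nzs by (simp add: divide_simps power2_eq_square del: One_nat_def)
qed

text \<open>
  Since \<open>weight\<close> is proportional to the cyclic \<open>Delta\<close>, the sums \<open>\<Sum>\<^sub>j weight j\<close> and \<open>\<Sum>\<^sub>j weight j * I j\<close> vanish.
  Hence \<open>I 3\<close> and \<open>J 3\<close> drop out, and only products of differences survive.
\<close>

lemma weighted_sum:
  fixes I J :: "nat \<Rightarrow> complex"
  assumes "I 1 - I 2 = Delta 1 2 3 * x" "I 2 - I 3 = Delta 2 3 1 * x"
    and "J 1 - J 2 = c * Delta 1 2 3 * y" "J 2 - J 3 = c * Delta 2 3 1 * y"
  shows "(\<Sum>j=1..3. weight j * I j * J j) = c * Gam ^ 2 * (\<Prod>i=1..3. \<Prod>j=1..3. theta (a i * b j)) * x * y"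
proof -
  define om where "om = 1 / (Gam * b 1 * b 3 ^ 2 * theta (b 1 / b 3) * theta (b 2 / b 3) * theta (b 2 / b 1))"
  note w = weight_Delta[folded om_def]
  define D1 D2 D3 where "D1 = Delta 2 3 1" and "D2 = Delta 3 1 2" and "D3 = Delta 1 2 3"
  have "D3 + D1 + D2 = 0" unfolding D1_def D2_def D3_def by (rule Delta_cyclic_sum)
  hence D: "D2 = - D1 - D3" by algebra
  have I: "I 1 = I 3 + D1 * x + D3 * x" "I 2 = I 3 + D1 * x"
    using assms(1,2) unfolding D1_def D3_def by (simp_all add: algebra_simps)
  have J: "J 1 = J 3 + c * D1 * y + c * D3 * y" "J 2 = J 3 + c * D1 * y"
    using assms(3,4) unfolding D1_def D3_def by (simp_all add: algebra_simps)
  have "(\<Sum>j=1..3. weight j * I j * J j) = om * (D1 * I 1 * J 1 + D2 * I 2 * J 2 + D3 * I 3 * J 3)"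
    unfolding sum_1_3 w D1_def D2_def D3_def by (simp add: algebra_simps)
  also have "D1 * I 1 * J 1 + D2 * I 2 * J 2 + D3 * I 3 * J 3 = - (D3 * D1 * D2 * c * x * y)"
    unfolding I J D by algebra
  finally show ?thesis using w(4) unfolding D1_def D2_def D3_def by algebra
qed

end


section \<open>Rational functions with simple poles in a prescribed set\<close>

lemma rf_num_den: "F = to_fract (rf_num F) / to_fract (rf_den F)"
  using Fract_quot_of_fract[of F]
  by (simp add: rf_num_def rf_den_def Fract_conv_to_fract)

lemma rf_den_nz [simp]: "rf_den F \<noteq> 0"
  by (simp add: rf_den_def)

lemma rf_coprime: "poly (rf_num F) z \<noteq> 0 \<or> poly (rf_den F) z \<noteq> 0"
  unfolding rf_num_def rf_den_def by (rule coprime_poly_0[OF coprime_quot_of_fract])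

lemma rf_cross_mult:
  assumes "F = to_fract n / to_fract d" "d \<noteq> 0"
  shows "rf_num F * d = n * rf_den F"
proof -
  have "to_fract (rf_num F) / to_fract (rf_den F) = to_fract n / to_fract d"
    using rf_num_den[of F] assms(1) by simp
  hence "to_fract (rf_num F * d) = to_fract (n * rf_den F)"
    using assms(2) by (simp add: frac_eq_eq)
  thus ?thesis by (simp only: to_fract_eq_iff)
qed

text \<open>
  \<open>rf_eval\<close> is compatible with the field operations only away from poles. The relation records regularity
  together with the value, for an arbitrary representation as a quotient.
\<close>

definition rf_has_value :: "ratfun \<Rightarrow> complex \<Rightarrow> complex \<Rightarrow> bool" where
  "rf_has_value F z w \<longleftrightarrow> (\<exists>n d. F = to_fract n / to_fract d \<and> poly d z \<noteq> 0 \<and> w = poly n z / poly d z)"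

lemma rf_has_valueD:
  assumes "rf_has_value F z w" shows "rf_eval F z = w"
proof -
  obtain n d where F: "F = to_fract n / to_fract d" and d: "poly d z \<noteq> 0" and w: "w = poly n z / poly d z"
    using assms unfolding rf_has_value_def by blast
  have "rf_num F * d = n * rf_den F" using F d by (intro rf_cross_mult) auto
  hence "poly (rf_num F * d) z = poly (n * rf_den F) z" by simp
  hence e: "poly (rf_num F) z * poly d z = poly n z * poly (rf_den F) z" by simp
  have "poly (rf_den F) z \<noteq> 0"
    using rf_coprime[of F z] e d by auto
  thus ?thesis using e d w unfolding rf_eval_def by (simp add: frac_eq_eq)
qed

lemma rf_has_value_eval: "poly (rf_den F) z \<noteq> 0 \<Longrightarrow> rf_has_value F z (rf_eval F z)"
  unfolding rf_has_value_def rf_eval_def using rf_num_den by blast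

lemma rf_has_value_const: "rf_has_value (rf_const c) z c"
  unfolding rf_has_value_def rf_const_def by (intro exI[of _ "[:c:]"] exI[of _ 1]) simp

lemma rf_has_value_Z: "rf_has_value rf_Z z z"
  unfolding rf_has_value_def rf_Z_def by (intro exI[of _ "[:0, 1:]"] exI[of _ 1]) simp

lemma rf_has_value_add:
  assumes "rf_has_value F z v" "rf_has_value G z w" shows "rf_has_value (F + G) z (v + w)"
proof -
  obtain n d m e where "F = to_fract n / to_fract d" "poly d z \<noteq> 0" "v = poly n z / poly d z"
    and "G = to_fract m / to_fract e" "poly e z \<noteq> 0" "w = poly m z / poly e z"
    using assms unfolding rf_has_value_def by metis
  moreover from this have "d \<noteq> 0" "e \<noteq> 0" by auto
  ultimately show ?thesis
    unfolding rf_has_value_def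
    by (intro exI[of _ "n * e + m * d"] exI[of _ "d * e"]) (simp add: add_frac_eq)
qed

lemma rf_has_value_mult:
  assumes "rf_has_value F z v" "rf_has_value G z w" shows "rf_has_value (F * G) z (v * w)"
proof -
  obtain n d m e where "F = to_fract n / to_fract d" "poly d z \<noteq> 0" "v = poly n z / poly d z"
    and "G = to_fract m / to_fract e" "poly e z \<noteq> 0" "w = poly m z / poly e z"
    using assms unfolding rf_has_value_def by metis
  thus ?thesis
    unfolding rf_has_value_def
    by (intro exI[of _ "n * m"] exI[of _ "d * e"]) simp
qed

lemma rf_has_value_inverse:
  assumes "rf_has_value F z v" "v \<noteq> 0" shows "rf_has_value (inverse F) z (inverse v)"
proof -
  obtain n d where "F = to_fract n / to_fract d" "poly d z \<noteq> 0" "v = poly n z / poly d z"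
    using assms unfolding rf_has_value_def by metis
  thus ?thesis using assms(2)
    unfolding rf_has_value_def
    by (intro exI[of _ d] exI[of _ n]) simp
qed

lemma rf_has_value_divide:
  "rf_has_value F z v \<Longrightarrow> rf_has_value G z w \<Longrightarrow> w \<noteq> 0 \<Longrightarrow> rf_has_value (F / G) z (v / w)"
  unfolding divide_inverse by (intro rf_has_value_mult rf_has_value_inverse)

lemma rf_has_value_1: "rf_has_value 1 z 1"
  using rf_has_value_const[of 1 z] by (simp add: rf_const_def one_pCons[symmetric])

lemma rf_const_mult: "rf_const x * rf_const y = rf_const (x * y)"
proof -
  have "[:x:] * [:y:] = [:x * y:]" by simp
  thus ?thesis unfolding rf_const_def by (metis to_fract_mult)
qed

lemma rf_const_1: "rf_const 1 = 1"
  by (simp add: rf_const_def one_pCons[symmetric])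

lemma rf_const_minus_1: "rf_const (- 1) = - 1"
proof -
  have "[:- 1:] = - (1 :: complex poly)" by (simp add: one_pCons)
  thus ?thesis by (simp only: rf_const_def to_fract_uminus to_fract_1)
qed

lemma rf_has_value_diff:
  assumes "rf_has_value F z v" "rf_has_value G z w" shows "rf_has_value (F - G) z (v - w)"
proof -
  have e: "F - G = F + rf_const (-1) * G" "v - w = v + - 1 * w"
    by (simp_all add: rf_const_minus_1)
  show ?thesis
    unfolding e by (intro rf_has_value_add rf_has_value_mult rf_has_value_const assms)
qed

lemma rf_has_value_power: "rf_has_value F z v \<Longrightarrow> rf_has_value (F ^ n) z (v ^ n)"
  by (induction n) (auto intro: rf_has_value_1 rf_has_value_mult)

lemma rf_has_value_powi: "rf_has_value F z v \<Longrightarrow> v \<noteq> 0 \<Longrightarrow> rf_has_value (F powi n) z (v powi n)"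
  unfolding power_int_def by (auto intro: rf_has_value_power rf_has_value_inverse)

lemma rf_has_value_prod:
  "(\<And>i. i \<in> S \<Longrightarrow> rf_has_value (F i) z (v i)) \<Longrightarrow> rf_has_value (\<Prod>i\<in>S. F i) z (\<Prod>i\<in>S. v i)"
  by (induction S rule: infinite_finite_induct) (auto intro: rf_has_value_1 rf_has_value_mult)

lemma rf_has_value_qpoch:
  assumes "rf_has_value X z x" "q \<noteq> 0" "x \<notin> range (\<lambda>k::int. q powi k)"
  shows "rf_has_value (qpoch (rf_const q) X k) z (qpoch q x k)"
proof -
  have "rf_has_value (1 - X / rf_const q ^ i) z (1 - x / q ^ i)" for i
    using assms by (intro rf_has_value_diff rf_has_value_divide rf_has_value_1 rf_has_value_power rf_has_value_const) auto
  moreover have "rf_has_value (1 - X * rf_const q ^ i) z (1 - x * q ^ i)" for i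
    using assms by (intro rf_has_value_diff rf_has_value_mult rf_has_value_1 rf_has_value_power rf_has_value_const) auto
  moreover have "1 - x / q ^ i \<noteq> 0" for i
  proof
    assume "1 - x / q ^ i = 0"
    hence "x = q powi int i" using assms(2) by (simp add: field_simps)
    with assms(3) show False by blast
  qed
  ultimately show ?thesis
    unfolding qpoch_def by (auto intro!: rf_has_value_prod rf_has_value_inverse)
qed

definition root_poly :: "complex set \<Rightarrow> complex poly" where
  "root_poly A = (\<Prod>p\<in>A. [:- p, 1:])"

lemma root_poly_nz [simp]: "root_poly A \<noteq> 0"
  unfolding root_poly_def by (cases "finite A") auto

lemma degree_root_poly: "degree (root_poly A) = card A"
  unfolding root_poly_def by (subst degree_prod_eq_sum_degree) auto

lemma poly_root_poly_eq_0_iff: "finite A \<Longrightarrow> poly (root_poly A) z = 0 \<longleftrightarrow> z \<in> A"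
  by (auto simp: root_poly_def poly_prod)

lemma order_root_poly:
  assumes "finite A" "z \<in> A" shows "order z (root_poly A) = 1"
proof -
  have r: "root_poly A = [:- z, 1:] * root_poly (A - {z})"
    unfolding root_poly_def using assms by (rule prod.remove)
  have "order z (root_poly (A - {z})) = 0"
    using assms by (intro order_0I) (simp add: poly_root_poly_eq_0_iff)
  moreover have "order z [:- z, 1:] = 1" using order_power_n_n[of z 1] by simp
  ultimately show ?thesis unfolding r using root_poly_nz[of A] unfolding r by (subst order_mult) auto
qed

lemma root_poly_Un_disjoint:
  "finite A \<Longrightarrow> finite B \<Longrightarrow> A \<inter> B = {} \<Longrightarrow> root_poly (A \<union> B) = root_poly A * root_poly B"
  unfolding root_poly_def by (rule prod.union_disjoint)

definition W_poles :: "complex \<Rightarrow> (nat \<Rightarrow> complex) \<Rightarrow> (nat \<Rightarrow> complex) \<Rightarrow> complex set" where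
  "W_poles q a b = {z. \<exists>j\<in>{1..3}. \<exists>k::int. (k > 0 \<and> z = inverse (a j) * q powi k) \<or>
                                (k < 0 \<and> z = b j * q powi k)}"

text \<open>
  A normal form in which \<open>W\<close> is visibly closed under addition: over \<open>\<complex>\<close> a polynomial with simple roots is
  a constant times the product of its linear factors.
\<close>

lemma W_space_iff:
  "F \<in> W_space q a b \<longleftrightarrow> (\<exists>A n. finite A \<and> A \<subseteq> W_poles q a b \<and> degree n \<le> card A
      \<and> F = to_fract n / to_fract (root_poly A))"
proof
  assume F: "F \<in> W_space q a b"
  define A where "A = {z. poly (rf_den F) z = 0}"
  have A: "finite A" unfolding A_def by (intro poly_roots_finite) simp
  define c where "c = lead_coeff (rf_den F)"
  have c: "c \<noteq> 0" by (simp add: c_def)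
  have "rf_den F = smult c (\<Prod>z\<in>A. [:- z, 1:] ^ order z (rf_den F))"
    unfolding c_def A_def by (rule complex_poly_decompose[symmetric])
  also have "(\<Prod>z\<in>A. [:- z, 1:] ^ order z (rf_den F)) = root_poly A"
    unfolding root_poly_def using F by (intro prod.cong) (auto simp: A_def W_space_def)
  finally have d: "rf_den F = smult c (root_poly A)" .
  have dc: "to_fract (rf_den F) = to_fract [:c:] * to_fract (root_poly A)"
    unfolding d by (simp flip: to_fract_mult)
  have nc: "to_fract (smult (1 / c) (rf_num F)) = to_fract (rf_num F) / to_fract [:c:]"
  proof -
    have "to_fract (smult (1 / c) (rf_num F)) * to_fract [:c:] = to_fract (rf_num F)"
      using c by (simp flip: to_fract_mult)
    thus ?thesis using c by (simp add: eq_divide_eq)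
  qed
  have "degree (rf_num F) \<le> degree (rf_den F)" using F by (simp add: W_space_def)
  also have "\<dots> = card A" unfolding d using c by (simp add: degree_root_poly)
  finally have "degree (smult (1 / c) (rf_num F)) \<le> card A" using c by simp
  moreover have "F = to_fract (smult (1 / c) (rf_num F)) / to_fract (root_poly A)"
    unfolding nc using rf_num_den[of F] unfolding dc by simp
  moreover have "A \<subseteq> W_poles q a b"
    using F unfolding A_def W_space_def W_poles_def by blast
  ultimately show "\<exists>A n. finite A \<and> A \<subseteq> W_poles q a b \<and> degree n \<le> card A
      \<and> F = to_fract n / to_fract (root_poly A)" using A by blast
next
  assume "\<exists>A n. finite A \<and> A \<subseteq> W_poles q a b \<and> degree n \<le> card A
      \<and> F = to_fract n / to_fract (root_poly A)"
  then obtain A n where A: "finite A" "A \<subseteq> W_poles q a b" "degree n \<le> card A"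
    and F: "F = to_fract n / to_fract (root_poly A)" by blast
  have cm: "rf_num F * root_poly A = n * rf_den F" using F by (intro rf_cross_mult) auto
  have dvd: "rf_den F dvd root_poly A"
  proof -
    have "rf_den F dvd rf_num F * root_poly A" unfolding cm by simp
    moreover have "coprime (rf_den F) (rf_num F)"
      unfolding rf_num_def rf_den_def using coprime_quot_of_fract coprime_commute by blast
    ultimately show ?thesis by (simp add: coprime_dvd_mult_right_iff)
  qed
  have deg: "degree (rf_num F) \<le> degree (rf_den F)"
  proof (cases "n = 0")
    case True
    hence "rf_num F = 0" using cm by simp
    thus ?thesis by simp
  next
    case False
    hence "rf_num F \<noteq> 0" using cm by (metis mult_eq_0_iff rf_den_nz mult_zero_left)
    hence "degree (rf_num F) + card A = degree n + degree (rf_den F)"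
      using arg_cong[OF cm, of degree] False by (simp add: degree_mult_eq degree_root_poly)
    thus ?thesis using A(3) by simp
  qed
  have ord: "z \<in> A \<and> order z (rf_den F) = 1" if "poly (rf_den F) z = 0" for z
  proof -
    have "poly (root_poly A) z = 0" using dvd that by (metis dvd_def mult_zero_left poly_mult)
    hence z: "z \<in> A" using A(1) by (simp add: poly_root_poly_eq_0_iff)
    have "order z (rf_den F) \<le> order z (root_poly A)"
      using dvd by (intro dvd_imp_order_le) auto
    hence "order z (rf_den F) \<le> 1" using order_root_poly[OF A(1) z] by simp
    moreover have "order z (rf_den F) \<noteq> 0" using that by (simp add: order_root)
    ultimately show ?thesis using z by simp
  qed
  show "F \<in> W_space q a b"
    unfolding W_space_def using deg ord A(2) unfolding W_poles_def by blast
qed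

lemma rf_const_mult_to_fract: "rf_const c * to_fract n = to_fract (smult c n)"
  unfolding rf_const_def by (simp flip: to_fract_mult)

lemma W_space_const_mult: "F \<in> W_space q a b \<Longrightarrow> rf_const c * F \<in> W_space q a b"
  unfolding W_space_iff
proof (elim exE conjE)
  fix A n assume "finite A" "A \<subseteq> W_poles q a b" "degree n \<le> card A" "F = to_fract n / to_fract (root_poly A)"
  thus "\<exists>A n. finite A \<and> A \<subseteq> W_poles q a b \<and> degree n \<le> card A
      \<and> rf_const c * F = to_fract n / to_fract (root_poly A)"
    by (intro exI[of _ A] exI[of _ "smult c n"])
      (auto simp: rf_const_mult_to_fract[symmetric] intro: order_trans[OF degree_smult_le])
qed

lemma W_space_add:
  assumes "F \<in> W_space q a b" "G \<in> W_space q a b" shows "F + G \<in> W_space q a b"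
proof -
  obtain A n where A: "finite A" "A \<subseteq> W_poles q a b" "degree n \<le> card A"
    and F: "F = to_fract n / to_fract (root_poly A)" using assms(1) unfolding W_space_iff by blast
  obtain B m where B: "finite B" "B \<subseteq> W_poles q a b" "degree m \<le> card B"
    and G: "G = to_fract m / to_fract (root_poly B)" using assms(2) unfolding W_space_iff by blast
  have eA: "root_poly (A \<union> B) = root_poly A * root_poly (B - A)"
    using root_poly_Un_disjoint[of A "B - A"] A B by simp
  have eB: "root_poly (A \<union> B) = root_poly B * root_poly (A - B)"
    using root_poly_Un_disjoint[of B "A - B"] A B by (simp add: Un_commute)
  have cA: "card (A \<union> B) = card A + card (B - A)"
    using card_Un_disjoint[of A "B - A"] A B by simp
  have cB: "card (A \<union> B) = card B + card (A - B)"
    using card_Un_disjoint[of B "A - B"] A B by (simp add: Un_commute)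
  have F': "F = to_fract (n * root_poly (B - A)) / to_fract (root_poly (A \<union> B))"
    unfolding F eA by simp
  have G': "G = to_fract (m * root_poly (A - B)) / to_fract (root_poly (A \<union> B))"
    unfolding G eB by simp
  have "degree (n * root_poly (B - A) + m * root_poly (A - B)) \<le> card (A \<union> B)"
  proof (intro degree_add_le)
    show "degree (n * root_poly (B - A)) \<le> card (A \<union> B)"
      using degree_mult_le[of n "root_poly (B - A)"] A(3) unfolding cA degree_root_poly by simp
    show "degree (m * root_poly (A - B)) \<le> card (A \<union> B)"
      using degree_mult_le[of m "root_poly (A - B)"] B(3) unfolding cB degree_root_poly by simp
  qed
  moreover have "F + G = to_fract (n * root_poly (B - A) + m * root_poly (A - B)) / to_fract (root_poly (A \<union> B))"
    by (subst F', subst G') (simp add: add_divide_distrib)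
  ultimately show ?thesis unfolding W_space_iff using A B by (metis Un_least finite_UnI)
qed

lemma split_off_pole:
  assumes A: "finite A" "p \<notin> A" and n: "degree n \<le> Suc (card A)"
  obtains c m where "degree m \<le> card A" "poly n p \<noteq> 0 \<Longrightarrow> c \<noteq> 0"
    "to_fract n / to_fract (root_poly (insert p A))
      = rf_const c * (1 / to_fract [:- p, 1:]) + to_fract m / to_fract (root_poly A)"
proof -
  define D where "D = root_poly A"
  have Dp: "poly D p \<noteq> 0" unfolding D_def using A by (simp add: poly_root_poly_eq_0_iff)
  define c where "c = poly n p / poly D p"
  have "poly (n - smult c D) p = 0" using Dp by (simp add: c_def)
  then obtain m where m: "n - smult c D = [:- p, 1:] * m"
    unfolding poly_eq_0_iff_dvd by (auto elim: dvdE)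
  have deg: "degree m \<le> card A"
  proof (cases "m = 0")
    case False
    hence "Suc (degree m) = degree (n - smult c D)" unfolding m by (subst degree_mult_eq) auto
    also have "\<dots> \<le> Suc (card A)"
      using n degree_smult_le[of c D] by (intro degree_diff_le) (auto simp: D_def degree_root_poly)
    finally show ?thesis by simp
  qed simp
  have R: "root_poly (insert p A) = [:- p, 1:] * D"
    unfolding D_def root_poly_def using A by (intro prod.insert) auto
  have n_eq: "n = smult c D + [:- p, 1:] * m" using m by (simp add: algebra_simps)
  have "(e * d + x * y) / (x * d) = e * (1 / x) + y / d" if "x \<noteq> 0" "d \<noteq> 0" for e x y d :: ratfun
    using that by (simp add: field_simps)
  from this[of "to_fract [:- p, 1:]" "to_fract D"]
  have "to_fract n / to_fract (root_poly (insert p A))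
      = rf_const c * (1 / to_fract [:- p, 1:]) + to_fract m / to_fract D"
    unfolding R n_eq
    by (simp only: to_fract_add to_fract_mult rf_const_mult_to_fract[symmetric]) (simp add: D_def)
  moreover have "c \<noteq> 0" if "poly n p \<noteq> 0" using that Dp by (simp add: c_def)
  ultimately show ?thesis using that deg unfolding D_def by blast
qed

lemma partial_fractions_induct:
  assumes A: "finite A" "degree n \<le> card A"
    and Q1: "Q 1" and Qadd: "\<And>F G. Q F \<Longrightarrow> Q G \<Longrightarrow> Q (F + G)"
    and Qmul: "\<And>c F. Q F \<Longrightarrow> Q (rf_const c * F)"
    and Qp: "\<And>p. p \<in> A \<Longrightarrow> Q (1 / to_fract [:- p, 1:])"
  shows "Q (to_fract n / to_fract (root_poly A))"
  using A Qp
proof (induction A arbitrary: n rule: finite_induct)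
  case empty
  then obtain c where "n = [:c:]" by (auto elim: degree_eq_zeroE)
  thus ?case using Qmul[OF Q1, of c] by (simp add: root_poly_def rf_const_def)
next
  case (insert p A)
  have "degree n \<le> Suc (card A)" using insert.prems(1) insert.hyps by simp
  from split_off_pole[OF insert.hyps(1,2) this]
  obtain c m where m: "degree m \<le> card A"
    and eq: "to_fract n / to_fract (root_poly (insert p A))
      = rf_const c * (1 / to_fract [:- p, 1:]) + to_fract m / to_fract (root_poly A)"
    by blast
  have "Q (to_fract m / to_fract (root_poly A))" using insert m by auto
  moreover have "Q (rf_const c * (1 / to_fract [:- p, 1:]))" using insert.prems by (intro Qmul) auto
  ultimately show ?case unfolding eq by (intro Qadd)
qed

text \<open>
  The functions \<open>N n / ((z - p 1) \<dots> (z - p n))\<close> are triangular with respect to the simple fractions, with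
  nonzero diagonal because \<open>N n\<close> does not vanish at \<open>p n\<close>.
\<close>

lemma simple_fractions_from_chain:
  fixes p :: "nat \<Rightarrow> complex" and N :: "nat \<Rightarrow> complex poly"
  assumes Q1: "Q 1" and Qadd: "\<And>F G. Q F \<Longrightarrow> Q G \<Longrightarrow> Q (F + G)"
    and Qmul: "\<And>c F. Q F \<Longrightarrow> Q (rf_const c * F)"
    and inj: "inj p"
    and QN: "\<And>n. n > 0 \<Longrightarrow> Q (to_fract (N n) / to_fract (root_poly (p ` {1..n})))"
    and N: "\<And>n. n > 0 \<Longrightarrow> degree (N n) \<le> n" "\<And>n. n > 0 \<Longrightarrow> poly (N n) (p n) \<noteq> 0"
    and n: "n > 0"
  shows "Q (1 / to_fract [:- p n, 1:])"
  using n
proof (induction n rule: less_induct)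
  case (less n)
  define A where "A = p ` {1..n - 1}"
  have fin: "finite A" and card: "card A = n - 1"
    unfolding A_def using inj by (auto simp: card_image inj_on_subset)
  have pn: "p n \<notin> A" using inj less.prems unfolding A_def inj_def by fastforce
  have ins: "p ` {1..n} = insert (p n) A"
  proof -
    have "{1..n} = insert n {1..n - 1}" using less.prems by auto
    thus ?thesis unfolding A_def by simp
  qed
  have "degree (N n) \<le> Suc (card A)" using N(1)[OF less.prems] card less.prems by simp
  from split_off_pole[OF fin pn this]
  obtain c m where m: "degree m \<le> card A" and c: "c \<noteq> 0"
    and eq: "to_fract (N n) / to_fract (root_poly (insert (p n) A))
      = rf_const c * (1 / to_fract [:- p n, 1:]) + to_fract m / to_fract (root_poly A)"
    using N(2)[OF less.prems] by blast
  have px: "Q (1 / to_fract [:- x, 1:])" if "x \<in> A" for x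
    using that less.IH unfolding A_def by auto
  have "Q (to_fract m / to_fract (root_poly A))"
  proof (rule partial_fractions_induct[where Q = Q])
    show "finite A" "degree m \<le> card A" "Q 1" by fact+
  qed (fact Qadd Qmul px)+
  hence "Q (rf_const (1 / c) * (to_fract (N n) / to_fract (root_poly (p ` {1..n})) + rf_const (- 1) * (to_fract m / to_fract (root_poly A))))"
    by (intro Qadd Qmul QN less.prems)
  also have "rf_const (1 / c) * (to_fract (N n) / to_fract (root_poly (p ` {1..n})) + rf_const (- 1) * (to_fract m / to_fract (root_poly A)))
     = 1 / to_fract [:- p n, 1:]"
  proof -
    have cc: "rf_const (1 / c) * rf_const c = 1"
      using c by (simp add: rf_const_mult rf_const_1)
    have alg: "x * (y * z + w + - 1 * w) = z" if "x * y = 1" for x y z w :: ratfun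
      using that by (simp add: mult.assoc[symmetric])
    show ?thesis unfolding ins eq rf_const_minus_1 by (rule alg[OF cc])
  qed
  finally show ?case .
qed


section \<open>The spanning functions\<close>

lemma to_fract_prod: "to_fract (\<Prod>i\<in>S. f i) = (\<Prod>i\<in>S. to_fract (f i))"
  by (induction S rule: infinite_finite_induct) auto

lemma rf_const_power: "rf_const c ^ n = rf_const (c ^ n)"
  by (induction n) (simp_all add: rf_const_mult rf_const_1)

lemma rf_const_prod: "(\<Prod>i\<in>S. rf_const (f i)) = rf_const (\<Prod>i\<in>S. f i)"
  by (induction S rule: infinite_finite_induct) (simp_all add: rf_const_mult rf_const_1)

lemma rf_const_inverse: "c \<noteq> 0 \<Longrightarrow> inverse (rf_const c) = rf_const (inverse c)"
  by (rule inverse_unique) (simp add: rf_const_mult rf_const_1)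

lemma rf_Z_nz [simp]: "rf_Z \<noteq> 0"
  by (simp add: rf_Z_def)

lemma one_minus_rf_const_Z: "1 - rf_const c * rf_Z = to_fract [:1, - c:]"
proof -
  have "rf_const c * rf_Z = to_fract [:0, c:]"
    unfolding rf_const_def rf_Z_def by (simp flip: to_fract_mult)
  hence "1 - rf_const c * rf_Z = to_fract (1 - [:0, c:])" by simp
  also have "1 - [:0, c:] = [:1, - c:]" by (simp add: one_pCons)
  finally show ?thesis .
qed

lemma rf_Z_minus_const: "rf_Z - rf_const c = to_fract [:- c, 1:]"
  unfolding rf_Z_def rf_const_def by (simp flip: to_fract_diff)

definition a_num :: "complex \<Rightarrow> complex \<Rightarrow> int \<Rightarrow> complex poly" where
  "a_num q c k = (\<Prod>i<nat k. [:1, - (c * q ^ i):])"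

definition b_num :: "complex \<Rightarrow> complex \<Rightarrow> int \<Rightarrow> complex poly" where
  "b_num q c l = (\<Prod>i<nat l. [:- (c * q ^ i), 1:])"

definition a_roots :: "complex \<Rightarrow> complex \<Rightarrow> int \<Rightarrow> complex set" where
  "a_roots q c k = (\<lambda>i. inverse c * q powi int i) ` {1..nat (- k)}"

definition b_roots :: "complex \<Rightarrow> complex \<Rightarrow> int \<Rightarrow> complex set" where
  "b_roots q c l = (\<lambda>i. c * q powi (- int i)) ` {1..nat (- l)}"

lemma degree_a_num: "degree (a_num q c k) \<le> nat k"
proof -
  have "degree (a_num q c k) \<le> (\<Sum>i<nat k. degree [:1, - (c * q ^ i):])"
    unfolding a_num_def
    using degree_prod_sum_le[of "{..<nat k}" "\<lambda>i. [:1, - (c * q ^ i):]"] by (simp only: o_def finite_lessThan simp_thms)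
  also have "\<dots> \<le> (\<Sum>i<nat k. 1)" by (intro sum_mono) auto
  finally show ?thesis by simp
qed

lemma degree_b_num: "degree (b_num q c k) \<le> nat k"
proof -
  have "degree (b_num q c k) \<le> (\<Sum>i<nat k. degree [:- (c * q ^ i), 1:])"
    unfolding b_num_def
    using degree_prod_sum_le[of "{..<nat k}" "\<lambda>i. [:- (c * q ^ i), 1:]"] by (simp only: o_def finite_lessThan simp_thms)
  also have "\<dots> \<le> (\<Sum>i<nat k. 1)" by (intro sum_mono) auto
  finally show ?thesis by simp
qed

context q_base begin

lemma q_powi_inj: "q powi m = q powi n \<longleftrightarrow> m = n"
proof
  assume e: "q powi m = q powi n"
  have aux: "\<not> (m < n)" if e: "q powi m = q powi n" for m n
  proof
    assume "m < n"
    then obtain d where d: "n = m + int (Suc d)" by (metis zless_iff_Suc_zadd)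
    have "q powi n = q powi m * q ^ Suc d" unfolding d by (simp add: power_int_add)
    hence "q ^ Suc d = 1" using e by simp
    hence "norm q ^ Suc d = 1" by (metis norm_one norm_power)
    moreover have "norm q ^ Suc d < 1" using q_lt_1 by (intro power_Suc_less_one) auto
    ultimately show False by simp
  qed
  show "m = n" using aux[OF e] aux[OF e[symmetric]] by simp
qed auto

lemma a_roots_finite [simp]: "finite (a_roots q c k)" and b_roots_finite [simp]: "finite (b_roots q c k)"
  by (simp_all add: a_roots_def b_roots_def)

lemma a_roots_inj: "c \<noteq> 0 \<Longrightarrow> inj (\<lambda>i. inverse c * q powi int i)"
  and b_roots_inj: "c \<noteq> 0 \<Longrightarrow> inj (\<lambda>i. c * q powi (- int i))"
proof -
  have "x = y" if "c \<noteq> 0" "c * q powi int x = c * q powi int y" for c x y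
    using that(2) unfolding mult_left_cancel[OF that(1)] q_powi_inj by (simp only: of_nat_eq_iff)
  thus "c \<noteq> 0 \<Longrightarrow> inj (\<lambda>i. inverse c * q powi int i)" unfolding inj_def by (meson inverse_nonzero_iff_nonzero)
  have "x = y" if "c \<noteq> 0" "c * q powi (- int x) = c * q powi (- int y)" for x y
    using that(2) unfolding mult_left_cancel[OF that(1)] q_powi_inj by (simp only: neg_equal_iff_equal of_nat_eq_iff)
  thus "c \<noteq> 0 \<Longrightarrow> inj (\<lambda>i. c * q powi (- int i))" unfolding inj_def by meson
qed

lemma card_a_roots: "c \<noteq> 0 \<Longrightarrow> card (a_roots q c k) = nat (- k)"
  unfolding a_roots_def using a_roots_inj[of c] by (subst card_image) (auto intro: inj_on_subset)

lemma card_b_roots: "c \<noteq> 0 \<Longrightarrow> card (b_roots q c k) = nat (- k)"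
  unfolding b_roots_def using b_roots_inj[of c] by (subst card_image) (auto intro: inj_on_subset)

lemma qpoch_const_Z:
  assumes c: "c \<noteq> 0"
  shows "\<exists>d. d \<noteq> 0 \<and> qpoch (rf_const q) (rf_const c * rf_Z) k
    = rf_const d * to_fract (a_num q c k) / to_fract (root_poly (a_roots q c k))"
proof (cases "k \<ge> 0")
  case True
  have "1 - rf_const c * rf_Z * rf_const q ^ i = to_fract [:1, - (c * q ^ i):]" for i
    unfolding one_minus_rf_const_Z[symmetric] by (simp add: rf_const_mult[symmetric] rf_const_power[symmetric] mult_ac)
  hence "qpoch (rf_const q) (rf_const c * rf_Z) k = to_fract (a_num q c k)"
    using True by (simp add: qpoch_def a_num_def to_fract_prod)
  moreover have "a_roots q c k = {}" using True by (simp add: a_roots_def)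
  ultimately show ?thesis by (intro exI[of _ 1]) (simp add: rf_const_1 root_poly_def)
next
  case False
  define e where "e = (\<lambda>i. - (c / q ^ i))"
  have "1 - rf_const c * rf_Z / rf_const q ^ i = rf_const (e i) * to_fract [:- (inverse c * q powi int i), 1:]" for i
  proof -
    have "rf_const c / rf_const q ^ i = rf_const (c / q ^ i)"
      unfolding divide_inverse rf_const_power by (subst rf_const_inverse) (auto simp: rf_const_mult)
    hence "1 - rf_const c * rf_Z / rf_const q ^ i = 1 - rf_const (c / q ^ i) * rf_Z"
      by (metis times_divide_eq_left)
    also have "\<dots> = to_fract [:1, - (c / q ^ i):]" by (rule one_minus_rf_const_Z)
    also have "[:1, - (c / q ^ i):] = smult (e i) [:- (inverse c * q powi int i), 1:]"
      using c by (simp add: e_def)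
    finally show ?thesis by (simp only: rf_const_mult_to_fract)
  qed
  hence "(\<Prod>i=1..nat (- k). 1 - rf_const c * rf_Z / rf_const q ^ i)
     = rf_const (\<Prod>i=1..nat (- k). e i) * to_fract (\<Prod>i=1..nat (- k). [:- (inverse c * q powi int i), 1:])"
    by (simp only: prod.distrib rf_const_prod to_fract_prod)
  also have "(\<Prod>i=1..nat (- k). [:- (inverse c * q powi int i), 1:]) = root_poly (a_roots q c k)"
    unfolding root_poly_def a_roots_def using a_roots_inj[OF c]
    by (subst prod.reindex) (auto intro: inj_on_subset simp: o_def)
  finally have p: "(\<Prod>i=1..nat (- k). 1 - rf_const c * rf_Z / rf_const q ^ i)
     = rf_const (\<Prod>i=1..nat (- k). e i) * to_fract (root_poly (a_roots q c k))" .
  have nz: "(\<Prod>i=1..nat (- k). e i) \<noteq> 0" using c by (auto simp: e_def)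
  have "qpoch (rf_const q) (rf_const c * rf_Z) k
    = rf_const (inverse (\<Prod>i=1..nat (- k). e i)) * to_fract (a_num q c k) / to_fract (root_poly (a_roots q c k))"
    using False nz unfolding qpoch_def p by (simp add: a_num_def rf_const_inverse[symmetric] divide_inverse)
  thus ?thesis using nz by (intro exI[of _ "inverse (\<Prod>i=1..nat (- k). e i)"]) simp
qed

text \<open>
  The power of \<open>Z\<close> is split off so that numerator and denominator become products of linear factors; in
  \<open>h_fun\<close> these powers cancel against each other.
\<close>

lemma qpoch_const_div_Z:
  assumes c: "c \<noteq> 0"
  shows "qpoch (rf_const q) (rf_const c / rf_Z) l
    = rf_Z powi (- l) * (to_fract (b_num q c l) / to_fract (root_poly (b_roots q c l)))"
proof (cases "l \<ge> 0")
  case True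
  have "1 - rf_const c / rf_Z * rf_const q ^ i = inverse rf_Z * to_fract [:- (c * q ^ i), 1:]" for i
    unfolding rf_Z_minus_const[symmetric]
    by (simp add: rf_const_mult[symmetric] rf_const_power[symmetric] field_simps)
  hence "qpoch (rf_const q) (rf_const c / rf_Z) l = inverse rf_Z ^ nat l * to_fract (b_num q c l)"
    using True by (simp add: qpoch_def b_num_def to_fract_prod prod.distrib)
  moreover have "b_roots q c l = {}" using True by (simp add: b_roots_def)
  moreover have "rf_Z powi (- l) = inverse rf_Z ^ nat l" using True by (cases "l = 0") (simp_all add: power_int_def)
  ultimately show ?thesis by (simp add: root_poly_def)
next
  case False
  have "1 - rf_const c / rf_Z / rf_const q ^ i = inverse rf_Z * to_fract [:- (c * q powi (- int i)), 1:]" for i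
  proof -
    have "rf_const c / rf_const q ^ i = rf_const (c * q powi (- int i))"
      unfolding divide_inverse rf_const_power
      by (subst rf_const_inverse) (auto simp: rf_const_mult power_int_minus)
    hence "rf_const c / rf_Z / rf_const q ^ i = inverse rf_Z * rf_const (c * q powi (- int i))"
      by (simp add: divide_inverse mult_ac)
    thus ?thesis unfolding rf_Z_minus_const[symmetric] by (simp add: right_diff_distrib)
  qed
  hence "(\<Prod>i=1..nat (- l). 1 - rf_const c / rf_Z / rf_const q ^ i)
     = inverse rf_Z ^ nat (- l) * to_fract (\<Prod>i=1..nat (- l). [:- (c * q powi (- int i)), 1:])"
    by (simp add: prod.distrib to_fract_prod)
  also have "(\<Prod>i=1..nat (- l). [:- (c * q powi (- int i)), 1:]) = root_poly (b_roots q c l)"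
    unfolding root_poly_def b_roots_def using b_roots_inj[OF c]
    by (subst prod.reindex) (auto intro: inj_on_subset simp: o_def)
  finally have p: "(\<Prod>i=1..nat (- l). 1 - rf_const c / rf_Z / rf_const q ^ i)
     = inverse rf_Z ^ nat (- l) * to_fract (root_poly (b_roots q c l))" .
  have "rf_Z powi (- l) = rf_Z ^ nat (- l)" using False by (simp add: power_int_def)
  thus ?thesis
    using False unfolding qpoch_def p by (simp add: b_num_def divide_inverse power_inverse)
qed

end

context q_params begin

definition h_roots where "h_roots k l = (\<Union>j\<in>{1..3}. a_roots q (a j) (k j)) \<union> (\<Union>j\<in>{1..3}. b_roots q (b j) (l j))"

definition h_num where "h_num k l = (\<Prod>j=1..3. a_num q (a j) (k j)) * (\<Prod>j=1..3. b_num q (b j) (l j))"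

lemma root_poly_h_roots:
  "root_poly (h_roots k l) = (\<Prod>j=1..3. root_poly (a_roots q (a j) (k j))) * (\<Prod>j=1..3. root_poly (b_roots q (b j) (l j)))"
proof -
  have dA: "a_roots q (a i) m \<inter> a_roots q (a j) n = {}" if "i \<in> {1..3}" "j \<in> {1..3}" "i \<noteq> j" for i j m n
  proof (rule ccontr)
    assume "\<not> ?thesis"
    then obtain x y where "inverse (a i) * q powi int x = inverse (a j) * q powi int y"
      unfolding a_roots_def by auto
    hence "a i / a j = q powi (int x - int y)"
      using a_nz that by (simp add: power_int_diff field_simps)
    with aa_generic[OF that] show False by blast
  qed
  have dB: "b_roots q (b i) m \<inter> b_roots q (b j) n = {}" if "i \<in> {1..3}" "j \<in> {1..3}" "i \<noteq> j" for i j m n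
  proof (rule ccontr)
    assume "\<not> ?thesis"
    then obtain x y where "b i * q powi (- int x) = b j * q powi (- int y)"
      unfolding b_roots_def by auto
    hence "b i / b j = q powi (int x - int y)"
      using b_nz that by (simp add: power_int_diff power_int_minus field_simps)
    with bb_generic[OF that] show False by blast
  qed
  have dAB: "a_roots q (a i) m \<inter> b_roots q (b j) n = {}" if "i \<in> {1..3}" "j \<in> {1..3}" for i j m n
  proof (rule ccontr)
    assume "\<not> ?thesis"
    then obtain x y where "inverse (a i) * q powi int x = b j * q powi (- int y)"
      unfolding a_roots_def b_roots_def by auto
    hence "a i * b j = q powi (int x + int y)"
      using a_nz b_nz that by (simp add: power_int_add power_int_minus field_simps)
    with ab_generic[OF that] show False by blast
  qed
  have "root_poly (h_roots k l) = root_poly (\<Union>j\<in>{1..3}. a_roots q (a j) (k j)) * root_poly (\<Union>j\<in>{1..3}. b_roots q (b j) (l j))"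
    unfolding h_roots_def
  proof (rule root_poly_Un_disjoint)
    show "(\<Union>j\<in>{1..3}. a_roots q (a j) (k j)) \<inter> (\<Union>j\<in>{1..3}. b_roots q (b j) (l j)) = {}"
      using dAB by blast
  qed auto
  also have "root_poly (\<Union>j\<in>{1..3}. a_roots q (a j) (k j)) = (\<Prod>j=1..3. root_poly (a_roots q (a j) (k j)))"
    unfolding root_poly_def using dA by (intro prod.UNION_disjoint) auto
  also have "root_poly (\<Union>j\<in>{1..3}. b_roots q (b j) (l j)) = (\<Prod>j=1..3. root_poly (b_roots q (b j) (l j)))"
    unfolding root_poly_def using dB by (intro prod.UNION_disjoint) auto
  finally show ?thesis .
qed

lemma h_roots_finite: "finite (h_roots k l)"
  by (simp add: h_roots_def)

lemma card_h_roots: "card (h_roots k l) = (\<Sum>j=1..3. nat (- k j)) + (\<Sum>j=1..3. nat (- l j))"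
proof -
  have "card (h_roots k l) = degree (root_poly (h_roots k l))" by (simp add: degree_root_poly)
  also have "\<dots> = (\<Sum>j=1..3. card (a_roots q (a j) (k j))) + (\<Sum>j=1..3. card (b_roots q (b j) (l j)))"
    unfolding root_poly_h_roots
    by (subst degree_mult_eq) (auto simp: degree_prod_eq_sum_degree degree_root_poly)
  also have "(\<Sum>j=1..3. card (a_roots q (a j) (k j))) = (\<Sum>j=1..3. nat (- k j))"
    using a_nz by (intro sum.cong card_a_roots) auto
  also have "(\<Sum>j=1..3. card (b_roots q (b j) (l j))) = (\<Sum>j=1..3. nat (- l j))"
    using b_nz by (intro sum.cong card_b_roots) auto
  finally show ?thesis .
qed

lemma h_roots_subset: "h_roots k l \<subseteq> W_poles q a b"
proof
  fix z assume "z \<in> h_roots k l"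
  then consider j i where "j \<in> {1..3}" "i \<ge> 1" "z = inverse (a j) * q powi int i"
    | j i where "j \<in> {1..3}" "i \<ge> 1" "z = b j * q powi (- int i)"
    unfolding h_roots_def a_roots_def b_roots_def by auto
  thus "z \<in> W_poles q a b"
  proof cases
    case 1
    thus ?thesis unfolding W_poles_def by (intro CollectI bexI[of _ j] exI[of _ "int i"]) auto
  next
    case 2
    thus ?thesis unfolding W_poles_def by (intro CollectI bexI[of _ j] exI[of _ "- int i"]) auto
  qed
qed

lemma degree_h_num: "degree (h_num k l) \<le> (\<Sum>j=1..3. nat (k j)) + (\<Sum>j=1..3. nat (l j))"
proof -
  have "degree (h_num k l) \<le> (\<Sum>j=1..3. degree (a_num q (a j) (k j))) + (\<Sum>j=1..3. degree (b_num q (b j) (l j)))"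
    unfolding h_num_def
    using degree_prod_sum_le[of "{1..3}" "\<lambda>j. a_num q (a j) (k j)"]
      degree_prod_sum_le[of "{1..3}" "\<lambda>j. b_num q (b j) (l j)"]
    by (intro order_trans[OF degree_mult_le] add_mono) (simp_all only: o_def finite_atLeastAtMost simp_thms)
  also have "\<dots> \<le> (\<Sum>j=1..3. nat (k j)) + (\<Sum>j=1..3. nat (l j))"
    by (intro add_mono sum_mono degree_a_num degree_b_num)
  finally show ?thesis .
qed

lemma h_fun_form:
  assumes "(\<Sum>j=1..3. k j) = - (\<Sum>j=1..3. l j)"
  shows "\<exists>d. d \<noteq> 0 \<and> h_fun q a b k l = to_fract (smult d (h_num k l)) / to_fract (root_poly (h_roots k l))"
proof -
  have "\<forall>j\<in>{1..3}. \<exists>d. d \<noteq> 0 \<and> qpoch (rf_const q) (rf_const (a j) * rf_Z) (k j)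
    = rf_const d * to_fract (a_num q (a j) (k j)) / to_fract (root_poly (a_roots q (a j) (k j)))"
    using a_nz by (intro ballI qpoch_const_Z)
  then obtain d where d: "\<And>j. j \<in> {1..3} \<Longrightarrow> d j \<noteq> 0" "\<And>j. j \<in> {1..3} \<Longrightarrow> qpoch (rf_const q) (rf_const (a j) * rf_Z) (k j)
    = rf_const (d j) * to_fract (a_num q (a j) (k j)) / to_fract (root_poly (a_roots q (a j) (k j)))"
    by metis
  have A: "(\<Prod>j=1..3. qpoch (rf_const q) (rf_const (a j) * rf_Z) (k j))
     = rf_const (\<Prod>j=1..3. d j) * (to_fract (\<Prod>j=1..3. a_num q (a j) (k j)) / to_fract (\<Prod>j=1..3. root_poly (a_roots q (a j) (k j))))"
    using d(2) by (simp add: prod_dividef prod.distrib to_fract_prod rf_const_prod)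
  have "(\<Prod>j=1..3. qpoch (rf_const q) (rf_const (b j) / rf_Z) (l j))
    = (\<Prod>j=1..3. rf_Z powi (- l j) * (to_fract (b_num q (b j) (l j)) / to_fract (root_poly (b_roots q (b j) (l j)))))"
    using b_nz by (intro prod.cong refl qpoch_const_div_Z) auto
  also have "\<dots> = (\<Prod>j=1..3. rf_Z powi (- l j)) * (to_fract (\<Prod>j=1..3. b_num q (b j) (l j)) / to_fract (\<Prod>j=1..3. root_poly (b_roots q (b j) (l j))))"
    by (simp add: prod_dividef prod.distrib to_fract_prod)
  also have "(\<Prod>j=1..3. rf_Z powi (- l j)) = rf_Z powi (\<Sum>j=1..3. k j)"
  proof -
    have "rf_Z powi (- l 1) * rf_Z powi (- l 2) * rf_Z powi (- l 3) = rf_Z powi (- l 1 + - l 2 + - l 3)"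
      by (simp only: power_int_add rf_Z_nz simp_thms)
    thus ?thesis using assms unfolding prod_1_3 sum_1_3 by simp
  qed
  finally have B: "(\<Prod>j=1..3. qpoch (rf_const q) (rf_const (b j) / rf_Z) (l j))
    = rf_Z powi (\<Sum>j=1..3. k j) * (to_fract (\<Prod>j=1..3. b_num q (b j) (l j)) / to_fract (\<Prod>j=1..3. root_poly (b_roots q (b j) (l j))))" .
  have cancel: "rf_Z powi (- n) * (x * (rf_Z powi n * y)) = x * y" for n x y
    by (simp add: power_int_minus field_simps)
  have "h_fun q a b k l = rf_const (\<Prod>j=1..3. d j) * (to_fract (\<Prod>j=1..3. a_num q (a j) (k j)) / to_fract (\<Prod>j=1..3. root_poly (a_roots q (a j) (k j))))
      * (to_fract (\<Prod>j=1..3. b_num q (b j) (l j)) / to_fract (\<Prod>j=1..3. root_poly (b_roots q (b j) (l j))))"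
    unfolding h_fun_def prod.distrib A B by (rule cancel)
  also have "\<dots> = rf_const (\<Prod>j=1..3. d j) * to_fract (h_num k l) / to_fract (root_poly (h_roots k l))"
    unfolding h_num_def root_poly_h_roots to_fract_mult by simp
  finally show ?thesis using d(1)
    by (intro exI[of _ "\<Prod>j=1..3. d j"]) (simp add: rf_const_mult_to_fract)
qed

lemma h_fun_in_W:
  assumes s: "(\<Sum>j=1..3. k j) = - (\<Sum>j=1..3. l j)"
  shows "h_fun q a b k l \<in> W_space q a b"
proof -
  obtain d where d: "h_fun q a b k l = to_fract (smult d (h_num k l)) / to_fract (root_poly (h_roots k l))"
    using h_fun_form[OF s] by blast
  have "degree (smult d (h_num k l)) \<le> (\<Sum>j=1..3. nat (k j)) + (\<Sum>j=1..3. nat (l j))"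
    using degree_smult_le degree_h_num order_trans by blast
  also have "\<dots> = card (h_roots k l)"
  proof -
    have "int (\<Sum>j=1..3. nat (f j)) = (\<Sum>j=1..3. f j) + int (\<Sum>j=1..3. nat (- f j))" for f :: "nat \<Rightarrow> int"
    proof -
      have "int (nat x) - int (nat (- x)) = x" for x by simp
      from this[of "f 1"] this[of "f 2"] this[of "f 3"] show ?thesis
        unfolding sum_1_3 by linarith
    qed
    from this[of k] this[of l]
    show ?thesis unfolding card_h_roots using s by linarith
  qed
  finally have "degree (smult d (h_num k l)) \<le> card (h_roots k l)" .
  thus ?thesis unfolding W_space_iff
    by (intro exI[of _ "h_roots k l"] exI[of _ "smult d (h_num k l)"] conjI h_roots_finite h_roots_subset d)
qed

text \<open>
  The functions \<open>h_fun\<close> span \<open>W\<close>. A pole at \<open>q\<^sup>n/a\<^sub>j\<close> is reached with \<open>k\<^sub>j = -n\<close> and \<open>l\<^sub>1 = n\<close>, a pole at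
  \<open>b\<^sub>jq\<^sup>-\<^sup>n\<close> with \<open>l\<^sub>j = -n\<close> and \<open>k\<^sub>1 = n\<close>; genericity keeps the numerators nonzero at the new pole.
\<close>

lemma W_induct:
  assumes F: "F \<in> W_space q a b"
    and Qadd: "\<And>F G. Q F \<Longrightarrow> Q G \<Longrightarrow> Q (F + G)"
    and Qmul: "\<And>c F. Q F \<Longrightarrow> Q (rf_const c * F)"
    and Qh: "\<And>k l. (\<Sum>j=1..3. k j) = - (\<Sum>j=1..3. l j) \<Longrightarrow> Q (h_fun q a b k l)"
  shows "Q F"
proof -
  have Q1: "Q 1" using Qh[of "\<lambda>_. 0" "\<lambda>_. 0"] by (simp add: h_fun_def)
  have one: "1 \<in> {1..3::nat}" by simp
  have chain: "Q (1 / to_fract [:- p n, 1:])"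
    if p: "inj p" and s: "\<And>n. (\<Sum>j=1..3. k n j) = - (\<Sum>j=1..3. l n j)"
      and r: "\<And>n. h_roots (k n) (l n) = p ` {1..n}" and deg: "\<And>n. degree (h_num (k n) (l n)) \<le> n"
      and nz: "\<And>n. poly (h_num (k n) (l n)) (p n) \<noteq> 0" and n: "n > 0"
    for p :: "nat \<Rightarrow> complex" and k l :: "nat \<Rightarrow> nat \<Rightarrow> int" and n
  proof -
    obtain d where d: "\<And>n. d n \<noteq> 0"
      "\<And>n. h_fun q a b (k n) (l n) = to_fract (smult (d n) (h_num (k n) (l n))) / to_fract (root_poly (h_roots (k n) (l n)))"
      using h_fun_form[OF s] by metis
    show ?thesis
    proof (rule simple_fractions_from_chain[where Q = Q and N = "\<lambda>n. smult (d n) (h_num (k n) (l n))"])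
      fix n :: nat
      show "Q (to_fract (smult (d n) (h_num (k n) (l n))) / to_fract (root_poly (p ` {1..n})))"
        using Qh[OF s[of n]] unfolding d(2) r .
      show "degree (smult (d n) (h_num (k n) (l n))) \<le> n"
        using degree_smult_le deg[of n] order_trans by blast
      show "poly (smult (d n) (h_num (k n) (l n))) (p n) \<noteq> 0"
        using d(1)[of n] nz[of n] by simp
    qed (fact n Q1 Qadd Qmul p)+
  qed
  have ra: "Q (1 / to_fract [:- (inverse (a j) * q powi int n), 1:])" if j: "j \<in> {1..3}" and n: "n > 0" for j n
  proof (rule chain[where p = "\<lambda>n. inverse (a j) * q powi int n"
      and k = "\<lambda>n i. if i = j then - int n else 0" and l = "\<lambda>n i. if i = 1 then int n else 0"])
    fix m :: nat
    let ?k = "\<lambda>i. if i = j then - int m else 0" and ?l = "\<lambda>i. if i = (1::nat) then int m else 0"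
    show "(\<Sum>j=1..3. ?k j) = - (\<Sum>j=1..3. ?l j)" using j by simp
    have "a_roots q (a i) (?k i) = (if i = j then (\<lambda>i. inverse (a j) * q powi int i) ` {1..m} else {})" for i
      by (simp add: a_roots_def)
    moreover have "b_roots q (b i) (?l i) = {}" for i by (simp add: b_roots_def)
    ultimately show "h_roots ?k ?l = (\<lambda>n. inverse (a j) * q powi int n) ` {1..m}"
      using j unfolding h_roots_def by (auto split: if_splits)
    have "(\<Prod>i=1..3. a_num q (a i) (?k i)) = 1"
      by (intro prod.neutral) (auto simp: a_num_def)
    hence hn: "h_num ?k ?l = b_num q (b 1) (int m)"
      unfolding h_num_def prod_1_3[of "\<lambda>j. b_num q (b j) (?l j)"] by (simp add: b_num_def)
    show "degree (h_num ?k ?l) \<le> m" unfolding hn using degree_b_num[of q "b 1" "int m"] by simp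
    have "inverse (a j) * q powi int m - b 1 * q ^ i \<noteq> 0" for i
    proof
      assume "inverse (a j) * q powi int m - b 1 * q ^ i = 0"
      hence "a j * b 1 = q powi (int m - int i)"
        using a_nz[OF j] by (simp add: power_int_diff field_simps)
      with ab_generic[OF j one] show False by blast
    qed
    thus "poly (h_num ?k ?l) (inverse (a j) * q powi int m) \<noteq> 0"
      unfolding hn by (auto simp: b_num_def poly_prod)
  qed (use n a_roots_inj[OF a_nz[OF j]] in auto)
  have rb: "Q (1 / to_fract [:- (b j * q powi (- int n)), 1:])" if j: "j \<in> {1..3}" and n: "n > 0" for j n
  proof (rule chain[where p = "\<lambda>n. b j * q powi (- int n)"
      and k = "\<lambda>n i. if i = 1 then int n else 0" and l = "\<lambda>n i. if i = j then - int n else 0"])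
    fix m :: nat
    let ?k = "\<lambda>i. if i = (1::nat) then int m else 0" and ?l = "\<lambda>i. if i = j then - int m else 0"
    show "(\<Sum>j=1..3. ?k j) = - (\<Sum>j=1..3. ?l j)" using j by simp
    have "b_roots q (b i) (?l i) = (if i = j then (\<lambda>i. b j * q powi (- int i)) ` {1..m} else {})" for i
      by (simp add: b_roots_def)
    moreover have "a_roots q (a i) (?k i) = {}" for i by (simp add: a_roots_def)
    ultimately show "h_roots ?k ?l = (\<lambda>n. b j * q powi (- int n)) ` {1..m}"
      using j unfolding h_roots_def by (auto split: if_splits)
    have "(\<Prod>i=1..3. b_num q (b i) (?l i)) = 1"
      by (intro prod.neutral) (auto simp: b_num_def)
    hence hn: "h_num ?k ?l = a_num q (a 1) (int m)"
      unfolding h_num_def prod_1_3[of "\<lambda>j. a_num q (a j) (?k j)"] by (simp add: a_num_def)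
    show "degree (h_num ?k ?l) \<le> m" unfolding hn using degree_a_num[of q "a 1" "int m"] by simp
    have "1 - b j * q powi (- int m) * (a 1 * q ^ i) \<noteq> 0" for i
    proof
      assume "1 - b j * q powi (- int m) * (a 1 * q ^ i) = 0"
      hence "a 1 * b j = q powi (int m - int i)"
        by (simp add: power_int_diff power_int_minus field_simps)
      with ab_generic[OF one j] show False by blast
    qed
    thus "poly (h_num ?k ?l) (b j * q powi (- int m)) \<noteq> 0"
      unfolding hn by (auto simp: a_num_def poly_prod)
  qed (use n b_roots_inj[OF b_nz[OF j]] in auto)
  obtain A n where A: "finite A" "A \<subseteq> W_poles q a b" "degree n \<le> card A"
    and Feq: "F = to_fract n / to_fract (root_poly A)" using F unfolding W_space_iff by blast
  have px: "Q (1 / to_fract [:- p, 1:])" if "p \<in> A" for p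
  proof -
    obtain j k where j: "j \<in> {1..3}" and k: "(k > 0 \<and> p = inverse (a j) * q powi k) \<or> (k < 0 \<and> p = b j * q powi k)"
      using A(2) \<open>p \<in> A\<close> unfolding W_poles_def by blast
    from k show ?thesis
    proof (elim disjE conjE)
      assume "k > 0" "p = inverse (a j) * q powi k"
      thus ?thesis using ra[OF j, of "nat k"] by simp
    next
      assume "k < 0" "p = b j * q powi k"
      thus ?thesis using rb[OF j, of "nat (- k)"] by simp
    qed
  qed
  show ?thesis
    unfolding Feq
  proof (rule partial_fractions_induct[where Q = Q])
    show "finite A" "degree n \<le> card A" "Q 1" by fact+
  qed (fact Qadd Qmul px)+
qed

end


section \<open>The functional K as a difference of Jackson sums\<close>

context q_base begin

definition lattice :: "(nat \<Rightarrow> complex) \<Rightarrow> complex set" where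
  "lattice c = {z. \<exists>j\<in>{1..3}. \<exists>k::int. z = c j * q powi k}"

lemma lattice_q_powi: "z * q powi n \<in> lattice c \<longleftrightarrow> z \<in> lattice c"
proof -
  have mono: "z * q powi n \<in> lattice c" if z: "z \<in> lattice c" for z n
  proof -
    obtain j k where j: "j \<in> {1..3}" "z = c j * q powi k" using z unfolding lattice_def by blast
    hence "z * q powi n = c j * q powi (k + n)" by (simp add: power_int_add)
    thus ?thesis using j unfolding lattice_def by blast
  qed
  have c: "z * q powi n * q powi (- n) = z" by (simp add: power_int_minus)
  show ?thesis using mono[of z n] mono[of "z * q powi n" "- n", unfolded c] by blast
qed

lemma lattice_shift: "lattice (\<lambda>j. c j * q powi n j) = lattice c"
proof -
  have 1: "c j * q powi n j * q powi m = c j * q powi (n j + m)" for j m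
    by (simp add: power_int_add)
  have 2: "c j * q powi m = c j * q powi n j * q powi (m - n j)" for j m
    by (simp add: power_int_diff)
  show ?thesis unfolding lattice_def using 1 2 by blast
qed

lemma countable_lattice: "countable (lattice c)"
proof -
  have "lattice c = (\<Union>j\<in>{1..3}. range (\<lambda>k::int. c j * q powi k))"
    unfolding lattice_def by auto
  thus ?thesis by auto
qed

end

context q_params begin

definition a_lat where "a_lat = lattice (\<lambda>j. inverse (a j))"

definition b_lat where "b_lat = lattice b"

lemma zero_not_lat: "0 \<notin> a_lat" "0 \<notin> b_lat"
  using a_nz b_nz by (auto simp: a_lat_def b_lat_def lattice_def)

lemma a_lat_disjoint_b_lat: "a_lat \<inter> b_lat = {}"
proof (rule ccontr)
  assume "\<not> ?thesis"
  then obtain z where z: "z \<in> a_lat" "z \<in> b_lat" by blast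
  obtain i k where i: "i \<in> {1..3}" "z = inverse (a i) * q powi k" using z(1) unfolding a_lat_def lattice_def by blast
  obtain j m where j: "j \<in> {1..3}" "z = b j * q powi m" using z(2) unfolding b_lat_def lattice_def by blast
  note ij = i(1) j(1)
  have e: "inverse (a i) * q powi k = b j * q powi m" using i(2) j(2) by simp
  have "a i * b j = q powi (k - m)"
    using e a_nz[OF ij(1)] by (simp add: power_int_diff field_simps)
  with ab_generic[OF ij] show False by blast
qed

lemma countable_lat: "countable (a_lat \<union> b_lat \<union> {0})"
  unfolding a_lat_def b_lat_def by (simp add: countable_lattice)

lemma a_mult_not_range: "j \<in> {1..3} \<Longrightarrow> v \<notin> a_lat \<Longrightarrow> a j * v \<notin> qZ"
proof
  assume j: "j \<in> {1..3}" and v: "v \<notin> a_lat" and "a j * v \<in> qZ"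
  then obtain k where "a j * v = q powi k" by auto
  hence "v = inverse (a j) * q powi k" using a_nz[OF j] by (simp add: field_simps)
  thus False using v j unfolding a_lat_def lattice_def by blast
qed

lemma b_div_not_range: "j \<in> {1..3} \<Longrightarrow> v \<notin> b_lat \<Longrightarrow> v \<noteq> 0 \<Longrightarrow> b j / v \<notin> qZ"
proof
  assume j: "j \<in> {1..3}" and v: "v \<notin> b_lat" "v \<noteq> 0" and "b j / v \<in> qZ"
  then obtain k where "b j / v = q powi k" by auto
  hence "v = b j * q powi (- k)" using v by (simp add: power_int_minus field_simps)
  thus False using v j unfolding b_lat_def lattice_def by blast
qed

lemma Lam_analytic: "Lam analytic_on - a_lat"
proof -
  have "(\<lambda>v. \<Prod>j=1..3. P (q * v / b j) / P (a j * v)) analytic_on - a_lat"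
  proof (intro analytic_intros P_analytic)
    fix j v assume "j \<in> {1..3::nat}" "v \<in> - a_lat"
    thus "P (a j * v) \<noteq> 0" by (intro P_nz a_mult_not_range) auto
  qed (use b_nz in auto)
  thus ?thesis unfolding Lam_def .
qed

lemma Lam_meromorphic: "Lam meromorphic_on UNIV"
proof -
  have "(\<lambda>v. \<Prod>j=1..3. P (q * v / b j) / P (a j * v)) meromorphic_on UNIV"
    using b_nz
    by (intro meromorphic_on_prod meromorphic_on_divide analytic_on_imp_meromorphic_on P_analytic analytic_intros) auto
  thus ?thesis unfolding Lam_def .
qed

lemma W_regular: "F \<in> W_space q a b \<Longrightarrow> v \<notin> a_lat \<union> b_lat \<Longrightarrow> poly (rf_den F) v \<noteq> 0"
  unfolding W_space_def a_lat_def b_lat_def lattice_def by blast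

lemma h_eval:
  assumes v: "v \<notin> a_lat \<union> b_lat \<union> {0}"
  shows "rf_eval (h_fun q a b k l) v = v powi (- (\<Sum>j=1..3. k j)) *
     (\<Prod>j=1..3. qpoch q (a j * v) (k j) * qpoch q (b j / v) (l j))"
  unfolding h_fun_def
  using v by (intro rf_has_valueD rf_has_value_mult rf_has_value_powi rf_has_value_prod rf_has_value_qpoch
      rf_has_value_Z rf_has_value_divide rf_has_value_const a_mult_not_range b_div_not_range) auto

definition h_const where "h_const l = (\<Prod>j=1..3. (- b j) powi l j * q powi choose2 (l j))"

text \<open>
  Each Pochhammer symbol in \<open>h_fun\<close> is absorbed by a factor of \<open>Lam\<close>: directly for the \<open>a\<^sub>j\<close>, and by the
  quasi-periodicity of \<open>theta\<close> for the \<open>b\<^sub>j\<close>. The powers of \<open>v\<close> cancel by the condition on the sums.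
\<close>

lemma Lam_h_fun:
  assumes s: "(\<Sum>j=1..3. k j) = - (\<Sum>j=1..3. l j)" and v: "v \<notin> a_lat \<union> b_lat \<union> {0}"
  shows "Lam v * rf_eval (h_fun q a b k l) v
    = h_const l * q_params.Lam q (\<lambda>j. a j * q powi k j) (\<lambda>j. b j * q powi l j) v"
proof -
  interpret s: q_params q "\<lambda>j. a j * q powi k j" "\<lambda>j. b j * q powi l j"
    using s by (intro shift_params) auto
  have v0: "v \<noteq> 0" using v by auto
  have A: "qpoch q (a j * v) (k j) / P (a j * v) = 1 / P (a j * q powi k j * v)" if "j \<in> {1..3}" for j
  proof -
    have r: "a j * v \<notin> qZ" using v that by (intro a_mult_not_range) auto
    have "P (a j * v * q powi k j) * qpoch q (a j * v) (k j) = P (a j * v)"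
      using r by (rule P_powi_step)
    moreover have "P (a j * v) \<noteq> 0" "P (a j * v * q powi k j) \<noteq> 0"
      using r by (auto intro!: P_nz powi_not_range)
    ultimately show ?thesis by (simp add: field_simps)
  qed
  have B: "P (q * v / b j) * qpoch q (b j / v) (l j) = (- b j / v) powi l j * q powi choose2 (l j) * P (q * v / (b j * q powi l j))"
    if j: "j \<in> {1..3}" for j
  proof -
    define x where "x = b j / v"
    have x0: "x \<noteq> 0" using v0 b_nz[OF j] by (simp add: x_def)
    have r: "x \<notin> qZ" unfolding x_def using v j by (intro b_div_not_range) auto
    have nz: "P (x * q powi l j) \<noteq> 0" using r by (auto intro!: P_nz powi_not_range)
    have "P (x * q powi l j) * qpoch q x (l j) = P x"
      using r by (rule P_powi_step)
    moreover have "P (x * q powi l j) * P (q / (x * q powi l j)) = (- 1 / x) powi l j * q powi (- choose2 (l j)) * (P x * P (q / x))"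
      using theta_powi[OF x0, of "l j"] by (simp add: theta_def)
    ultimately have "P (x * q powi l j) * P (q / (x * q powi l j))
      = (- 1 / x) powi l j * q powi (- choose2 (l j)) * ((P (x * q powi l j) * qpoch q x (l j)) * P (q / x))"
      by simp
    also have "\<dots> = P (x * q powi l j) * ((- 1 / x) powi l j * q powi (- choose2 (l j)) * (qpoch q x (l j) * P (q / x)))"
      by (simp only: mult_ac)
    finally have "P (x * q powi l j) * P (q / (x * q powi l j)) =
      P (x * q powi l j) * ((- 1 / x) powi l j * q powi (- choose2 (l j)) * (qpoch q x (l j) * P (q / x)))" .
    hence e: "P (q / (x * q powi l j)) = (- 1 / x) powi l j * q powi (- choose2 (l j)) * (qpoch q x (l j) * P (q / x))"
      by (rule mult_left_cancel[OF nz, THEN iffD1])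
    have "(- x) powi l j * (- 1 / x) powi l j = 1"
      unfolding power_int_mult_distrib[symmetric] using x0 by simp
    moreover have "q powi choose2 (l j) * q powi (- choose2 (l j)) = 1"
      by (simp add: power_int_minus)
    moreover have "u * w * (u' * w' * z) = z" if "u * u' = 1" "w * w' = 1" for u u' w w' z :: complex
    proof -
      have "u * w * (u' * w' * z) = (u * u') * (w * w') * z" by (simp only: mult_ac)
      thus ?thesis using that by simp
    qed
    ultimately have E: "(- x) powi l j * q powi choose2 (l j) * P (q / (x * q powi l j)) = qpoch q x (l j) * P (q / x)"
      unfolding e by blast
    have qx: "q / x = q * v / b j" "q / (x * q powi l j) = q * v / (b j * q powi l j)" "- x = - b j / v"
      unfolding x_def using v0 b_nz[OF j] by (simp_all add: field_simps)
    show ?thesis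
      unfolding qx[symmetric] x_def[symmetric] E by (rule mult.commute)
  qed
  have C: "(\<Prod>j=1..3. (- b j / v) powi l j) = (\<Prod>j=1..3. (- b j) powi l j) * v powi (\<Sum>j=1..3. k j)"
  proof -
    have "(\<Prod>j=1..3. (- b j / v) powi l j) = (\<Prod>j=1..3. (- b j) powi l j) * (\<Prod>j=1..3. v powi (- l j))"
      unfolding prod.distrib[symmetric]
      by (intro prod.cong refl) (simp only: power_int_minus divide_inverse power_int_mult_distrib power_int_inverse)
    also have "(\<Prod>j=1..3. v powi (- l j)) = v powi (- l 1 + - l 2 + - l 3)"
      unfolding prod_1_3 using v0 by (simp only: power_int_add simp_thms)
    also have "- l 1 + - l 2 + - l 3 = (\<Sum>j=1..3. k j)"
      unfolding s unfolding sum_1_3 by simp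
    finally show ?thesis .
  qed
  have "x / y * (w * (u * z)) = w * (x * z * (u / y))" for x y w u z :: complex
    by simp
  hence "Lam v * rf_eval (h_fun q a b k l) v = v powi (- (\<Sum>j=1..3. k j)) *
     (\<Prod>j=1..3. (P (q * v / b j) * qpoch q (b j / v) (l j)) * (qpoch q (a j * v) (k j) / P (a j * v)))"
    unfolding h_eval[OF v] Lam_def prod.distrib prod_dividef by blast
  also have "(\<Prod>j=1..3. (P (q * v / b j) * qpoch q (b j / v) (l j)) * (qpoch q (a j * v) (k j) / P (a j * v)))
    = (\<Prod>j=1..3. ((- b j / v) powi l j * q powi choose2 (l j) * P (q * v / (b j * q powi l j))) * (1 / P (a j * q powi k j * v)))"
    by (intro prod.cong refl) (simp only: A B)
  also have "\<dots> = (\<Prod>j=1..3. (- b j / v) powi l j) * (\<Prod>j=1..3. q powi choose2 (l j)) * s.Lam v"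
    unfolding s.Lam_def prod.distrib prod_dividef by simp
  also have "v powi (- (\<Sum>j=1..3. k j)) * \<dots> = h_const l * s.Lam v"
    unfolding C h_const_def prod.distrib power_int_minus using v0 by simp
  finally show ?thesis .
qed

text \<open>
  The poles of \<open>f\<close> at \<open>b\<^sub>jq\<^sup>k\<close> cancel against zeros of \<open>Lam\<close>, but the pointwise product has the junk value 0
  there, and these points carry the Jackson sums. Hence the analytic extension \<open>A\<close> is used.
\<close>

definition Lam_ext :: "ratfun \<Rightarrow> (complex \<Rightarrow> complex) \<Rightarrow> bool" where
  "Lam_ext f A \<longleftrightarrow> A analytic_on - a_lat \<and> A meromorphic_on UNIV \<and>
     (\<forall>v. v \<notin> a_lat \<union> b_lat \<union> {0} \<longrightarrow> A v = Lam v * rf_eval f v)"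

definition jsums :: "(complex \<Rightarrow> complex) \<Rightarrow> (nat \<Rightarrow> complex) \<Rightarrow> bool" where
  "jsums A I \<longleftrightarrow> (\<forall>j\<in>{1..3}. (jterm A j has_sum I j) UNIV \<and>
     (\<lambda>k. norm (jterm A j k)) summable_on UNIV)"

text \<open>
  The value \<open>x\<close> is that of \<open>K\<close> at \<open>f\<close>. Two differences are recorded, because the final computation needs all
  of them and the third one follows.
\<close>

definition K_data :: "ratfun \<Rightarrow> complex \<Rightarrow> bool" where
  "K_data f x \<longleftrightarrow> (\<exists>A I. Lam_ext f A \<and> jsums A I \<and>
     I 1 - I 2 = Delta 1 2 3 * x \<and> I 2 - I 3 = Delta 2 3 1 * x)"

lemma Lam_ext_add:
  assumes W: "f \<in> W_space q a b" "g \<in> W_space q a b" and A: "Lam_ext f A" and B: "Lam_ext g B"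
  shows "Lam_ext (f + g) (\<lambda>v. A v + B v)"
proof -
  have "rf_eval (f + g) v = rf_eval f v + rf_eval g v" if "v \<notin> a_lat \<union> b_lat \<union> {0}" for v
    using that W_regular[OF W(1), of v] W_regular[OF W(2), of v]
    by (intro rf_has_valueD rf_has_value_add rf_has_value_eval) auto
  thus ?thesis
    using A B unfolding Lam_ext_def
    by (auto intro!: analytic_on_add meromorphic_on_add simp: distrib_left)
qed

lemma Lam_ext_const_mult:
  assumes W: "f \<in> W_space q a b" and A: "Lam_ext f A"
  shows "Lam_ext (rf_const c * f) (\<lambda>v. c * A v)"
proof -
  have "rf_eval (rf_const c * f) v = c * rf_eval f v" if "v \<notin> a_lat \<union> b_lat \<union> {0}" for v
    using that W_regular[OF W, of v]
    by (intro rf_has_valueD rf_has_value_mult rf_has_value_const rf_has_value_eval) auto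
  thus ?thesis
    using A unfolding Lam_ext_def
    by (auto intro!: analytic_on_mult meromorphic_on_mult meromorphic_on_const)
qed

lemma jsums_add:
  assumes A: "jsums A I" and B: "jsums B J"
  shows "jsums (\<lambda>v. A v + B v) (\<lambda>j. I j + J j)"
  unfolding jsums_def distrib_left
proof (intro ballI conjI)
  fix j :: nat assume j: "j \<in> {1..3}"
  show "((\<lambda>k. jterm A j k + jterm B j k) has_sum I j + J j) UNIV"
    using A B j unfolding jsums_def by (intro has_sum_add) auto
  have "(\<lambda>k. norm (jterm A j k) + norm (jterm B j k)) summable_on UNIV"
    using A B j unfolding jsums_def by (intro summable_on_add) auto
  thus "(\<lambda>k. norm (jterm A j k + jterm B j k)) summable_on UNIV"
    by (rule Infinite_Sum.abs_summable_on_comparison_test') (rule norm_triangle_ineq)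
qed

lemma jsums_const_mult:
  assumes A: "jsums A I" shows "jsums (\<lambda>v. c * A v) (\<lambda>j. c * I j)"
  unfolding jsums_def mult.left_commute[of _ c] norm_mult[of c]
  using A unfolding jsums_def by (auto intro!: has_sum_cmult_right summable_on_cmult_right)

lemma K_data_add:
  assumes W: "f \<in> W_space q a b" "g \<in> W_space q a b" and "K_data f x" "K_data g y"
  shows "K_data (f + g) (x + y)"
proof -
  obtain A I B J where A: "Lam_ext f A" "jsums A I" "I 1 - I 2 = Delta 1 2 3 * x" "I 2 - I 3 = Delta 2 3 1 * x"
    and B: "Lam_ext g B" "jsums B J" "J 1 - J 2 = Delta 1 2 3 * y" "J 2 - J 3 = Delta 2 3 1 * y"
    using assms(3,4) unfolding K_data_def by blast
  show ?thesis
    unfolding K_data_def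
    by (rule exI[of _ "\<lambda>v. A v + B v"], rule exI[of _ "\<lambda>j. I j + J j"])
      (use Lam_ext_add[OF W A(1) B(1)] jsums_add[OF A(2) B(2)] A(3,4) B(3,4) in \<open>simp add: algebra_simps\<close>)
qed

lemma K_data_const_mult:
  assumes W: "f \<in> W_space q a b" and "K_data f x"
  shows "K_data (rf_const c * f) (c * x)"
proof -
  obtain A I where A: "Lam_ext f A" "jsums A I" "I 1 - I 2 = Delta 1 2 3 * x" "I 2 - I 3 = Delta 2 3 1 * x"
    using assms(2) unfolding K_data_def by blast
  show ?thesis
    unfolding K_data_def
    by (rule exI[of _ "\<lambda>v. c * A v"], rule exI[of _ "\<lambda>j. c * I j"])
      (use Lam_ext_const_mult[OF W A(1)] jsums_const_mult[OF A(2)] A(3,4) in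
        \<open>simp add: right_diff_distrib[symmetric] mult.left_commute\<close>)
qed

lemma K_data_h_fun:
  assumes s: "(\<Sum>j=1..3. k j) = - (\<Sum>j=1..3. l j)"
  shows "K_data (h_fun q a b k l) (K_value q a b k l)"
proof -
  interpret s: q_params q "\<lambda>j. a j * q powi k j" "\<lambda>j. b j * q powi l j"
    using s by (intro shift_params) auto
  have al: "s.a_lat = a_lat"
    unfolding a_lat_def s.a_lat_def
    by (simp only: inverse_mult_distrib power_int_minus[symmetric] lattice_shift)
  have p: "b j * q powi m = b j * q powi l j * q powi (m - l j)" for j m
    by (simp add: power_int_diff)
  have bij: "bij_betw (\<lambda>m. m - l j) UNIV UNIV" for j
    by (rule bij_betwI[of _ _ _ "\<lambda>m. m + l j"]) auto
  have pm: "{1, 2, 3} = {1..3::nat}" "{2, 3, 1} = {1..3::nat}" by auto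
  have D: "h_const l * s.Delta i j m = K_value q a b k l * Delta i j m"
    if "{i, j, m} = {1..3::nat}" "i \<noteq> j" "j \<noteq> m" "i \<noteq> m" for i j m
    unfolding h_const_def by (rule Delta_shift[OF s that])
  show ?thesis
    unfolding K_data_def Lam_ext_def jsums_def
  proof (intro exI[of _ "\<lambda>v. h_const l * s.Lam v"] exI[of _ "\<lambda>j. h_const l * s.qsum s.Lam j"] conjI allI impI ballI)
    show "(\<lambda>v. h_const l * s.Lam v) analytic_on - a_lat"
      using s.Lam_analytic unfolding al by (intro analytic_on_mult analytic_on_const)
    show "(\<lambda>v. h_const l * s.Lam v) meromorphic_on UNIV"
      using s.Lam_meromorphic by (intro meromorphic_on_mult meromorphic_on_const)
    show "h_const l * s.Lam v = Lam v * rf_eval (h_fun q a b k l) v" if "v \<notin> a_lat \<union> b_lat \<union> {0}" for v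
      using Lam_h_fun[OF s that] by simp
    fix j :: nat assume j: "j \<in> {1..3}"
    have "((\<lambda>m. b j * q powi l j * q powi (m - l j) * s.Lam (b j * q powi l j * q powi (m - l j)))
        has_sum s.qsum s.Lam j) UNIV"
      by (rule has_sum_reindex_bij_betw[OF bij, THEN iffD2, OF s.Lam_has_sum(1)[OF j]])
    hence "((\<lambda>m. jterm s.Lam j m) has_sum s.qsum s.Lam j) UNIV"
      unfolding p[of j, symmetric] .
    from has_sum_cmult_right[OF this, of "h_const l"]
    show "((\<lambda>m::int. b j * q powi m * (h_const l * s.Lam (b j * q powi m))) has_sum h_const l * s.qsum s.Lam j) UNIV"
      unfolding mult.left_commute[of _ "h_const l"] .
    have "(\<lambda>m. norm (b j * q powi l j * q powi (m - l j) * s.Lam (b j * q powi l j * q powi (m - l j)))) summable_on UNIV"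
      by (rule summable_on_reindex_bij_betw[OF bij, THEN iffD2, OF s.Lam_has_sum(2)[OF j]])
    hence "(\<lambda>m. norm (jterm s.Lam j m)) summable_on UNIV"
      unfolding p[of j, symmetric] .
    from summable_on_cmult_right[OF this, of "norm (h_const l)"]
    show "(\<lambda>m::int. norm (b j * q powi m * (h_const l * s.Lam (b j * q powi m)))) summable_on UNIV"
      unfolding mult.left_commute[of _ "h_const l"] norm_mult[of "h_const l"] .
  next
    show "h_const l * s.qsum s.Lam 1 - h_const l * s.qsum s.Lam 2 = Delta 1 2 3 * K_value q a b k l"
      using D[of 1 2 3] pm s.saalschuetz[of 1 2 3] unfolding right_diff_distrib[symmetric] by (simp add: mult.commute)
    show "h_const l * s.qsum s.Lam 2 - h_const l * s.qsum s.Lam 3 = Delta 2 3 1 * K_value q a b k l"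
      using D[of 2 3 1] pm s.saalschuetz[of 2 3 1] unfolding right_diff_distrib[symmetric] by (simp add: mult.commute)
  qed
qed

text \<open>
  Balls in the complex plane are uncountable, so the complement of a countable set is dense.
\<close>

lemma (in -) eq_0_of_eq_0_off_countable:
  assumes A: "A analytic_on {p}" and C: "countable C" and z: "\<And>v. v \<notin> C \<Longrightarrow> A v = (0::complex)"
  shows "A p = 0"
proof (rule ccontr)
  assume "A p \<noteq> 0"
  moreover have "isCont A p" using A by (rule analytic_at_imp_isCont)
  ultimately obtain e where e: "e > 0" "\<And>v. dist p v < e \<Longrightarrow> A v \<noteq> 0"
    using continuous_at_avoid[of p A 0] by blast
  have "ball p e \<subseteq> C"
  proof
    fix v assume "v \<in> ball p e"
    hence "A v \<noteq> 0" by (intro e) simp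
    thus "v \<in> C" using z by blast
  qed
  hence "countable (ball p e)" using C countable_subset by blast
  thus False using uncountable_ball[OF e(1)] by blast
qed

text \<open>
  By linearity it suffices to treat \<open>f = 0\<close>. Then the extension vanishes off the lattices, hence by continuity
  also on the points of the Jackson sums.
\<close>

lemma K_data_unique:
  assumes W: "f \<in> W_space q a b" and "K_data f x" "K_data f y"
  shows "x = y"
proof -
  have "K_data (f + rf_const (- 1) * f) (x + (- 1) * y)"
    by (intro K_data_add K_data_const_mult W W_space_const_mult assms)
  moreover have "f + rf_const (- 1) * f = 0" by (simp add: rf_const_minus_1)
  ultimately have "K_data 0 (x - y)" by simp
  then obtain A I where A: "A analytic_on - a_lat"
    "\<And>v. v \<notin> a_lat \<union> b_lat \<union> {0} \<Longrightarrow> A v = Lam v * rf_eval 0 v"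
    "\<And>j. j \<in> {1..3} \<Longrightarrow> (jterm A j has_sum I j) UNIV"
    "I 1 - I 2 = Delta 1 2 3 * (x - y)"
    unfolding K_data_def Lam_ext_def jsums_def by blast
  have "rf_eval 0 v = 0" for v by (simp add: rf_eval_def rf_num_def)
  hence z: "A v = 0" if "v \<notin> a_lat \<union> b_lat \<union> {0}" for v using A(2)[OF that] by simp
  have "A p = 0" if "p \<in> b_lat" for p
  proof (rule eq_0_of_eq_0_off_countable[OF _ countable_lat z])
    show "A analytic_on {p}" using A(1) that a_lat_disjoint_b_lat by (auto intro: analytic_on_subset)
  qed
  hence "A (b j * q powi k) = 0" if "j \<in> {1..3}" for j k
    using that unfolding b_lat_def lattice_def by blast
  note Ab = this
  have I: "I j = 0" if "j \<in> {1..3}" for j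
  proof (rule has_sum_unique[OF A(3)[OF that]])
    show "(jterm A j has_sum 0) UNIV"
      using Ab[OF that] by (intro has_sum_0) simp
  qed
  have "Delta 1 2 3 \<noteq> 0" by (rule Delta_nz) auto
  thus ?thesis using A(4) I by simp
qed

lemma K_data_exists: "f \<in> W_space q a b \<Longrightarrow> \<exists>x. K_data f x"
proof -
  assume f: "f \<in> W_space q a b"
  have "f \<in> W_space q a b \<and> (\<exists>x. K_data f x)"
    using f
  proof (rule W_induct[where Q = "\<lambda>f. f \<in> W_space q a b \<and> (\<exists>x. K_data f x)"])
    fix k l :: "nat \<Rightarrow> int" assume "(\<Sum>j=1..3. k j) = - (\<Sum>j=1..3. l j)"
    thus "h_fun q a b k l \<in> W_space q a b \<and> (\<exists>x. K_data (h_fun q a b k l) x)"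
      using h_fun_in_W K_data_h_fun by blast
  next
    fix F G assume "F \<in> W_space q a b \<and> (\<exists>x. K_data F x)" "G \<in> W_space q a b \<and> (\<exists>x. K_data G x)"
    thus "F + G \<in> W_space q a b \<and> (\<exists>x. K_data (F + G) x)"
      using W_space_add K_data_add by metis
  next
    fix c F assume "F \<in> W_space q a b \<and> (\<exists>x. K_data F x)"
    thus "rf_const c * F \<in> W_space q a b \<and> (\<exists>x. K_data (rf_const c * F) x)"
      using W_space_const_mult K_data_const_mult by metis
  qed
  thus ?thesis by blast
qed

text \<open>
  The values given by \<open>K_data\<close> form a linear functional with the prescribed values on the spanning functions,
  and a linear functional is determined by those.
\<close>

theorem K_functional_K_data: "f \<in> W_space q a b \<Longrightarrow> K_data f (K_functional q a b f)"
proof -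
  assume f: "f \<in> W_space q a b"
  define L where "L = (\<lambda>f. if f \<in> W_space q a b then THE x. K_data f x else 0)"
  have L: "K_data f (L f)" if "f \<in> W_space q a b" for f
    unfolding L_def using that K_data_exists[OF that] K_data_unique[OF that]
    by (auto intro: theI')
  have LI: "L f = x" if "f \<in> W_space q a b" "K_data f x" for f x
    using K_data_unique L that by blast
  have is_K: "is_K_functional q a b L"
    unfolding is_K_functional_def
  proof (intro conjI allI impI ballI)
    fix F G assume FG: "F \<in> W_space q a b" "G \<in> W_space q a b"
    show "L (F + G) = L F + L G" by (intro LI W_space_add K_data_add L FG)
    fix c
    show "L (rf_const c * F) = c * L F" by (intro LI W_space_const_mult K_data_const_mult L FG)
  next
    fix k l :: "nat \<Rightarrow> int" assume "(\<Sum>j=1..3. k j) = - (\<Sum>j=1..3. l j)"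
    thus "L (h_fun q a b k l) = K_value q a b k l" by (intro LI h_fun_in_W K_data_h_fun)
  qed (auto simp: L_def)
  have "K_functional q a b = L"
    unfolding K_functional_def
  proof (rule the_equality)
    fix M assume M: "is_K_functional q a b M"
    have "F \<in> W_space q a b \<and> M F = L F" if "F \<in> W_space q a b" for F
      using that
    proof (rule W_induct[where Q = "\<lambda>F. F \<in> W_space q a b \<and> M F = L F"])
      fix k l :: "nat \<Rightarrow> int" assume "(\<Sum>j=1..3. k j) = - (\<Sum>j=1..3. l j)"
      thus "h_fun q a b k l \<in> W_space q a b \<and> M (h_fun q a b k l) = L (h_fun q a b k l)"
        using h_fun_in_W M is_K unfolding is_K_functional_def by metis
    next
      fix F G assume "F \<in> W_space q a b \<and> M F = L F" "G \<in> W_space q a b \<and> M G = L G"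
      thus "F + G \<in> W_space q a b \<and> M (F + G) = L (F + G)"
        using W_space_add M is_K unfolding is_K_functional_def by metis
    next
      fix c F assume "F \<in> W_space q a b \<and> M F = L F"
      thus "rf_const c * F \<in> W_space q a b \<and> M (rf_const c * F) = L (rf_const c * F)"
        using W_space_const_mult M is_K unfolding is_K_functional_def by metis
    qed
    thus "M = L" using M unfolding is_K_functional_def L_def by (intro ext) metis
  qed (rule is_K)
  thus ?thesis using L[OF f] by simp
qed

end


section \<open>Contour integrals with singularities accumulating at the origin\<close>

text \<open>
  The residue theorem for the difference of two loops around the hole of an annulus. The loops are joined
  by a cut that is traversed in both directions; around the resulting closed path the hole has winding
  number 0.
\<close>

lemma annulus_residues:
  fixes \<rho> r R :: real and F :: "complex \<Rightarrow> complex"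
  assumes r: "0 < \<rho>" "\<rho> < r" "r < R"
    and pts: "finite pts"
    and hol: "F holomorphic_on {z. \<rho> < norm z \<and> norm z < R} - pts"
    and \<gamma>: "valid_path \<gamma>" "pathfinish \<gamma> = pathstart \<gamma>" "path_image \<gamma> \<subseteq> {z. \<rho> < norm z \<and> norm z < R} - pts"
    and wind: "winding_number \<gamma> 0 = 1"
    and circ: "\<And>z. norm z = r \<Longrightarrow> z \<notin> pts"
  shows "contour_integral \<gamma> F - contour_integral (circlepath 0 r) F
    = 2 * pi * \<i> * (\<Sum>p\<in>pts. (winding_number \<gamma> p - winding_number (circlepath 0 r) p) * residue F p)"
proof -
  define S where "S = {z::complex. \<rho> < norm z \<and> norm z < R}"
  note hol = hol[folded S_def] and \<gamma> = \<gamma>(1,2) \<gamma>(3)[folded S_def]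
  have S_eq: "S = ball 0 R - cball 0 \<rho>" unfolding S_def by (auto simp: dist_norm)
  have oS: "open S" unfolding S_eq by (intro open_Diff) auto
  have cS: "connected S" unfolding S_def using connected_annulus(1)[where a = "0::complex"] by simp
  have oSp: "open (S - pts)" using oS pts by (intro open_Diff finite_imp_closed)
  have cSp: "connected (S - pts)" using oS cS pts by (intro connected_open_delete_finite) auto
  define C where "C = circlepath (0::complex) r"
  have C: "valid_path C" "pathfinish C = pathstart C" "path_image C \<subseteq> S - pts" "path_image C = sphere 0 r"
    unfolding C_def S_def using r circ by (auto simp: dist_norm)
  have "pathstart \<gamma> \<in> S - pts" "pathstart C \<in> S - pts"
    using \<gamma>(3) C(3) pathstart_in_path_image by blast+
  then obtain l where l: "polynomial_function l" "path_image l \<subseteq> S - pts" "pathstart l = pathstart \<gamma>" "pathfinish l = pathstart C"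
    using connected_open_polynomial_connected[OF oSp cSp] by blast
  have vl: "valid_path l" using l(1) by (rule valid_path_polynomial_function)
  \<comment> \<open>Once around the contour, along the cut, backwards around the circle, and back along the cut.\<close>
  define g where "g = \<gamma> +++ (l +++ (reversepath C +++ reversepath l))"
  have int: "F contour_integrable_on p" if "valid_path p" "path_image p \<subseteq> S - pts" for p
    using hol oSp that by (rule contour_integrable_holomorphic_simple)
  have v: "valid_path (reversepath C +++ reversepath l)" "valid_path (l +++ (reversepath C +++ reversepath l))"
    "valid_path g" "pathfinish g = pathstart g"
    unfolding g_def using C vl l \<gamma> by (auto intro!: valid_path_join)
  have im: "path_image (reversepath C +++ reversepath l) \<subseteq> S - pts"
    "path_image (l +++ (reversepath C +++ reversepath l)) \<subseteq> S - pts"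
    "path_image g \<subseteq> S - pts"
    unfolding g_def using C l \<gamma> by (auto simp: path_image_join)
  have ci: "contour_integral g F = contour_integral \<gamma> F - contour_integral C F"
  proof -
    have rv: "valid_path (reversepath C)" "valid_path (reversepath l)" using C vl by auto
    have rim: "path_image (reversepath C) \<subseteq> S - pts" "path_image (reversepath l) \<subseteq> S - pts" using C l by auto
    have "contour_integral g F = contour_integral \<gamma> F + (contour_integral l F + (contour_integral (reversepath C) F + contour_integral (reversepath l) F))"
      unfolding g_def
      by (subst contour_integral_join, (intro int \<gamma> v im)+)
        (subst contour_integral_join, (intro int vl l v im)+,
          subst contour_integral_join, (intro int rv rim)+, simp)
    thus ?thesis using C vl by (simp add: contour_integral_reversepath)
  qed
  have wn: "winding_number g z = winding_number \<gamma> z - winding_number C z" if z: "z \<notin> S - pts" for z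
  proof -
    have ni: "z \<notin> path_image \<gamma>" "z \<notin> path_image l" "z \<notin> path_image C"
      "z \<notin> path_image (reversepath C +++ reversepath l)" "z \<notin> path_image (l +++ (reversepath C +++ reversepath l))"
      using z \<gamma>(3) l(2) C(3) im by auto
    have pa: "path \<gamma>" "path l" "path C" "path (reversepath C +++ reversepath l)" "path (l +++ (reversepath C +++ reversepath l))"
      using \<gamma> vl C v by (auto intro: valid_path_imp_path)
    have "winding_number g z = winding_number \<gamma> z + (winding_number l z + (winding_number (reversepath C) z + winding_number (reversepath l) z))"
      unfolding g_def using ni pa l C \<gamma>
      by (simp add: winding_number_join)
    thus ?thesis using ni pa by (simp add: winding_number_reversepath)
  qed
  have "\<forall>z. z \<notin> S \<longrightarrow> winding_number g z = 0"
  proof (intro allI impI)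
    fix z assume z: "z \<notin> S"
    hence w: "winding_number g z = winding_number \<gamma> z - winding_number C z" by (intro wn) auto
    consider "norm z \<le> \<rho>" | "norm z \<ge> R" using z unfolding S_def by fastforce
    thus "winding_number g z = 0"
    proof cases
      case 1
      have "winding_number \<gamma> 0 = winding_number \<gamma> z"
      proof (rule winding_number_eq)
        show "cball 0 \<rho> \<inter> path_image \<gamma> = {}" using \<gamma>(3) unfolding S_def by auto
      qed (use \<gamma> 1 r in \<open>auto intro: valid_path_imp_path\<close>)
      moreover have "winding_number C z = 1"
        unfolding C_def using 1 r by (intro winding_number_circlepath) auto
      ultimately show ?thesis using w wind by simp
    next
      case 2
      have "winding_number \<gamma> z = 0"
        using 2 \<gamma> unfolding S_def by (intro winding_number_zero_outside[of _ "ball 0 R"]) (auto intro: valid_path_imp_path)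
      moreover have "winding_number C z = 0"
        using 2 C r unfolding C_def by (intro winding_number_zero_outside[of _ "ball 0 R"]) auto
      ultimately show ?thesis using w by simp
    qed
  qed
  hence "contour_integral g F = 2 * pi * \<i> * (\<Sum>p\<in>pts. winding_number g p * residue F p)"
    using v im hol pts oS cS by (intro Residue_theorem[of S])
  also have "(\<Sum>p\<in>pts. winding_number g p * residue F p) = (\<Sum>p\<in>pts. (winding_number \<gamma> p - winding_number C p) * residue F p)"
    by (intro sum.cong) (auto simp: wn)
  finally show ?thesis unfolding ci C_def .
qed

lemma has_sum_LIMSEQ:
  fixes f :: "'a \<Rightarrow> complex"
  assumes "(f has_sum S) B" and fin: "\<And>n. finite (A n)" "\<And>n. A n \<subseteq> B"
    and ev: "\<And>x. x \<in> B \<Longrightarrow> eventually (\<lambda>n. x \<in> A n) sequentially"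
  shows "(\<lambda>n. \<Sum>x\<in>A n. f x) \<longlonglongrightarrow> S"
proof -
  have "filterlim A (finite_subsets_at_top B) sequentially"
    unfolding filterlim_iff eventually_finite_subsets_at_top
  proof (intro allI impI, elim exE conjE)
    fix Q X assume X: "finite X" "X \<subseteq> B" and Q: "\<forall>Y. finite Y \<and> X \<subseteq> Y \<and> Y \<subseteq> B \<longrightarrow> Q Y"
    have "eventually (\<lambda>n. \<forall>x\<in>X. x \<in> A n) sequentially"
      using X ev by (intro eventually_ball_finite) auto
    thus "eventually (\<lambda>n. Q (A n)) sequentially"
    proof eventually_elim
      case (elim n)
      hence "X \<subseteq> A n" by blast
      thus "Q (A n)" using Q fin by blast
    qed
  qed
  thus ?thesis using assms(1) unfolding has_sum_def by (rule filterlim_compose[rotated])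
qed

text \<open>
  Points of \<open>Sing\<close> at which \<open>J\<close> has a removable singularity may lie anywhere, even on the contour. The proof
  therefore passes to \<open>remove_sings J\<close>, whose integral is the same since the two functions differ at only
  finitely many points of the contour. As \<open>n\<close> grows, the circles of radius \<open>r n\<close> exhaust the poles near 0.
\<close>

lemma contour_integral_eq_residue_sum:
  fixes J :: "complex \<Rightarrow> complex"
  assumes mero: "J meromorphic_on - {0}"
    and ana: "J analytic_on - {0} - Sing"
    and fin: "\<And>r R. 0 < r \<Longrightarrow> finite {z\<in>Sing. r \<le> norm z \<and> norm z \<le> R}"
    and Sing0: "0 \<notin> Sing"
    and \<gamma>: "valid_path \<gamma>" "simple_path \<gamma>" "pathfinish \<gamma> = pathstart \<gamma>"
      "0 \<in> inside (path_image \<gamma>)" "winding_number \<gamma> 0 = 1"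
    and BS: "B \<subseteq> Sing"
    and ins: "\<And>p. p \<in> B \<Longrightarrow> is_pole J p \<Longrightarrow> p \<in> inside (path_image \<gamma>)"
    and out: "\<And>p. p \<in> Sing - B \<Longrightarrow> is_pole J p \<Longrightarrow> p \<in> outside (path_image \<gamma>)"
    and r: "\<And>n. 0 < r n" "r \<longlonglongrightarrow> 0" "\<And>n z. norm z = r n \<Longrightarrow> z \<notin> Sing"
    and circ: "(\<lambda>n. contour_integral (circlepath 0 (r n)) J) \<longlonglongrightarrow> 0"
    and sum: "(residue J has_sum S) B"
  shows "contour_integral \<gamma> J = 2 * pi * \<i> * S"
proof -
  define F where "F = remove_sings J"
  have iso: "isolated_singularity_at J p" if "p \<noteq> 0" for p
    using that by (intro meromorphic_on_isolated_singularity meromorphic_on_subset[OF mero]) auto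
  have nm: "F nicely_meromorphic_on - {0}"
    unfolding F_def using mero by (rule remove_sings_nicely_meromorphic)
  have pole_iff: "is_pole F p \<longleftrightarrow> is_pole J p" if "p \<noteq> 0" for p
    unfolding F_def using iso[OF that] by (rule is_pole_remove_sings_iff)
  have Fana: "F analytic_on {p}" if "p \<noteq> 0" "\<not> is_pole J p" for p
    using that nm pole_iff by (intro nicely_meromorphic_on_imp_analytic_at[of F "- {0}"]) auto
  have resF: "residue F p = residue J p" if "p \<noteq> 0" for p
    unfolding F_def using iso[OF that] by (rule residue_remove_sings)
  have res0: "residue J p = 0" if np: "p \<noteq> 0" "\<not> is_pole J p" for p
  proof -
    obtain U where "open U" "p \<in> U" "F holomorphic_on U"
      using Fana[OF np] unfolding analytic_at by blast
    hence "residue F p = 0" by (rule residue_holo)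
    thus ?thesis using resF np by simp
  qed
  have FJ: "F p = J p" if "p \<noteq> 0" "p \<notin> Sing" for p
    unfolding F_def using that ana by (intro remove_sings_at_analytic) (auto intro: analytic_on_subset)
  have nopole: "\<not> is_pole J p" if "p \<noteq> 0" "p \<notin> Sing" for p
  proof -
    have "isCont J p" using that ana by (intro analytic_at_imp_isCont) (auto intro: analytic_on_subset)
    thus ?thesis by (metis isCont_def not_tendsto_and_filterlim_at_infinity at_neq_bot is_pole_def)
  qed
  have cl: "closed (path_image \<gamma>)" "compact (path_image \<gamma>)"
    using \<gamma>(1) by (auto intro: closed_path_image compact_path_image valid_path_imp_path)
  have img0: "0 \<notin> path_image \<gamma>" using \<gamma>(4) inside_no_overlap by fastforce
  \<comment> \<open>Poles in this ball, including those inside the small circle, have winding number 1 for both paths.\<close>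
  obtain \<delta> where \<delta>: "\<delta> > 0" "cball 0 \<delta> \<subseteq> inside (path_image \<gamma>)"
    using open_inside[OF cl(1)] \<gamma>(4) open_contains_cball by blast
  obtain R where R: "path_image \<gamma> \<union> inside (path_image \<gamma>) \<subseteq> ball 0 R"
  proof -
    have "bounded (path_image \<gamma> \<union> inside (path_image \<gamma>))"
      using cl(2) by (intro bounded_Un[THEN iffD2] conjI bounded_inside compact_imp_bounded)
    thus ?thesis using that bounded_subset_ballD by blast
  qed
  have \<delta>R: "\<delta> < R"
  proof -
    have "complex_of_real \<delta> \<in> cball 0 \<delta>" using \<delta>(1) by simp
    thus ?thesis using \<delta> R by fastforce
  qed
  have avoid: "\<delta> < norm z" if "z \<in> path_image \<gamma>" for z
  proof -
    have "z \<notin> cball 0 \<delta>" using that \<delta>(2) inside_no_overlap[of "path_image \<gamma>"] by blast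
    thus ?thesis by simp
  qed
  have nop_img: "\<not> is_pole J z" if "z \<in> path_image \<gamma>" for z
  proof
    assume p: "is_pole J z"
    have "z \<noteq> 0" using that img0 by auto
    hence "z \<in> Sing" using p nopole by blast
    hence "z \<in> inside (path_image \<gamma>) \<union> outside (path_image \<gamma>)" using p ins out by blast
    thus False using that inside_no_overlap[of "path_image \<gamma>"] outside_no_overlap[of "path_image \<gamma>"] by blast
  qed
  have int_eq: "contour_integral \<gamma> J = contour_integral \<gamma> F"
  proof (rule contour_integral_spike_finite_simple_path)
    have "Sing \<inter> path_image \<gamma> \<subseteq> {z\<in>Sing. \<delta> \<le> norm z \<and> norm z \<le> R}"
    proof
      fix z assume z: "z \<in> Sing \<inter> path_image \<gamma>"
      hence "norm z < R" using R by auto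
      thus "z \<in> {z\<in>Sing. \<delta> \<le> norm z \<and> norm z \<le> R}" using z avoid[of z] by auto
    qed
    thus "finite (Sing \<inter> path_image \<gamma>)" using fin[OF \<delta>(1)] finite_subset by blast
    show "J x = F x" if "x \<in> path_image \<gamma> - (Sing \<inter> path_image \<gamma>)" for x
      using that img0 FJ[of x] by (cases "x = 0") auto
  qed (use \<gamma> in auto)
  have in1: "winding_number \<gamma> z = 1" if "z \<in> inside (path_image \<gamma>)" for z
    using simple_closed_path_winding_number_inside[OF \<gamma>(2)] \<gamma>(4,5) that by (metis one_neq_neg_one)
  define A where "A = (\<lambda>n. {p\<in>B. is_pole J p \<and> r n < norm p \<and> norm p < R})"
  have finA: "finite (A n)" for n
    by (rule finite_subset[OF _ fin[OF r(1), of n R]]) (use BS in \<open>auto simp: A_def\<close>)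
  have key: "contour_integral \<gamma> F - contour_integral (circlepath 0 (r n)) J = 2 * pi * \<i> * (\<Sum>p\<in>A n. residue J p)"
    if n: "r n < \<delta>" for n
  proof -
    define pts where "pts = {p\<in>Sing. is_pole J p \<and> r n / 2 \<le> norm p \<and> norm p \<le> R}"
    have fp: "finite pts"
      by (rule finite_subset[OF _ fin[of "r n / 2" R]]) (use r(1)[of n] in \<open>auto simp: pts_def\<close>)
    have "contour_integral \<gamma> F - contour_integral (circlepath 0 (r n)) F
      = 2 * pi * \<i> * (\<Sum>p\<in>pts. (winding_number \<gamma> p - winding_number (circlepath 0 (r n)) p) * residue F p)"
    proof (rule annulus_residues[where \<rho> = "r n / 2" and R = R])
      show "F holomorphic_on {z. r n / 2 < norm z \<and> norm z < R} - pts"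
      proof (rule analytic_imp_holomorphic, subst analytic_on_analytic_at, intro ballI)
        fix z assume z: "z \<in> {z. r n / 2 < norm z \<and> norm z < R} - pts"
        hence z0: "z \<noteq> 0" using r(1)[of n] by auto
        have "\<not> is_pole J z" using z nopole[OF z0] by (auto simp: pts_def)
        thus "F analytic_on {z}" using Fana z0 by blast
      qed
      show "path_image \<gamma> \<subseteq> {z. r n / 2 < norm z \<and> norm z < R} - pts"
      proof
        fix z assume z: "z \<in> path_image \<gamma>"
        have "norm z < R" using z R by auto
        moreover have "r n / 2 < norm z" using avoid[OF z] n r(1)[of n] by simp
        ultimately show "z \<in> {z. r n / 2 < norm z \<and> norm z < R} - pts"
          using nop_img[OF z] by (auto simp: pts_def)
      qed
      show "z \<notin> pts" if "norm z = r n" for z using r(3)[OF that] by (simp add: pts_def)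
    qed (use r(1)[of n] n \<delta>R fp \<gamma> in auto)
    also have "contour_integral (circlepath 0 (r n)) F = contour_integral (circlepath 0 (r n)) J"
    proof (rule contour_integral_eq)
      fix z assume "z \<in> path_image (circlepath 0 (r n))"
      hence "norm z = r n" using r(1)[of n] by (simp add: dist_norm)
      thus "F z = J z" using r(1)[of n] r(3) by (intro FJ) auto
    qed
    also have "(\<Sum>p\<in>pts. (winding_number \<gamma> p - winding_number (circlepath 0 (r n)) p) * residue F p)
       = (\<Sum>p\<in>A n. residue J p)"
    proof (rule sum.mono_neutral_cong_right[OF fp])
      show "A n \<subseteq> pts" using BS r(1)[of n] by (auto simp: A_def pts_def)
      show "\<forall>p\<in>pts - A n. (winding_number \<gamma> p - winding_number (circlepath 0 (r n)) p) * residue F p = 0"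
      proof
        fix p assume p: "p \<in> pts - A n"
        hence pS: "p \<in> Sing" "is_pole J p" "norm p \<le> R" by (auto simp: pts_def)
        show "(winding_number \<gamma> p - winding_number (circlepath 0 (r n)) p) * residue F p = 0"
        proof (cases "norm p < r n")
          case True
          hence "p \<in> inside (path_image \<gamma>)" using n \<delta>(2) by (auto simp: subset_iff)
          moreover have "winding_number (circlepath 0 (r n)) p = 1"
            using True by (intro winding_number_circlepath) auto
          ultimately show ?thesis using in1 by simp
        next
          case False
          hence gt: "norm p > r n" using r(3)[of p n] pS by (cases "norm p = r n") auto
          have c0: "winding_number (circlepath 0 (r n)) p = 0"
            using gt r(1)[of n] by (intro winding_number_zero_outside[of _ "cball 0 (r n)"]) auto
          have "p \<in> outside (path_image \<gamma>)"
          proof (cases "p \<in> B")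
            case True
            hence "p \<in> inside (path_image \<gamma>)" using ins pS by blast
            hence "norm p < R" using R by auto
            with True p gt pS have False by (auto simp: A_def)
            thus ?thesis ..
          qed (use out pS in blast)
          hence "winding_number \<gamma> p = 0"
            using \<gamma> by (intro winding_number_zero_in_outside) (auto intro: valid_path_imp_path)
          thus ?thesis using c0 by simp
        qed
      qed
      fix p assume p: "p \<in> A n"
      hence "p \<in> inside (path_image \<gamma>)" "p \<noteq> 0" using ins r(1)[of n] by (auto simp: A_def)
      moreover have "winding_number (circlepath 0 (r n)) p = 0"
        using p r(1)[of n] by (intro winding_number_zero_outside[of _ "cball 0 (r n)"]) (auto simp: A_def)
      ultimately show "(winding_number \<gamma> p - winding_number (circlepath 0 (r n)) p) * residue F p = residue J p"
        using in1 resF by simp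
    qed
    finally show ?thesis .
  qed
  have "(\<lambda>n. \<Sum>p\<in>A n. residue J p) \<longlonglongrightarrow> S"
  proof (rule has_sum_LIMSEQ)
    show "(residue J has_sum S) {p\<in>B. is_pole J p}"
    proof (rule has_sum_cong_neutral[THEN iffD1, OF _ _ _ sum])
      fix p assume "p \<in> B - {p\<in>B. is_pole J p}"
      thus "residue J p = 0" using BS Sing0 by (intro res0) auto
    qed auto
    fix p assume p: "p \<in> {p\<in>B. is_pole J p}"
    hence "norm p < R" using ins R by fastforce
    moreover have "norm p > 0" using p BS Sing0 by auto
    hence "eventually (\<lambda>n. r n < norm p) sequentially" using r(2) by (rule order_tendstoD(2)[rotated])
    ultimately show "eventually (\<lambda>n. p \<in> A n) sequentially"
      using p by (auto simp: A_def elim!: eventually_mono)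
  qed (use finA in \<open>auto simp: A_def\<close>)
  hence "(\<lambda>n. contour_integral (circlepath 0 (r n)) J + 2 * pi * \<i> * (\<Sum>p\<in>A n. residue J p)) \<longlonglongrightarrow> 0 + 2 * pi * \<i> * S"
    by (intro tendsto_add circ tendsto_mult tendsto_const)
  moreover have "eventually (\<lambda>n. contour_integral (circlepath 0 (r n)) J + 2 * pi * \<i> * (\<Sum>p\<in>A n. residue J p) = contour_integral \<gamma> F) sequentially"
    using order_tendstoD(2)[OF r(2) \<delta>(1)] by eventually_elim (use key in \<open>simp add: algebra_simps\<close>)
  ultimately have "(\<lambda>n. contour_integral \<gamma> F) \<longlonglongrightarrow> 0 + 2 * pi * \<i> * S"
    by (rule Lim_transform_eventually)
  hence "contour_integral \<gamma> F = 0 + 2 * pi * \<i> * S" by (simp add: LIMSEQ_const_iff)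
  thus ?thesis unfolding int_eq by simp
qed


section \<open>The theta quotient\<close>

context q_base begin

lemma finite_powi_annulus:
  assumes "c \<noteq> 0" "0 < r"
  shows "finite {k::int. r \<le> norm (c * q powi k) \<and> norm (c * q powi k) \<le> R}"
proof -
  have "(\<lambda>n. norm c * norm q ^ n) \<longlonglongrightarrow> norm c * 0"
    using q_lt_1 by (intro tendsto_mult tendsto_const LIMSEQ_power_zero) auto
  hence "eventually (\<lambda>n. norm c * norm q ^ n < r) sequentially"
    using assms(2) by (intro order_tendstoD(2)[where y = "norm c * 0"]) auto
  then obtain n where n: "norm c * norm q ^ n < r" by (auto simp: eventually_sequentially)
  have "(\<lambda>n. R * norm q ^ n) \<longlonglongrightarrow> R * 0"
    using q_lt_1 by (intro tendsto_mult tendsto_const LIMSEQ_power_zero) auto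
  hence "eventually (\<lambda>n. R * norm q ^ n < norm c) sequentially"
    using assms(1) by (intro order_tendstoD(2)[where y = "R * 0"]) auto
  then obtain m where m: "R * norm q ^ m < norm c" by (auto simp: eventually_sequentially)
  have "{k::int. r \<le> norm (c * q powi k) \<and> norm (c * q powi k) \<le> R} \<subseteq> {- int m..int n}"
  proof (intro subsetI, elim CollectE conjE)
    fix k :: int assume k: "r \<le> norm (c * q powi k)" "norm (c * q powi k) \<le> R"
    have "k \<le> int n"
    proof (rule ccontr)
      assume "\<not> k \<le> int n"
      then obtain d where d: "k = int (n + d)" by (metis add.commute le_cases less_le linear nat_le_iff zle_iff_zadd of_nat_add)
      have "norm (c * q powi k) = norm c * norm q ^ n * norm q ^ d"
        unfolding d power_int_of_nat by (simp add: norm_mult norm_power power_add)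
      also have "\<dots> \<le> norm c * norm q ^ n"
        using q_lt_1 by (intro mult_right_le_one_le) (auto intro: power_le_one)
      finally show False using n k by simp
    qed
    moreover have "- int m \<le> k"
    proof (rule ccontr)
      assume "\<not> - int m \<le> k"
      hence "k \<le> - int m" by simp
      then obtain d where "- k = int m + int d" by (metis neg_le_iff_le minus_minus zle_iff_zadd)
      hence d: "k = - int (m + d)" by simp
      have "q powi k * q ^ (m + d) = 1" unfolding d power_int_minus power_int_of_nat by simp
      hence "norm c = norm (c * q powi k) * norm q ^ (m + d)"
        by (metis mult.assoc mult.right_neutral norm_mult norm_power)
      also have "\<dots> \<le> norm (c * q powi k) * norm q ^ m"
        using q_lt_1 by (intro mult_left_mono power_decreasing) auto
      also have "\<dots> \<le> R * norm q ^ m" using k by (intro mult_right_mono) auto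
      finally show False using m by simp
    qed
    ultimately show "k \<in> {- int m..int n}" by simp
  qed
  thus ?thesis by (rule finite_subset) simp
qed

lemma P_q_nz: "P q \<noteq> 0"
  unfolding P_eq_0_iff
proof
  assume "\<exists>n. q * q ^ n = 1"
  then obtain n where "q powi int (Suc n) = q powi 0" by (auto simp del: of_nat_Suc)
  thus False unfolding q_powi_inj by simp
qed

end

context q_params begin

lemma finite_lat_annulus:
  assumes "0 < r" shows "finite {z \<in> a_lat \<union> b_lat. r \<le> norm z \<and> norm z \<le> R}"
proof -
  have "{z \<in> a_lat \<union> b_lat. r \<le> norm z \<and> norm z \<le> R}
     \<subseteq> (\<Union>j\<in>{1..3}. (\<lambda>k. inverse (a j) * q powi k) ` {k. r \<le> norm (inverse (a j) * q powi k) \<and> norm (inverse (a j) * q powi k) \<le> R})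
     \<union> (\<Union>j\<in>{1..3}. (\<lambda>k. b j * q powi k) ` {k. r \<le> norm (b j * q powi k) \<and> norm (b j * q powi k) \<le> R})"
    unfolding a_lat_def b_lat_def lattice_def by blast
  moreover have "finite \<dots>"
    using a_nz b_nz assms by (intro finite_UnI finite_UN_I finite_imageI finite_powi_annulus) auto
  ultimately show ?thesis by (rule finite_subset)
qed

lemma lat_q_powi: "z * q powi n \<in> a_lat \<longleftrightarrow> z \<in> a_lat" "z * q powi n \<in> b_lat \<longleftrightarrow> z \<in> b_lat"
  unfolding a_lat_def b_lat_def by (rule lattice_q_powi)+

text \<open>
  The theta-function part of the integrand. By \<open>balanced\<close> it is multiplied by \<open>q ^ 2\<close> when \<open>u\<close> is replaced by
  \<open>qu\<close>, which governs both its residues along \<open>b\<^sub>jq\<^sup>m\<close> and its decay near 0.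
\<close>

definition Theta where "Theta u = (\<Prod>j=1..3. theta (a j * u) / theta (b j / u))"

lemma theta_b_div_nz: "j \<in> {1..3} \<Longrightarrow> u \<notin> b_lat \<Longrightarrow> u \<noteq> 0 \<Longrightarrow> theta (b j / u) \<noteq> 0"
  using b_div_not_range[of j u] b_nz[of j] by (subst theta_eq_0_iff) auto

lemma Theta_q_mult:
  assumes "u \<noteq> 0" shows "Theta (q * u) = q ^ 2 * Theta u"
proof -
  have 1: "theta (a j * (q * u)) / theta (b j / (q * u)) = q * (1 / (a j * b j)) * (theta (a j * u) / theta (b j / u))"
    if j: "j \<in> {1..3}" for j
  proof -
    have nz: "a j \<noteq> 0" "b j \<noteq> 0" using a_nz b_nz j by auto
    have "theta (a j * (q * u)) = - theta (a j * u) / (a j * u)"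
      using theta_q_mult[of "a j * u"] nz assms by (simp add: mult_ac)
    moreover have "theta (b j / u) = - theta (b j / (q * u)) / (b j / (q * u))"
      using theta_q_mult[of "b j / (q * u)"] nz assms by simp
    hence "theta (b j / (q * u)) = - (b j / (q * u)) * theta (b j / u)"
      using nz assms by simp
    ultimately show ?thesis using nz assms by (simp add: mult_ac)
  qed
  have "Theta (q * u) = (\<Prod>j=1..3. q * (1 / (a j * b j)) * (theta (a j * u) / theta (b j / u)))"
    unfolding Theta_def using 1 by (intro prod.cong refl) auto
  also have "\<dots> = q ^ 3 / ((\<Prod>j=1..3. a j) * (\<Prod>j=1..3. b j)) * Theta u"
    unfolding Theta_def prod.distrib prod_dividef by simp
  also have "q ^ 3 / ((\<Prod>j=1..3. a j) * (\<Prod>j=1..3. b j)) = q ^ 2"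
    unfolding balanced by (simp add: power3_eq_cube power2_eq_square)
  finally show ?thesis .
qed

lemma Theta_q_powi:
  assumes "u \<noteq> 0" shows "Theta (u * q powi n) = q powi (2 * n) * Theta u"
proof -
  have step: "Theta (u * q powi (n + 1)) = q ^ 2 * Theta (u * q powi n)" for n
    using Theta_q_mult[of "u * q powi n"] assms by (simp add: power_int_add mult_ac)
  have q2: "q powi (2 * (n + 1)) = q ^ 2 * q powi (2 * n)" for n
    by (simp add: power_int_add distrib_left)
  show ?thesis
  proof (induction n rule: int_induct[where k = 0])
    case (step1 i)
    show ?case unfolding step q2 step1(2) by simp
  next
    case (step2 i)
    have "q ^ 2 * Theta (u * q powi (i - 1)) = q ^ 2 * (q powi (2 * (i - 1)) * Theta u)"
      using step[of "i - 1"] q2[of "i - 1"] step2(2) by simp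
    thus ?case by simp
  qed simp
qed

lemma Theta_analytic: "Theta analytic_on - {0} - b_lat"
proof -
  have "(\<lambda>u. \<Prod>j=1..3. theta (a j * u) / theta (b j / u)) analytic_on - {0} - b_lat"
    using a_nz b_nz theta_b_div_nz by (intro analytic_intros theta_analytic) auto
  thus ?thesis unfolding Theta_def .
qed

lemma Theta_meromorphic: "Theta meromorphic_on - {0}"
proof -
  have "(\<lambda>u. \<Prod>j=1..3. theta (a j * u) / theta (b j / u)) meromorphic_on - {0}"
    using a_nz b_nz
    by (intro meromorphic_on_prod meromorphic_on_divide analytic_on_imp_meromorphic_on theta_analytic analytic_intros) auto
  thus ?thesis unfolding Theta_def .
qed

text \<open>
  The cofactor of the simple pole of \<open>Theta (b j * w)\<close> at \<open>w = 1\<close>.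
\<close>

definition Theta_reg where
  "Theta_reg j w = (\<Prod>i=1..3. theta (a i * (b j * w))) / ((\<Prod>i\<in>{1..3}-{j}. theta (b i / (b j * w))) * (P (q / w) * P (q * w)))"

lemma Theta_near_pole:
  assumes "j \<in> {1..3}" "w \<noteq> 0" "w \<noteq> 1"
  shows "Theta (b j * w) = w * Theta_reg j w / (w - 1)"
proof -
  have "theta (b j / (b j * w)) = (1 - 1 / w) * (P (q / w) * P (q * w))"
    using b_nz[OF assms(1)] assms(2) P_rec[of "1 / w"] by (simp add: theta_def)
  also have "1 - 1 / w = (w - 1) / w" using assms by (simp add: field_simps)
  finally have t: "theta (b j / (b j * w)) = (w - 1) / w * (P (q / w) * P (q * w))" .
  have pr: "(\<Prod>i=1..3. theta (b i / (b j * w))) = theta (b j / (b j * w)) * (\<Prod>i\<in>{1..3}-{j}. theta (b i / (b j * w)))"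
    using assms by (intro prod.remove) auto
  have "N / ((w - 1) / w * Q * Y) = w * (N / (Y * Q)) / (w - 1)" for N Q Y
    using assms by (simp add: mult_ac)
  thus ?thesis unfolding Theta_def Theta_reg_def prod_dividef pr t .
qed

lemma Theta_reg_analytic: "j \<in> {1..3} \<Longrightarrow> Theta_reg j analytic_on {1}"
proof -
  assume j: "j \<in> {1..3}"
  have nz: "theta (b i / (b j * 1)) \<noteq> 0" if "i \<in> {1..3} - {j}" for i
    using bb_generic[of i j] b_nz j that by (subst theta_eq_0_iff) auto
  have "(\<lambda>w. (\<Prod>i=1..3. theta (a i * (b j * w))) / ((\<Prod>i\<in>{1..3}-{j}. theta (b i / (b j * w))) * (P (q / w) * P (q * w)))) analytic_on {1}"
    using a_nz b_nz j nz P_q_nz by (intro analytic_intros theta_analytic P_analytic) auto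
  thus ?thesis unfolding Theta_reg_def .
qed

lemma Theta_reg_1: "j \<in> {1..3} \<Longrightarrow> Theta_reg j 1 = b j ^ 2 * weight j / P q ^ 2"
  using b_nz[of j] by (simp add: Theta_reg_def weight_def power2_eq_square)

end


section \<open>The integrand, its residues and their sum\<close>

text \<open>
  For each \<open>x\<close> the residues are indexed by \<open>m\<close> with \<open>u = b\<^sub>jq\<^sup>m\<close> and \<open>v = b\<^sub>jq\<^sup>m\<^sup>-\<^sup>x\<close>. The substitution
  \<open>(x, m) \<mapsto> (m, m - x)\<close> makes the double sum a product.
\<close>

lemma has_sum_convolution:
  fixes f g :: "int \<Rightarrow> complex"
  assumes f: "(f has_sum F) UNIV" "(\<lambda>m. norm (f m)) summable_on UNIV"
    and g: "(g has_sum G) UNIV" "(\<lambda>m. norm (g m)) summable_on UNIV"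
  obtains h where "\<And>x. ((\<lambda>m. f m * g (m - x)) has_sum h x) UNIV" "(h has_sum F * G) UNIV"
proof -
  have "((\<lambda>(m, y). norm (f m) * norm (g y)) has_sum (\<Sum>\<^sub>\<infinity>m. norm (f m)) * (\<Sum>\<^sub>\<infinity>m. norm (g m))) (UNIV \<times> UNIV)"
  proof (rule has_sum_SigmaI)
    fix m show "((\<lambda>y. case (m, y) of (m, y) \<Rightarrow> norm (f m) * norm (g y)) has_sum norm (f m) * (\<Sum>\<^sub>\<infinity>m. norm (g m))) UNIV"
      unfolding prod.case by (intro has_sum_cmult_right has_sum_infsum g)
    show "((\<lambda>m. norm (f m) * (\<Sum>\<^sub>\<infinity>m. norm (g m))) has_sum (\<Sum>\<^sub>\<infinity>m. norm (f m)) * (\<Sum>\<^sub>\<infinity>m. norm (g m))) UNIV"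
      by (intro has_sum_cmult_left has_sum_infsum f)
    show "(\<lambda>(m, y). norm (f m) * norm (g y)) summable_on UNIV \<times> UNIV"
    proof (rule summable_on_SigmaI)
      fix m show "((\<lambda>y. case (m, y) of (m, y) \<Rightarrow> norm (f m) * norm (g y)) has_sum norm (f m) * (\<Sum>\<^sub>\<infinity>m. norm (g m))) UNIV"
        unfolding prod.case by (intro has_sum_cmult_right has_sum_infsum g)
      show "(\<lambda>m. norm (f m) * (\<Sum>\<^sub>\<infinity>m. norm (g m))) summable_on UNIV"
        by (intro summable_on_cmult_left f)
    qed auto
  qed
  hence "(\<lambda>z. norm (case z of (m, y) \<Rightarrow> f m * g y)) summable_on UNIV \<times> UNIV"
    by (auto simp: case_prod_unfold norm_mult dest: has_sum_imp_summable)
  hence s: "(\<lambda>(m, y). f m * g y) summable_on UNIV \<times> UNIV"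
    by (rule abs_summable_summable)
  have "((\<lambda>(m, y). f m * g y) has_sum F * G) (UNIV \<times> UNIV)"
  proof (rule has_sum_SigmaI[OF _ _ s])
    fix m show "((\<lambda>y. case (m, y) of (m, y) \<Rightarrow> f m * g y) has_sum f m * G) UNIV"
      unfolding prod.case by (intro has_sum_cmult_right g)
    show "((\<lambda>m. f m * G) has_sum F * G) UNIV" by (intro has_sum_cmult_left f)
  qed
  moreover have bij: "bij_betw (\<lambda>(x, m). (m, m - x)) (UNIV \<times> UNIV) (UNIV \<times> (UNIV :: int set))"
    by (rule bij_betwI[of _ _ _ "\<lambda>(m, y). (m - y, m)"]) auto
  ultimately have "((\<lambda>z. (\<lambda>(m, y). f m * g y) ((\<lambda>(x, m). (m, m - x)) z)) has_sum F * G) (UNIV \<times> UNIV)"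
    using has_sum_reindex_bij_betw[OF bij, of "\<lambda>(m, y). f m * g y" "F * G"] by blast
  hence t: "((\<lambda>(x, m). f m * g (m - x)) has_sum F * G) (UNIV \<times> UNIV)"
    by (simp add: case_prod_unfold)
  define h where "h = (\<lambda>x. \<Sum>\<^sub>\<infinity>m. f m * g (m - x))"
  have h: "((\<lambda>m. f m * g (m - x)) has_sum h x) UNIV" for x
    unfolding h_def using summable_on_SigmaD1[OF has_sum_imp_summable[OF t], of x] by (intro has_sum_infsum) auto
  show ?thesis
  proof (rule that[OF h])
    show "(h has_sum F * G) UNIV"
      by (rule has_sum_SigmaD[OF t]) (use h in auto)
  qed
qed

locale q_integrand = q_params q a b + p: q_params q a' b'
  for q a b a' b' +
  fixes s t :: complex and M N :: "nat \<Rightarrow> int" and f g :: ratfun and A C :: "complex \<Rightarrow> complex"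
  assumes s2: "s ^ 2 = q" and t_def: "t = (\<Prod>j=1..3. a j)"
    and a'_def: "a' = (\<lambda>j. a j * q powi M j)" and b'_def: "b' = (\<lambda>j. b j * q powi N j)"
    and sumM: "(\<Sum>j=1..3. M j) = 0" and sumN: "(\<Sum>j=1..3. N j) = 0"
    and A_ext: "Lam_ext f A" and C_ext: "p.Lam_ext g C"
begin

lemma A_analytic: "A analytic_on - a_lat" and A_meromorphic: "A meromorphic_on UNIV"
  and A_eq: "v \<notin> a_lat \<union> b_lat \<union> {0} \<Longrightarrow> A v = Lam v * rf_eval f v"
  using A_ext unfolding Lam_ext_def by auto

lemma C_analytic: "C analytic_on - p.a_lat" and C_meromorphic: "C meromorphic_on UNIV"
  and C_eq: "v \<notin> p.a_lat \<union> p.b_lat \<union> {0} \<Longrightarrow> C v = p.Lam v * rf_eval g v"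
  using C_ext unfolding p.Lam_ext_def by auto

lemma s_nz [simp]: "s \<noteq> 0"
  using s2 q_nz by (metis zero_power2)

lemma q_powi_s: "q powi n = s powi (2 * n)"
proof -
  have "s powi 2 = q" using s2 by simp
  thus ?thesis by (simp add: power_int_mult)
qed

lemma lat_eq: "p.a_lat = a_lat" "p.b_lat = b_lat"
  unfolding a_lat_def p.a_lat_def b_lat_def p.b_lat_def
  unfolding a'_def b'_def
  by (simp_all only: inverse_mult_distrib power_int_minus[symmetric] lattice_shift)

text \<open>
  The constant by which \<open>Theta\<close> changes when the \<open>b\<^sub>j\<close> in it are replaced by the shifted \<open>b'\<^sub>j\<close>.
\<close>

definition nu where "nu = (\<Prod>j=1..3. b j powi N j * q powi choose2 (N j))"

lemma nu_nz: "nu \<noteq> 0"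
  using b_nz by (auto simp: nu_def)

lemma prod_powi_sum_0: "x \<noteq> 0 \<Longrightarrow> (\<Sum>j=1..3. n j) = 0 \<Longrightarrow> (\<Prod>j=1..3. x powi n j) = (1 :: complex)"
  for n :: "nat \<Rightarrow> int"
proof -
  assume x: "x \<noteq> 0" and n: "(\<Sum>j=1..3. n j) = 0"
  have "x powi n 1 * x powi n 2 * x powi n 3 = x powi (n 1 + n 2 + n 3)"
    using x by (simp only: power_int_add simp_thms)
  also have "n 1 + n 2 + n 3 = 0" using n unfolding sum_1_3 .
  finally show ?thesis unfolding prod_1_3 by simp
qed

lemma theta_b'_div:
  assumes "u \<noteq> 0"
  shows "(\<Prod>j=1..3. theta (b j / u)) = nu * (\<Prod>j=1..3. theta (b' j / u))"
proof -
  have 1: "b j powi N j * q powi choose2 (N j) * theta (b' j / u) = (- u) powi N j * theta (b j / u)" if j: "j \<in> {1..3}" for j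
  proof -
    have th: "theta (b' j / u) = (- 1 / (b j / u)) powi N j * q powi (- choose2 (N j)) * theta (b j / u)"
      using theta_powi[of "b j / u" "N j"] b_nz[OF j] assms by (simp add: b'_def)
    have "- 1 / (b j / u) = - u / b j" by simp
    hence e: "(- 1 / (b j / u)) powi N j = (- u) powi N j / b j powi N j"
      by (simp only: power_int_divide_distrib)
    show ?thesis
      unfolding th e power_int_minus using b_nz[OF j] by simp
  qed
  have "nu * (\<Prod>j=1..3. theta (b' j / u)) = (\<Prod>j=1..3. (- u) powi N j * theta (b j / u))"
    unfolding nu_def prod.distrib[symmetric] using 1 by (intro prod.cong refl) auto
  also have "\<dots> = (\<Prod>j=1..3. theta (b j / u))"
    unfolding prod.distrib using prod_powi_sum_0[of "- u" N] assms sumN by simp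
  finally show ?thesis ..
qed

text \<open>
  The elementary factor of the integrand is exactly what quasi-periodicity requires to pass from
  \<open>theta (a\<^sub>jv)\<close> to \<open>theta (a\<^sub>ju)\<close>; all powers of \<open>u\<close> cancel, and \<open>q\<^sup>-\<^sup>x\<close> remains.
\<close>

lemma theta_cross_factor:
  assumes "u \<noteq> 0"
  shows "(- s / (t * (s powi (- x) * u) ^ 3)) powi x * (\<Prod>j=1..3. theta (a j * (u * q powi (- x))))
    = q powi (- x) * (\<Prod>j=1..3. theta (a j * u))"
proof -
  have th: "theta (a j * (u * q powi (- x))) = (- (a j * u)) powi x * q powi (- choose2 x - x) * theta (a j * u)"
    if j: "j \<in> {1..3}" for j
  proof -
    have nz: "a j * u \<noteq> 0" using a_nz[OF j] assms by simp
    have "theta (a j * u * q powi (- x)) = (- 1 / (a j * u)) powi (- x) * q powi (- choose2 (- x)) * theta (a j * u)"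
      using nz by (rule theta_powi)
    also have "(- 1 / (a j * u)) powi (- x) = (- (a j * u)) powi x"
    proof -
      have "- 1 / (a j * u) = inverse (- (a j * u))" by (simp add: divide_inverse)
      thus ?thesis by (simp only: power_int_inverse power_int_minus inverse_inverse_eq)
    qed
    also have "- choose2 (- x) = - choose2 x - x" by (simp add: choose2_minus)
    finally show ?thesis by (simp add: mult.assoc)
  qed
  have t0: "t \<noteq> 0" unfolding t_def using a_nz by auto
  have "(\<Prod>j=1..3. theta (a j * (u * q powi (- x))))
    = (\<Prod>j=1..3. (- (a j * u)) powi x * q powi (- choose2 x - x) * theta (a j * u))"
    using th by (intro prod.cong refl) auto
  also have "\<dots> = (- (t * u ^ 3)) powi x * (q powi (- choose2 x - x)) ^ 3 * (\<Prod>j=1..3. theta (a j * u))"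
  proof -
    have "(\<Prod>j=1..3. (- (a j * u)) powi x) = (- (t * u ^ 3)) powi x"
      unfolding t_def prod_1_3 power_int_mult_distrib[symmetric] by (simp add: power3_eq_cube mult_ac)
    thus ?thesis by (simp add: prod.distrib)
  qed
  finally have pr: "(\<Prod>j=1..3. theta (a j * (u * q powi (- x))))
    = (- (t * u ^ 3)) powi x * (q powi (- choose2 x - x)) ^ 3 * (\<Prod>j=1..3. theta (a j * u))" .
  have e1: "(- s / (t * (s powi (- x) * u) ^ 3)) powi x * (- (t * u ^ 3)) powi x = s powi (x + 3 * x * x)"
  proof -
    have "(- s / (t * (s powi (- x) * u) ^ 3)) * (- (t * u ^ 3)) = s * (s powi x) ^ 3"
      using assms t0 by (simp add: power_mult_distrib power_int_minus field_simps)
    also have "\<dots> = s powi (1 + 3 * x)"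
    proof -
      have e: "1 + 3 * x = 1 + x + x + x" by simp
      show ?thesis unfolding e
        by (simp only: power_int_add s_nz simp_thms power_int_1_right power3_eq_cube mult.assoc)
    qed
    finally have "((- s / (t * (s powi (- x) * u) ^ 3)) * (- (t * u ^ 3))) powi x = s powi ((1 + 3 * x) * x)"
      by (simp add: power_int_mult)
    also have "(1 + 3 * x) * x = x + 3 * x * x" by (simp add: distrib_right)
    finally show ?thesis unfolding power_int_mult_distrib .
  qed
  have e2: "(q powi (- choose2 x - x)) ^ 3 = s powi (- 3 * x * x - 3 * x)"
  proof -
    have "2 * (- choose2 x - x) = - x * x - x" using two_choose2[of x] by (simp add: algebra_simps)
    hence "q powi (- choose2 x - x) = s powi (- x * x - x)" unfolding q_powi_s by (rule arg_cong)
    hence "(q powi (- choose2 x - x)) ^ 3 = s powi ((- x * x - x) + (- x * x - x) + (- x * x - x))"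
      by (simp only: power_int_add s_nz simp_thms power3_eq_cube)
    also have "(- x * x - x) + (- x * x - x) + (- x * x - x) = - 3 * x * x - 3 * x" by simp
    finally show ?thesis .
  qed
  have "s powi (x + 3 * x * x) * s powi (- 3 * x * x - 3 * x) = s powi ((x + 3 * x * x) + (- 3 * x * x - 3 * x))"
    by (rule power_int_add[symmetric]) simp
  also have "(x + 3 * x * x) + (- 3 * x * x - 3 * x) = 2 * (- x)" by simp
  finally have e3: "s powi (x + 3 * x * x) * s powi (- 3 * x * x - 3 * x) = q powi (- x)"
    unfolding q_powi_s .
  have "(- s / (t * (s powi (- x) * u) ^ 3)) powi x * (\<Prod>j=1..3. theta (a j * (u * q powi (- x))))
    = ((- s / (t * (s powi (- x) * u) ^ 3)) powi x * (- (t * u ^ 3)) powi x) * (q powi (- choose2 x - x)) ^ 3 * (\<Prod>j=1..3. theta (a j * u))"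
    unfolding pr by (simp only: mult.assoc)
  thus ?thesis unfolding e1 e2 e3 .
qed

abbreviation J where "J \<equiv> integrand q s t a b M N f g"

definition factored where "factored x z = nu * q powi (- x) * Theta (s powi x * z) * A (s powi x * z * q powi (- x)) * C (s powi x * z) / (2 * of_real pi * \<i> * z)"

text \<open>
  By \<open>theta x = P x * P (q / x)\<close>, the infinite products in the integrand are \<open>Lam v\<close> and \<open>Lam' u\<close> times theta
  functions.
\<close>

lemma integrand_eq:
  assumes z: "z \<noteq> 0" and u: "s powi x * z \<notin> a_lat \<union> b_lat"
  shows "J x z = factored x z"
proof -
  define u v where "u = s powi x * z" and "v = u * q powi (- x)"
  have u0: "u \<noteq> 0" "v \<noteq> 0" using z by (simp_all add: u_def v_def)
  have ul: "u \<notin> a_lat" "u \<notin> b_lat" using u by (auto simp: u_def)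
  have vl: "v \<notin> a_lat" "v \<notin> b_lat" using ul unfolding v_def lat_q_powi by auto
  have vz: "v = s powi (- x) * z"
  proof -
    have "s powi x * q powi (- x) = s powi (x + 2 * (- x))"
      unfolding q_powi_s by (rule power_int_add[symmetric]) simp
    also have "x + 2 * (- x) = - x" by simp
    finally show ?thesis unfolding v_def u_def by (simp add: mult_ac)
  qed
  have zu: "z = s powi (- x) * u" by (simp add: u_def power_int_minus)
  have fac: "(P (q * s powi x / (a j * z)) * P (q * s powi (- x) * z / b j)) /
         (P (q powi M j * s powi x * a j * z) * P (q powi N j * s powi (- x) * b j / z))
     = (theta (a j * v) / theta (b' j / u)) * (P (q * v / b j) / P (a j * v)) * (P (q * u / b' j) / P (a' j * u))"
    if j: "j \<in> {1..3}" for j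
  proof -
    have r: "q * s powi x / (a j * z) = q / (a j * v)" "q * s powi (- x) * z / b j = q * v / b j"
      "q powi M j * s powi x * a j * z = a' j * u" "q powi N j * s powi (- x) * b j / z = b' j / u"
      unfolding a'_def b'_def vz u_def using z by (simp_all add: power_int_minus field_simps)
    have n1: "P (a j * v) \<noteq> 0" using a_mult_not_range[OF j vl(1)] by (rule P_nz)
    have "b' j / u \<notin> qZ" using p.b_div_not_range[OF j, of u] ul u0 lat_eq by auto
    hence "theta (b' j / u) \<noteq> 0" using p.b_nz[OF j] u0 by (subst theta_eq_0_iff) auto
    hence n2: "P (b' j / u) \<noteq> 0" "P (q * u / b' j) \<noteq> 0" unfolding theta_def by auto
    have t1: "theta (a j * v) = P (a j * v) * P (q / (a j * v))" by (simp add: theta_def)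
    have t2: "theta (b' j / u) = P (b' j / u) * P (q * u / b' j)" by (simp add: theta_def)
    show ?thesis unfolding r t1 t2 using n1 n2 by simp
  qed
  have prod: "(\<Prod>j=1..3. (P (q * s powi x / (a j * z)) * P (q * s powi (- x) * z / b j)) /
         (P (q powi M j * s powi x * a j * z) * P (q powi N j * s powi (- x) * b j / z)))
     = (\<Prod>j=1..3. theta (a j * v)) / (\<Prod>j=1..3. theta (b' j / u)) * Lam v * p.Lam u"
  proof -
    have "(\<Prod>j=1..3. (P (q * s powi x / (a j * z)) * P (q * s powi (- x) * z / b j)) /
         (P (q powi M j * s powi x * a j * z) * P (q powi N j * s powi (- x) * b j / z)))
      = (\<Prod>j=1..3. (theta (a j * v) / theta (b' j / u)) * (P (q * v / b j) / P (a j * v)) * (P (q * u / b' j) / P (a' j * u)))"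
      using fac by (intro prod.cong refl) auto
    thus ?thesis unfolding Lam_def p.Lam_def prod.distrib prod_dividef .
  qed
  have Af: "Lam v * rf_eval f v = A v" using vl u0 by (intro A_eq[symmetric]) auto
  have Cg: "p.Lam u * rf_eval g u = C u" using ul u0 lat_eq by (intro C_eq[symmetric]) auto
  have Th: "Theta u = (\<Prod>j=1..3. theta (a j * u)) / (nu * (\<Prod>j=1..3. theta (b' j / u)))"
    unfolding Theta_def prod_dividef theta_b'_div[OF u0(1)] ..
  have cr: "(- s / (t * z ^ 3)) powi x * (\<Prod>j=1..3. theta (a j * v)) = q powi (- x) * (\<Prod>j=1..3. theta (a j * u))"
    using theta_cross_factor[OF u0(1), of x] unfolding v_def[symmetric] zu[symmetric] .
  have "J x z = ((\<Prod>j=1..3. theta (a j * v)) / (\<Prod>j=1..3. theta (b' j / u)) * Lam v * p.Lam u) *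
      (- s / (t * z ^ 3)) powi x * rf_eval f v * rf_eval g u / (2 * of_real pi * \<i> * z)"
    unfolding integrand_def prod vz[symmetric] u_def[symmetric] ..
  also have "\<dots> = ((- s / (t * z ^ 3)) powi x * (\<Prod>j=1..3. theta (a j * v))) / (\<Prod>j=1..3. theta (b' j / u))
      * (Lam v * rf_eval f v) * (p.Lam u * rf_eval g u) / (2 * of_real pi * \<i> * z)"
    by (simp only: mult_ac times_divide_eq_left times_divide_eq_right)
  also have "\<dots> = nu * q powi (- x) * Theta u * A v * C u / (2 * of_real pi * \<i> * z)"
    unfolding cr Af Cg Th using nu_nz by simp
  finally show ?thesis unfolding factored_def u_def v_def .
qed

text \<open>
  In the variable \<open>u\<close> the candidates for poles are the two lattices; the integrand is a function of \<open>z\<close>, so they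
  are rescaled.
\<close>

definition Sing where "Sing x = {z. s powi x * z \<in> a_lat \<union> b_lat}"
definition Bs where "Bs x = {z. s powi x * z \<in> b_lat}"

lemma Sing_0: "0 \<notin> Sing x"
  using zero_not_lat by (auto simp: Sing_def)

lemma Sing_finite:
  assumes "0 < r" shows "finite {z \<in> Sing x. r \<le> norm z \<and> norm z \<le> R}"
proof -
  let ?c = "norm (s powi x)"
  have c: "?c > 0" by simp
  have "(\<lambda>z. s powi x * z) ` {z \<in> Sing x. r \<le> norm z \<and> norm z \<le> R}
     \<subseteq> {z \<in> a_lat \<union> b_lat. ?c * r \<le> norm z \<and> norm z \<le> ?c * R}"
    using c by (auto simp: Sing_def norm_mult intro: mult_left_mono)
  moreover have "finite {z \<in> a_lat \<union> b_lat. ?c * r \<le> norm z \<and> norm z \<le> ?c * R}"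
    using c assms by (intro finite_lat_annulus) simp
  ultimately have "finite ((\<lambda>z. s powi x * z) ` {z \<in> Sing x. r \<le> norm z \<and> norm z \<le> R})"
    by (rule finite_subset)
  thus ?thesis by (rule finite_imageD) (auto simp: inj_on_def)
qed

lemma eventually_not_Sing:
  assumes "p \<noteq> 0" shows "eventually (\<lambda>z. z \<noteq> 0 \<and> z \<notin> Sing x) (at p)"
proof -
  define T where "T = {z \<in> Sing x. norm p / 2 \<le> norm z \<and> norm z \<le> norm p + 1}"
  have T: "finite T" unfolding T_def using assms by (intro Sing_finite) simp
  define U where "U = {z. norm p / 2 < norm z \<and> norm z < norm p + 1} - (T - {p})"
  have U: "U = ball 0 (norm p + 1) - cball 0 (norm p / 2) - (T - {p})"
    unfolding U_def by auto
  have "open U" unfolding U using T by (intro open_Diff finite_imp_closed open_ball closed_cball) auto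
  moreover have "p \<in> U" using assms by (simp add: U_def)
  moreover have "z \<noteq> 0 \<and> z \<notin> Sing x" if "z \<in> U" "z \<noteq> p" for z
    using that unfolding U_def T_def by auto
  ultimately show ?thesis unfolding eventually_at_topological by blast
qed

lemma open_regular: "open (- {0} - Sing x)"
proof (subst open_subopen, intro ballI)
  fix z assume z: "z \<in> - {0} - Sing x"
  hence "eventually (\<lambda>w. w \<noteq> 0 \<and> w \<notin> Sing x) (nhds z)"
    using eventually_not_Sing[of z x] by (auto simp: eventually_nhds_conv_at)
  then obtain T where "open T" "z \<in> T" "\<And>w. w \<in> T \<Longrightarrow> w \<noteq> 0 \<and> w \<notin> Sing x"
    unfolding eventually_nhds by blast
  thus "\<exists>T. open T \<and> z \<in> T \<and> T \<subseteq> - {0} - Sing x" by (intro exI[of _ T]) auto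
qed

lemma integrand_analytic: "J x analytic_on - {0} - Sing x"
proof -
  have l: "(\<lambda>z. s powi x * z) analytic_on - {0} - Sing x" "(\<lambda>z. s powi x * z * q powi (- x)) analytic_on - {0} - Sing x"
    by (intro analytic_intros)+
  have 1: "(\<lambda>z. Theta (s powi x * z)) analytic_on - {0} - Sing x"
    using analytic_on_compose_gen[OF l(1) Theta_analytic] by (auto simp: o_def Sing_def)
  have 2: "(\<lambda>z. C (s powi x * z)) analytic_on - {0} - Sing x"
    using analytic_on_compose_gen[OF l(1) C_analytic] lat_eq by (auto simp: o_def Sing_def)
  have 3: "(\<lambda>z. A (s powi x * z * q powi (- x))) analytic_on - {0} - Sing x"
    using analytic_on_compose_gen[OF l(2) A_analytic] lat_q_powi by (auto simp: o_def Sing_def)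
  have "(\<lambda>z. factored x z) analytic_on - {0} - Sing x"
    unfolding factored_def by (intro analytic_intros 1 2 3) auto
  hence "factored x holomorphic_on - {0} - Sing x" by (simp add: analytic_imp_holomorphic)
  moreover have "factored x z = J x z" if "z \<in> - {0} - Sing x" for z
    using integrand_eq[of z x] that by (auto simp: Sing_def)
  ultimately have "J x holomorphic_on - {0} - Sing x" by (rule holomorphic_transform)
  thus ?thesis using open_regular by (simp add: analytic_on_open)
qed

lemma eventually_integrand_eq: "p \<noteq> 0 \<Longrightarrow> eventually (\<lambda>z. J x z = factored x z) (at p)"
proof -
  assume "p \<noteq> 0"
  from eventually_not_Sing[OF this, of x] show ?thesis
    by eventually_elim (auto intro!: integrand_eq simp: Sing_def)
qed

lemma integrand_meromorphic: "J x meromorphic_on - {0}"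
proof -
  have l: "(\<lambda>z. s powi x * z) analytic_on - {0}" "(\<lambda>z. s powi x * z * q powi (- x)) analytic_on - {0}"
    by (intro analytic_intros)+
  have "(\<lambda>z. Theta (s powi x * z)) meromorphic_on - {0}"
    by (rule meromorphic_on_compose[OF Theta_meromorphic l(1)]) auto
  moreover have "(\<lambda>z. C (s powi x * z)) meromorphic_on - {0}"
    by (rule meromorphic_on_compose[OF C_meromorphic l(1)]) auto
  moreover have "(\<lambda>z. A (s powi x * z * q powi (- x))) meromorphic_on - {0}"
    by (rule meromorphic_on_compose[OF A_meromorphic l(2)]) auto
  ultimately have "(\<lambda>z. factored x z) meromorphic_on - {0}"
    unfolding factored_def by (intro meromorphic_intros)
  thus ?thesis
    using eventually_integrand_eq by (subst meromorphic_on_cong[of _ _ "factored x" "- {0}"]) auto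
qed

text \<open>
  With \<open>w = z/p\<close> one has \<open>u = b\<^sub>jw q\<^sup>m\<close>, and \<open>Theta_q_powi\<close> reduces the pole at \<open>p\<close> to the pole of
  \<open>Theta (b\<^sub>jw)\<close> at \<open>w = 1\<close>. The exponent \<open>2m - x = m + (m - x)\<close> of \<open>q\<close> splits between the two Jackson terms.
\<close>

lemma residue_integrand:
  assumes j: "j \<in> {1..3}" and pu: "s powi x * p = b j * q powi m"
  shows "residue (J x) p = nu / P q ^ 2 / (2 * of_real pi * \<i>) * weight j *
    (jterm C j m * jterm A j (m - x))"
proof -
  have p0: "p \<noteq> 0" using pu b_nz[OF j] by auto
  define G where "G = (\<lambda>z. nu * q powi (- x) * q powi (2 * m) * Theta_reg j (z / p) * A (s powi x * z * q powi (- x)) * C (s powi x * z) / (2 * of_real pi * \<i>))"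
  have ev: "eventually (\<lambda>z. J x z = G z / (z - p) ^ Suc 0) (at p)"
    using eventually_not_Sing[OF p0, of x] eventually_neq_at_within[of p p UNIV]
  proof eventually_elim
    case (elim z)
    define w where "w = z / p"
    have w: "w \<noteq> 0" "w \<noteq> 1" using elim p0 by (auto simp: w_def)
    have u: "s powi x * z = b j * w * q powi m"
    proof -
      have "s powi x * z = s powi x * p * w" using p0 by (simp add: w_def)
      thus ?thesis unfolding pu by (simp add: mult_ac)
    qed
    have "Theta (s powi x * z) = q powi (2 * m) * (w * Theta_reg j w / (w - 1))"
      unfolding u using Theta_q_powi[of "b j * w" m] Theta_near_pole[OF j w] w b_nz[OF j] by simp
    moreover have "J x z = factored x z" using elim by (intro integrand_eq) (auto simp: Sing_def)
    moreover have k: "w / (w - 1) / z = 1 / (z - p)"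
      using p0 elim by (simp add: w_def divide_simps)
    ultimately have "J x z = nu * q powi (- x) * (q powi (2 * m) * (w * Theta_reg j w / (w - 1))) * A (s powi x * z * q powi (- x)) * C (s powi x * z) / (2 * of_real pi * \<i> * z)"
      by (simp add: factored_def)
    also have "\<dots> = (w / (w - 1) / z) * G z"
      unfolding G_def w_def[symmetric] by (simp add: mult_ac)
    finally show ?case unfolding k by simp
  qed
  have bl: "b j * q powi m \<in> b_lat" using j unfolding b_lat_def lattice_def by blast
  hence nal: "s powi x * p \<notin> a_lat" using a_lat_disjoint_b_lat pu by auto
  have l: "(\<lambda>z. s powi x * z) analytic_on {p}" "(\<lambda>z. s powi x * z * q powi (- x)) analytic_on {p}" "(\<lambda>z. z / p) analytic_on {p}"
    using p0 by (intro analytic_intros; simp)+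
  have 1: "(\<lambda>z. Theta_reg j (z / p)) analytic_on {p}"
    using analytic_on_compose_gen[OF l(3) Theta_reg_analytic[OF j]] p0 by (auto simp: o_def)
  have 2: "(\<lambda>z. C (s powi x * z)) analytic_on {p}"
    using analytic_on_compose_gen[OF l(1) C_analytic] nal lat_eq by (auto simp: o_def)
  have 3: "(\<lambda>z. A (s powi x * z * q powi (- x))) analytic_on {p}"
    using analytic_on_compose_gen[OF l(2) A_analytic] nal lat_q_powi by (auto simp: o_def)
  have "G analytic_on {p}"
    unfolding G_def by (intro analytic_intros 1 2 3) auto
  then obtain U where U: "open U" "p \<in> U" "G holomorphic_on U" unfolding analytic_at by blast
  have "residue (J x) p = residue (\<lambda>z. G z / (z - p) ^ Suc 0) p"
    using ev by (rule residue_cong) simp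
  also have "\<dots> = G p" using residue_holomorphic_over_power[OF U, of 0] by simp
  also have "G p = nu / P q ^ 2 / (2 * of_real pi * \<i>) * weight j *
    (jterm C j m * jterm A j (m - x))"
  proof -
    have q1: "b j * q powi m * q powi (- x) = b j * q powi (m - x)"
      by (simp add: power_int_diff power_int_minus divide_inverse)
    have q2: "q powi (- x) * q powi (2 * m) = q powi m * q powi (m - x)"
    proof -
      have "q powi (- x) * q powi (2 * m) = q powi (- x + 2 * m)" by (rule power_int_add[symmetric]) simp
      also have "- x + 2 * m = m + (m - x)" by simp
      also have "q powi \<dots> = q powi m * q powi (m - x)" by (rule power_int_add) simp
      finally show ?thesis .
    qed
    have "G p = nu * (q powi (- x) * q powi (2 * m)) * Theta_reg j 1 * A (b j * q powi (m - x)) * C (b j * q powi m) / (2 * of_real pi * \<i>)"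
      unfolding G_def pu q1 using p0 by (simp add: mult.assoc)
    thus ?thesis unfolding q2 Theta_reg_1[OF j] by (simp add: power2_eq_square mult_ac)
  qed
  finally show ?thesis .
qed

end


context q_integrand begin

text \<open>
  On the circle of radius \<open>\<rho> |q|\<^sup>n\<close> the factor \<open>Theta\<close> is \<open>q\<^sup>2\<^sup>n\<close> times its values on the circle of radius \<open>\<rho>\<close>, while
  the extensions \<open>A\<close> and \<open>C\<close> stay bounded near 0.
\<close>

lemma circle_integrals_vanish:
  obtains r :: "nat \<Rightarrow> real" where "\<And>n. 0 < r n" "r \<longlonglongrightarrow> 0" "\<And>n z. norm z = r n \<Longrightarrow> z \<notin> Sing x"
    "(\<lambda>n. contour_integral (circlepath 0 (r n)) (J x)) \<longlonglongrightarrow> 0"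
proof -
  have cS: "countable (Sing x)"
  proof -
    have "Sing x \<subseteq> (\<lambda>u. u / s powi x) ` (a_lat \<union> b_lat)"
    proof
      fix z assume "z \<in> Sing x"
      hence "s powi x * z \<in> a_lat \<union> b_lat" by (simp add: Sing_def)
      thus "z \<in> (\<lambda>u. u / s powi x) ` (a_lat \<union> b_lat)" by (rule image_eqI[rotated]) simp
    qed
    moreover have "countable (a_lat \<union> b_lat)" using countable_lat by (rule countable_subset[rotated]) auto
    ultimately show ?thesis using countable_image countable_subset by blast
  qed
  \<comment> \<open>The radii for which some circle meets a singularity form a countable set.\<close>
  define K where "K = (\<lambda>(z, n::nat). norm z / norm q ^ n) ` (Sing x \<times> UNIV)"
  have "countable K" unfolding K_def using cS by (intro countable_image countable_SIGMA) auto
  hence "uncountable ({1<..<2::real} - K)"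
    using uncountable_minus_countable uncountable_open_interval[of 1 "2::real"] by auto
  then obtain \<rho> where \<rho>: "1 < \<rho>" "\<rho> \<notin> K" by (metis DiffE countable_empty ex_in_conv greaterThanLessThan_iff)
  define r where "r = (\<lambda>n. \<rho> * norm q ^ n)"
  have r0: "0 < r n" for n using \<rho> q_pos by (simp add: r_def)
  have rl: "r \<longlonglongrightarrow> 0"
  proof -
    have "r \<longlonglongrightarrow> \<rho> * 0" unfolding r_def using q_lt_1 by (intro tendsto_intros LIMSEQ_power_zero) auto
    thus ?thesis by simp
  qed
  have rS: "z \<notin> Sing x" if "norm z = r n" for z n
  proof
    assume "z \<in> Sing x"
    hence "norm z / norm q ^ n \<in> K" unfolding K_def by (intro image_eqI[of _ _ "(z, n)"]) auto
    moreover have "norm z / norm q ^ n = \<rho>" using that q_pos by (simp add: r_def)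
    ultimately show False using \<rho> by simp
  qed
  have "compact ((\<lambda>z. Theta (s powi x * z)) ` sphere 0 \<rho>)"
  proof (rule compact_continuous_image)
    have "(\<lambda>z. Theta (s powi x * z)) analytic_on - {0} - Sing x"
      using analytic_on_compose_gen[OF _ Theta_analytic, of "\<lambda>z. s powi x * z" "- {0} - Sing x"]
      by (auto simp: o_def Sing_def intro!: analytic_intros)
    moreover have "sphere 0 \<rho> \<subseteq> - {0} - Sing x"
      using rS[of _ 0] \<rho> by (auto simp: r_def)
    ultimately show "continuous_on (sphere 0 \<rho>) (\<lambda>z. Theta (s powi x * z))"
      by (intro holomorphic_on_imp_continuous_on analytic_imp_holomorphic) (rule analytic_on_subset)
  qed auto
  hence "bounded ((\<lambda>z. Theta (s powi x * z)) ` sphere 0 \<rho>)" by (rule compact_imp_bounded)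
  then obtain T where "\<forall>y\<in>(\<lambda>z. Theta (s powi x * z)) ` sphere 0 \<rho>. norm y \<le> T"
    unfolding bounded_iff by blast
  hence T: "norm (Theta (s powi x * z)) \<le> T" if "norm z = \<rho>" for z using that by auto
  have bnd: "\<exists>d>0. \<forall>v. norm v < d \<longrightarrow> norm (F v) \<le> norm (F 0) + 1" if "F analytic_on {0}" for F :: "complex \<Rightarrow> complex"
  proof -
    have "isCont F 0" using that by (rule analytic_at_imp_isCont)
    then obtain d where d: "d > 0" "\<And>v. dist v 0 < d \<Longrightarrow> dist (F v) (F 0) < 1"
      unfolding continuous_at_eps_delta by (metis zero_less_one)
    have "norm (F v) \<le> norm (F 0) + 1" if "norm v < d" for v
      using d(2)[of v] that norm_triangle_sub[of "F v" "F 0"] by (simp add: dist_norm)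
    thus ?thesis using d(1) by blast
  qed
  obtain dA where dA: "dA > 0" "\<And>v. norm v < dA \<Longrightarrow> norm (A v) \<le> norm (A 0) + 1"
    using bnd[of A] A_analytic zero_not_lat by (auto intro: analytic_on_subset)
  obtain dC where dC: "dC > 0" "\<And>v. norm v < dC \<Longrightarrow> norm (C v) \<le> norm (C 0) + 1"
    using bnd[of C] C_analytic zero_not_lat lat_eq by (auto intro: analytic_on_subset)
  define c where "c = norm (s powi x)"
  define c' where "c' = norm (q powi (- x))"
  define Q where "Q = norm nu * c' * T * (norm (A 0) + 1) * (norm (C 0) + 1)"
  have T0: "T \<ge> 0" using T[of "of_real \<rho>"] \<rho> norm_ge_zero by (metis abs_of_pos less_trans norm_of_real order_trans zero_less_one)
  have Q0: "Q \<ge> 0" unfolding Q_def c'_def using T0 by simp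
  have "(\<lambda>n. c * r n) \<longlonglongrightarrow> c * 0" "(\<lambda>n. c * r n * c') \<longlonglongrightarrow> c * 0 * c'"
    by (intro tendsto_intros rl)+
  hence "eventually (\<lambda>n. c * r n < dC) sequentially" "eventually (\<lambda>n. c * r n * c' < dA) sequentially"
    using dA(1) dC(1) by (auto intro: order_tendstoD)
  hence ev: "eventually (\<lambda>n. norm (contour_integral (circlepath 0 (r n)) (J x)) \<le> Q * norm q ^ n) sequentially"
  proof eventually_elim
    case (elim n)
    define B where "B = Q * (norm q ^ n * norm q ^ n) / (2 * pi * r n)"
    have B0: "B \<ge> 0" unfolding B_def using Q0 r0[of n] by simp
    have "norm (J x z) \<le> B" if z: "norm z = r n" for z
    proof -
      have z0: "z \<noteq> 0" using z r0[of n] by auto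
      have zS: "z \<notin> Sing x" using rS[OF z] .
      define z1 where "z1 = z * q powi (- int n)"
      have z1: "norm z1 = \<rho>" using z q_pos by (simp add: z1_def norm_mult norm_inverse norm_power power_int_minus r_def)
      have zz: "s powi x * z = s powi x * z1 * q powi int n" by (simp add: z1_def power_int_minus)
      have "z1 \<noteq> 0" using z1 \<rho> by auto
      hence "Theta (s powi x * z) = q powi (2 * int n) * Theta (s powi x * z1)"
        unfolding zz by (intro Theta_q_powi) auto
      moreover have "norm (q powi (2 * int n)) = norm q ^ n * norm q ^ n"
      proof -
        have "q powi (2 * int n) = q powi int n * q powi int n"
          unfolding mult_2 by (rule power_int_add) simp
        thus ?thesis by (simp add: norm_mult norm_power)
      qed
      ultimately have th: "norm (Theta (s powi x * z)) \<le> norm q ^ n * norm q ^ n * T"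
        using T[OF z1] by (simp add: norm_mult mult_left_mono)
      have u: "norm (s powi x * z) = c * r n" by (simp add: norm_mult c_def z)
      have Cb: "norm (C (s powi x * z)) \<le> norm (C 0) + 1" using elim u by (intro dC) simp
      have "norm (s powi x * z * q powi (- x)) = c * r n * c'" unfolding norm_mult[of _ "q powi (- x)"] u c'_def ..
      hence Ab: "norm (A (s powi x * z * q powi (- x))) \<le> norm (A 0) + 1" using elim by (intro dA) simp
      have "J x z = factored x z" using z0 zS by (intro integrand_eq) (auto simp: Sing_def)
      hence "norm (J x z) = norm nu * c' * norm (Theta (s powi x * z)) * norm (A (s powi x * z * q powi (- x))) * norm (C (s powi x * z)) / (2 * pi * r n)"
        unfolding factored_def c'_def using z by (simp add: norm_mult norm_divide)
      also have "\<dots> \<le> norm nu * c' * (norm q ^ n * norm q ^ n * T) * (norm (A 0) + 1) * (norm (C 0) + 1) / (2 * pi * r n)"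
        using r0[of n] T0
        by (intro divide_right_mono mult_mono th Ab Cb mult_nonneg_nonneg order_refl norm_ge_zero) (auto simp: c'_def)
      also have "\<dots> = B" unfolding B_def Q_def by (simp add: mult_ac)
      finally show ?thesis .
    qed
    moreover have "J x contour_integrable_on circlepath 0 (r n)"
    proof (rule contour_integrable_holomorphic_simple[OF _ open_regular])
      show "J x holomorphic_on - {0} - Sing x" using integrand_analytic by (rule analytic_imp_holomorphic)
      show "path_image (circlepath 0 (r n)) \<subseteq> - {0} - Sing x"
        using rS r0[of n] by auto
    qed auto
    ultimately have "norm (contour_integral (circlepath 0 (r n)) (J x)) \<le> B * (2 * pi * r n)"
      using B0 r0[of n]
      by (intro has_contour_integral_bound_circlepath[OF has_contour_integral_integral]) auto
    also have "\<dots> = Q * norm q ^ n * norm q ^ n" unfolding B_def using r0[of n] by simp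
    also have "\<dots> \<le> Q * norm q ^ n"
      using q_lt_1 Q0 by (intro mult_right_le_one_le) (auto intro: power_le_one)
    finally show ?case .
  qed
  have "(\<lambda>n. Q * norm q ^ n) \<longlonglongrightarrow> Q * 0"
    using q_lt_1 by (intro tendsto_intros LIMSEQ_power_zero) auto
  hence "(\<lambda>n. Q * norm q ^ n) \<longlonglongrightarrow> 0" by simp
  from Lim_null_comparison[OF ev this] show ?thesis using that r0 rl rS by blast
qed

lemma contour_integral_integrand:
  assumes sep: "separating_contour q s a b x (J x) \<gamma>" and S: "(residue (J x) has_sum S) (Bs x)"
  shows "contour_integral \<gamma> (J x) = 2 * pi * \<i> * S"
proof -
  obtain r where r: "\<And>n. 0 < r n" "r \<longlonglongrightarrow> 0" "\<And>n z. norm z = r n \<Longrightarrow> z \<notin> Sing x"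
    "(\<lambda>n. contour_integral (circlepath 0 (r n)) (J x)) \<longlonglongrightarrow> 0"
    using circle_integrals_vanish[of x] by blast
  have solve: "p = y * s powi (- x) * w" if "s powi x * p = y * w" for p y w
  proof -
    have "p = s powi (- x) * (s powi x * p)" by (simp add: power_int_minus)
    thus ?thesis unfolding that by (simp add: mult_ac)
  qed
  show ?thesis
  proof (rule contour_integral_eq_residue_sum[OF integrand_meromorphic integrand_analytic Sing_finite Sing_0])
    show "valid_path \<gamma>" "simple_path \<gamma>" "pathfinish \<gamma> = pathstart \<gamma>"
      "0 \<in> inside (path_image \<gamma>)" "winding_number \<gamma> 0 = 1"
      using sep unfolding separating_contour_def by auto
    show "Bs x \<subseteq> Sing x" by (auto simp: Bs_def Sing_def)
    show "p \<in> inside (path_image \<gamma>)" if p: "p \<in> Bs x" "is_pole (J x) p" for p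
    proof -
      obtain j k where j: "j \<in> {1..3}" "s powi x * p = b j * q powi k"
        using p(1) unfolding Bs_def b_lat_def lattice_def by blast
      have "p = b j * s powi (- x) * q powi k" using solve[OF j(2)] .
      thus ?thesis using sep j(1) p(2) unfolding separating_contour_def by blast
    qed
    show "p \<in> outside (path_image \<gamma>)" if p: "p \<in> Sing x - Bs x" "is_pole (J x) p" for p
    proof -
      have "s powi x * p \<in> a_lat" using p(1) unfolding Bs_def Sing_def by blast
      then obtain j k where j: "j \<in> {1..3}" "s powi x * p = inverse (a j) * q powi k"
        unfolding a_lat_def lattice_def by blast
      have "p = inverse (a j) * s powi (- x) * q powi k" using solve[OF j(2)] .
      thus ?thesis using sep j(1) p(2) unfolding separating_contour_def by blast
    qed
  qed (use r S in auto)
qed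

lemma residue_sum:
  assumes h: "\<And>j. j \<in> {1..3} \<Longrightarrow> ((\<lambda>m. jterm C j m * jterm A j (m - x)) has_sum h j) UNIV"
  shows "(residue (J x) has_sum (\<Sum>j=1..3. nu / P q ^ 2 / (2 * of_real pi * \<i>) * weight j * h j)) (Bs x)"
proof -
  define pt where "pt = (\<lambda>j m. b j * s powi (- x) * q powi m)"
  have spt: "s powi x * pt j m = b j * q powi m" for j m
    by (simp add: pt_def power_int_minus)
  have one: "(residue (J x) has_sum (nu / P q ^ 2 / (2 * of_real pi * \<i>) * weight j * h j)) (range (pt j))"
    if j: "j \<in> {1..3}" for j
  proof -
    have "inj (pt j)" unfolding inj_def pt_def using b_nz[OF j] by (auto simp: q_powi_inj)
    moreover have "(residue (J x) \<circ> pt j) = (\<lambda>m. nu / P q ^ 2 / (2 * of_real pi * \<i>) * weight j *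
       (jterm C j m * jterm A j (m - x)))"
      unfolding o_def by (intro ext residue_integrand j spt)
    ultimately show ?thesis
      using has_sum_cmult_right[OF h[OF j], of "nu / P q ^ 2 / (2 * of_real pi * \<i>) * weight j"]
      by (subst has_sum_reindex) auto
  qed
  have disj: "range (pt i) \<inter> range (pt j) = {}" if "i \<in> {1..3}" "j \<in> {1..3}" "i \<noteq> j" for i j
  proof (rule ccontr)
    assume "\<not> ?thesis"
    then obtain m n where "pt i m = pt j n" by auto
    hence "b i * q powi m = b j * q powi n" using spt[of i m] spt[of j n] by simp
    hence "b i / b j = q powi (n - m)" using b_nz that by (simp add: power_int_diff field_simps)
    with bb_generic[OF that] show False by blast
  qed
  have Bs: "Bs x = range (pt 1) \<union> range (pt 2) \<union> range (pt 3)"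
  proof -
    have "Bs x = (\<Union>j\<in>{1..3}. range (pt j))"
    proof (intro equalityI subsetI)
      fix p assume "p \<in> Bs x"
      then obtain j m where j: "j \<in> {1..3}" "s powi x * p = b j * q powi m" unfolding Bs_def b_lat_def lattice_def by blast
      hence "s powi x * p = s powi x * pt j m" using spt by simp
      hence "p = pt j m" by simp
      thus "p \<in> (\<Union>j\<in>{1..3}. range (pt j))" using j by blast
    next
      fix p assume "p \<in> (\<Union>j\<in>{1..3}. range (pt j))"
      then obtain j m where "j \<in> {1..3}" "p = pt j m" by blast
      thus "p \<in> Bs x" unfolding Bs_def b_lat_def lattice_def using spt by blast
    qed
    also have "{1..3::nat} = {1, 2, 3}" by auto
    finally show ?thesis by auto
  qed
  show ?thesis
    unfolding Bs sum_1_3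
  proof (intro has_sum_Un_disjoint one)
    show "range (pt 1) \<inter> range (pt 2) = {}" by (rule disj) auto
    have "range (pt 1) \<inter> range (pt 3) = {}" "range (pt 2) \<inter> range (pt 3) = {}" by (rule disj; simp)+
    thus "(range (pt 1) \<union> range (pt 2)) \<inter> range (pt 3) = {}" by blast
  qed auto
qed

lemma total_constant:
  defines "c \<equiv> K_value q a b M N / nu"
  shows "nu / P q ^ 2 * (c * Gam ^ 2 * (\<Prod>i=1..3. \<Prod>j=1..3. theta (a i * b j)))
    = 1 / (\<Prod>j=1..3. q powi (choose2 (M j) + choose2 (N j)) * a j powi M j * b j powi N j) *
            (\<Prod>i=1..3. \<Prod>j=1..3. P (q / (a i * b j)) / P (a i * b j * q powi (M i + N j)))"
proof -
  define D where "D = (\<Prod>j=1..3. q powi (choose2 (M j) + choose2 (N j)) * a j powi M j * b j powi N j)"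
  define R where "R = (\<Prod>i=1..3. \<Prod>j=1..3. qpoch q (a i * b j) (M i + N j))"
  define S where "S = (\<Prod>i=1..3. \<Prod>j=1..3. P (a i * b j))"
  define T where "T = (\<Prod>i=1..3. \<Prod>j=1..3. theta (a i * b j))"
  have K: "K_value q a b M N = R / D"
    unfolding K_value_def Let_def sumM R_def D_def by simp
  have G: "Gam = P q / S" unfolding Gam_def S_def ..
  have e: "qpoch q x k * theta x / P x ^ 2 = P (q / x) / P (x * q powi k)" if "x \<notin> qZ" for x k
  proof -
    have nz: "P x \<noteq> 0" "P (x * q powi k) \<noteq> 0" using that by (auto intro!: P_nz powi_not_range)
    have "qpoch q x k = P x / P (x * q powi k)" using P_powi_step[OF that, of k] nz by (simp add: field_simps)
    thus ?thesis using nz by (simp add: theta_def power2_eq_square)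
  qed
  have "(\<Prod>i=1..3. \<Prod>j=1..3. P (q / (a i * b j)) / P (a i * b j * q powi (M i + N j)))
      = (\<Prod>i=1..3. \<Prod>j=1..3. qpoch q (a i * b j) (M i + N j) * theta (a i * b j) / P (a i * b j) ^ 2)"
    by (intro prod.cong refl e[symmetric] ab_generic)
  also have "\<dots> = R * T / S ^ 2"
    unfolding R_def S_def T_def prod_dividef prod.distrib prod_power_distrib ..
  finally have pr: "(\<Prod>i=1..3. \<Prod>j=1..3. P (q / (a i * b j)) / P (a i * b j * q powi (M i + N j))) = R * T / S ^ 2" .
  show ?thesis
    unfolding pr D_def[symmetric] T_def[symmetric] c_def K G using nu_nz P_q_nz
    by (simp add: power_divide)
qed

lemma sum_of_contour_integrals:
  assumes sep: "\<And>x. separating_contour q s a b x (J x) (\<gamma> x)"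
    and I: "jsums A I" "I 1 - I 2 = Delta 1 2 3 * y" "I 2 - I 3 = Delta 2 3 1 * y"
    and I': "p.jsums C I'" "I' 1 - I' 2 = p.Delta 1 2 3 * y'" "I' 2 - I' 3 = p.Delta 2 3 1 * y'"
  shows "((\<lambda>x. contour_integral (\<gamma> x) (J x)) has_sum
    (1 / (\<Prod>j=1..3. q powi (choose2 (M j) + choose2 (N j)) * a j powi M j * b j powi N j) *
            (\<Prod>i=1..3. \<Prod>j=1..3. P (q / (a i * b j)) / P (a i * b j * q powi (M i + N j))) * y * y')) UNIV"
proof -
  have bij: "bij_betw (\<lambda>m. m - N j) UNIV UNIV" for j
    by (rule bij_betwI[of _ _ _ "\<lambda>m. m + N j"]) auto
  have pt: "b' j * q powi (m - N j) = b j * q powi m" for j m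
    by (simp add: b'_def power_int_diff)
  have C0: "(p.jterm C j has_sum I' j) UNIV" "(\<lambda>k. norm (p.jterm C j k)) summable_on UNIV"
    if "j \<in> {1..3}" for j using I'(1) that unfolding p.jsums_def by auto
  have A0: "(jterm A j has_sum I j) UNIV" "(\<lambda>k. norm (jterm A j k)) summable_on UNIV"
    if "j \<in> {1..3}" for j using I(1) that unfolding jsums_def by auto
  have C1: "(jterm C j has_sum I' j) UNIV" if "j \<in> {1..3}" for j
    using has_sum_reindex_bij_betw[OF bij, THEN iffD2, OF C0(1)[OF that], of j] unfolding pt .
  have C2: "(\<lambda>k. norm (jterm C j k)) summable_on UNIV" if "j \<in> {1..3}" for j
    using summable_on_reindex_bij_betw[OF bij, THEN iffD2, OF C0(2)[OF that], of j] unfolding pt .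
  have "\<forall>j\<in>{1..3}. \<exists>h. (\<forall>x. ((\<lambda>m. jterm C j m * jterm A j (m - x)) has_sum h x) UNIV)
     \<and> (h has_sum (I' j * I j)) UNIV"
  proof
    fix j :: nat assume j: "j \<in> {1..3}"
    obtain h where "\<And>x. ((\<lambda>m. jterm C j m * jterm A j (m - x)) has_sum h x) UNIV"
      "(h has_sum (I' j * I j)) UNIV"
      by (rule has_sum_convolution[OF C1[OF j] C2[OF j] A0(1)[OF j] A0(2)[OF j]]) blast
    thus "\<exists>h. (\<forall>x. ((\<lambda>m. jterm C j m * jterm A j (m - x)) has_sum h x) UNIV)
     \<and> (h has_sum (I' j * I j)) UNIV" by blast
  qed
  from bchoice[OF this] obtain h where h: "\<And>j x. j \<in> {1..3} \<Longrightarrow> ((\<lambda>m. jterm C j m * jterm A j (m - x)) has_sum h j x) UNIV"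
    "\<And>j. j \<in> {1..3} \<Longrightarrow> (h j has_sum (I' j * I j)) UNIV"
    by blast
  have ci: "contour_integral (\<gamma> x) (J x) = nu / P q ^ 2 * (\<Sum>j=1..3. weight j * h j x)" for x
  proof -
    have "contour_integral (\<gamma> x) (J x) = 2 * pi * \<i> * (\<Sum>j=1..3. nu / P q ^ 2 / (2 * of_real pi * \<i>) * weight j * h j x)"
      by (intro contour_integral_integrand sep residue_sum h)
    thus ?thesis by (simp add: sum_distrib_left mult.assoc)
  qed
  define c where "c = K_value q a b M N / nu"
  have nu_eq: "(\<Prod>j=1..3. (- b j) powi N j * q powi choose2 (N j)) = nu"
    unfolding nu_def neg_powi[of "b _"] prod.distrib using prod_powi_sum_0[of "- 1" N] sumN by simp
  have pD: "p.Delta i j m = c * Delta i j m" if "{i, j, m} = {1..3::nat}" "i \<noteq> j" "j \<noteq> m" "i \<noteq> m" for i j m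
    using Delta_shift[of M N, OF _ that] sumM sumN nu_nz unfolding nu_eq a'_def[symmetric] b'_def[symmetric]
    by (simp add: c_def field_simps)
  have "{1, 2, 3} = {1..3::nat}" "{2, 3, 1} = {1..3::nat}" by auto
  hence "p.Delta 1 2 3 = c * Delta 1 2 3" "p.Delta 2 3 1 = c * Delta 2 3 1" by (intro pD; simp)+
  hence "(\<Sum>j=1..3. weight j * I j * I' j) = c * Gam ^ 2 * (\<Prod>i=1..3. \<Prod>j=1..3. theta (a i * b j)) * y * y'"
    using I(2,3) I'(2,3) by (intro weighted_sum) simp_all
  hence ws: "(\<Sum>j=1..3. weight j * (I' j * I j)) = c * Gam ^ 2 * (\<Prod>i=1..3. \<Prod>j=1..3. theta (a i * b j)) * y * y'"
    by (simp add: mult_ac)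
  have "((\<lambda>x. nu / P q ^ 2 * (\<Sum>j=1..3. weight j * h j x)) has_sum nu / P q ^ 2 * (\<Sum>j=1..3. weight j * (I' j * I j))) UNIV"
  proof (rule has_sum_cmult_right)
    show "((\<lambda>x. \<Sum>j=1..3. weight j * h j x) has_sum (\<Sum>j=1..3. weight j * (I' j * I j))) UNIV"
      unfolding sum_1_3 by (intro has_sum_add has_sum_cmult_right h) auto
  qed
  also have "nu / P q ^ 2 * (\<Sum>j=1..3. weight j * (I' j * I j))
    = nu / P q ^ 2 * (c * Gam ^ 2 * (\<Prod>i=1..3. \<Prod>j=1..3. theta (a i * b j))) * y * y'"
    unfolding ws by (simp only: mult.assoc)
  also note total_constant[folded c_def]
  finally show ?thesis unfolding ci .
qed

end

theorem proposition4p3: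
  fixes q s t :: complex
    and a b a' b' :: "nat \<Rightarrow> complex"
    and M N :: "nat \<Rightarrow> int"
    and f g :: ratfun
    and \<gamma> :: "int \<Rightarrow> real \<Rightarrow> complex"
  assumes "0 < norm q" "norm q < 1" "s ^ 2 = q"
    and "generic_params q a b"
    and "(\<Prod>j=1..3. a j) * (\<Prod>j=1..3. b j) = q"
    and "t = (\<Prod>j=1..3. a j)"
    and "(\<Sum>j=1..3. M j) = 0" "(\<Sum>j=1..3. N j) = 0"
    and "a' = (\<lambda>j. a j * q powi M j)" "b' = (\<lambda>j. b j * q powi N j)"
    and "f \<in> W_space q a b" "g \<in> W_space q a' b'"
    and "\<And>x. separating_contour q s a b x (integrand q s t a b M N f g x) (\<gamma> x)"
  shows "((\<lambda>x::int. contour_integral (\<gamma> x) (integrand q s t a b M N f g x)) has_sum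
           (1 / (\<Prod>j=1..3. q powi (choose2 (M j) + choose2 (N j)) * a j powi M j * b j powi N j) *
            (\<Prod>i=1..3. \<Prod>j=1..3.
               qpoch_inf q (q / (a i * b j)) / qpoch_inf q (a i * b j * q powi (M i + N j))) *
            K_functional q a b f * K_functional q a' b' g)) UNIV"
proof -
  interpret q_params q a b
    using assms by unfold_locales
  interpret p: q_params q a' b'
    using shift_params[of M N] assms(7-10) by simp
  obtain A I where A: "Lam_ext f A" and I: "jsums A I"
    "I 1 - I 2 = Delta 1 2 3 * K_functional q a b f" "I 2 - I 3 = Delta 2 3 1 * K_functional q a b f"
    using K_functional_K_data[OF assms(11)] unfolding K_data_def by blast
  obtain C I' where C: "p.Lam_ext g C" and I': "p.jsums C I'"
    "I' 1 - I' 2 = p.Delta 1 2 3 * K_functional q a' b' g" "I' 2 - I' 3 = p.Delta 2 3 1 * K_functional q a' b' g"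
    using p.K_functional_K_data[OF assms(12)] unfolding p.K_data_def by blast
  interpret q_integrand q a b a' b' s t M N f g A C
    using assms A C by unfold_locales auto
  show ?thesis
    by (rule sum_of_contour_integrals[OF assms(13) I I'])
qed

end
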